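(* Let $S(0),S(1),\ldots,S(n)$ be a simple symmetric nearest-neighbor random walk on $\mathbb{Z}^d$ started at $S(0)=0$, and let $R(n)=\{S(0),S(1),\ldots,S(n)\}$ be its range. For $d=2$ there exist constants $c_2,C_2>0$ such that for all integers $n\ge 2$, $$c_2\frac{n}{\log^2 n}\le H(R(n))\le C_2\frac{n}{\log^2 n}.$$ For every $d\ge 3$ there exist constants $c_d,C_d>0$ such that for all $n\in\mathbb{N}$, $$c_d\, n\le H(R(n))\le C_d\, n.$$
   Context: For a random variable $X$ taking values in a finite (or countable) set with $p(x)=\Pr[X=x]$, the entropy is $H(X)=\mathbb{E}[-\log p(X)]$, where all logarithms are base $2$. Here $R(n)$ is regarded as a random finite subset of $\mathbb{Z}^d$. *)

theory Defs
  imports "HOL-Probability.Probability"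
begin

text \<open>Points of Z^d are represented as integer lists of length d.\<close>

definition unit_step :: "nat \<Rightarrow> nat \<Rightarrow> int \<Rightarrow> int list" where
  "unit_step d i s = map (\<lambda>j. if j = i then s else 0) [0..<d]"

definition steps :: "nat \<Rightarrow> int list set" where
  "steps d = {unit_step d i s | i s. i < d \<and> (s = 1 \<or> s = -1)}"

definition vadd :: "int list \<Rightarrow> int list \<Rightarrow> int list" where
  "vadd xs ys = map2 (+) xs ys"

definition walk_pos :: "nat \<Rightarrow> int list list \<Rightarrow> nat \<Rightarrow> int list" where
  "walk_pos d xs k = foldl vadd (replicate d 0) (take k xs)"

definition walk_range :: "nat \<Rightarrow> int list list \<Rightarrow> nat \<Rightarrow> int list set" where
  "walk_range d xs n = {walk_pos d xs k | k. k \<le> n}"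

text \<open>Simple symmetric random walk: the n steps are i.i.d. uniform on the 2d unit steps,
  i.e. the step sequence is uniform among the (2d)^n sequences.\<close>
definition step_seqs :: "nat \<Rightarrow> nat \<Rightarrow> int list list set" where
  "step_seqs d n = {xs. length xs = n \<and> set xs \<subseteq> steps d}"

definition range_dist :: "nat \<Rightarrow> nat \<Rightarrow> int list set pmf" where
  "range_dist d n = map_pmf (\<lambda>xs. walk_range d xs n) (pmf_of_set (step_seqs d n))"

definition entropy2 :: "'a pmf \<Rightarrow> real" where
  "entropy2 p = measure_pmf.expectation p (\<lambda>x. - log 2 (pmf p x))"

end

(* Both bounds are instances of Gibbs' inequality.

   Lower bound: cut the walk into blocks of three steps. A block s, s, -s and a block s, -s, s started at
   y have the same end point, and only the first visits the apex y + 2s. If the rest of the walk avoids y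
   and the apex, the range reveals which of the two was used, while flipping the block changes nothing
   else; so each such block contributes one bit. Such a block occurs at a given time with probability
   bounded below for d >= 3 (transience) and of order 1 / log^2 n for d = 2 (last exit decomposition,
   applied to the past and to the future).

   Upper bound for d = 2: encode the range by a quadtree whose nodes are labelled empty, full or mixed;
   the code length is proportional to the number of mixed dyadic boxes. The expected number of boxes of
   side r hit by the walk is O(n / (r^2 log n)), and a box that is hit remains incompletely covered only if
   one of the first O(log r) rounds "run for a power of r steps, then return" fails, which has probability
   O(log^2 r / log n), up to a union bound over points that decays geometrically in the number of rounds.
   Hence there are O(n log^2 r / (r^2 log^2 n)) mixed boxes of side r, which is summable over dyadic r;
   for r >= log^2 n the trivial bound O(n / r) on the number of boxes visited suffices. *)

theory Submission
  imports Defs "HOL-Library.Function_Algebras" "HOL-Real_Asymp.Real_Asymp"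
begin

section \<open>Entropy of a function of a uniform variable\<close>

text \<open>The lower bound is not a decoding argument: the range does not show where the good
  blocks are. What holds is that two different walks obtained from each other by flipping good
  blocks never have the same range. Gibbs' inequality, with the number of flips as the weight of a
  walk, turns this into entropy. In the upper bound a plain union bound over a box would need about
  log log n further rounds to push the failure probability down to O(1 / log n), and would lose that
  factor on small boxes. For one fixed point the failures sum to O(log r / log n) regardless of the
  number of rounds, because a failed return matters only while the point is missing. So O(log r)
  rounds bring the expected number of missing points below 1, and these are then paid at the price
  of a single point. Neither limit theorems nor stopping times occur: planar transition
  probabilities are products of binomial ones, strong Markov arguments become induction on the first
  step, and for d >= 3 transience comes from an explicit superharmonic function.\<close>

lemma entropy2_map_uniform:
  assumes fin: "finite \<Omega>" and ne: "\<Omega> \<noteq> {}"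
  shows "entropy2 (map_pmf f (pmf_of_set \<Omega>)) =
    (\<Sum>x\<in>\<Omega>. log 2 (real (card \<Omega>) / real (card {y\<in>\<Omega>. f y = f x}))) / real (card \<Omega>)"
proof -
  have pm: "pmf (map_pmf f (pmf_of_set \<Omega>)) (f x) = real (card {y\<in>\<Omega>. f y = f x}) / real (card \<Omega>)" for x
  proof -
    have "\<Omega> \<inter> f -` {f x} = {y\<in>\<Omega>. f y = f x}" by auto
    then show ?thesis by (simp add: pmf_map measure_pmf_of_set[OF ne fin])
  qed
  have "entropy2 (map_pmf f (pmf_of_set \<Omega>)) =
     (\<Sum>x\<in>\<Omega>. - log 2 (real (card {y\<in>\<Omega>. f y = f x}) / real (card \<Omega>))) / real (card \<Omega>)"
    unfolding entropy2_def by (simp add: integral_pmf_of_set[OF ne fin] pm sum_negf)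
  also have "(\<Sum>x\<in>\<Omega>. - log 2 (real (card {y\<in>\<Omega>. f y = f x}) / real (card \<Omega>))) =
      (\<Sum>x\<in>\<Omega>. log 2 (real (card \<Omega>) / real (card {y\<in>\<Omega>. f y = f x})))"
  proof (rule sum.cong[OF refl])
    fix x assume "x \<in> \<Omega>"
    then have "card {y\<in>\<Omega>. f y = f x} > 0" "card \<Omega> > 0" using fin by (auto simp: card_gt_0_iff)
    then show "- log 2 (real (card {y\<in>\<Omega>. f y = f x}) / real (card \<Omega>)) =
      log 2 (real (card \<Omega>) / real (card {y\<in>\<Omega>. f y = f x}))"
      by (simp add: log_divide)
  qed
  finally show ?thesis .
qed

text \<open>Only the partition of the sample space into level sets enters the entropy, so a
  bijection that respects level sets preserves it.\<close>

lemma entropy2_map_uniform_bij: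
  assumes fin: "finite \<Omega>" and ne: "\<Omega> \<noteq> {}" and bij: "bij_betw g \<Omega> \<Omega>'"
    and eq: "\<And>x y. x \<in> \<Omega> \<Longrightarrow> y \<in> \<Omega> \<Longrightarrow> f x = f y \<longleftrightarrow> f' (g x) = f' (g y)"
  shows "entropy2 (map_pmf f (pmf_of_set \<Omega>)) = entropy2 (map_pmf f' (pmf_of_set \<Omega>'))"
proof -
  have fin': "finite \<Omega>'" and ne': "\<Omega>' \<noteq> {}" and cd: "card \<Omega>' = card \<Omega>"
    using bij fin ne bij_betw_finite[OF bij] bij_betw_same_card[OF bij] by (auto simp: bij_betw_def)
  have "card {y\<in>\<Omega>'. f' y = f' (g x)} = card {y\<in>\<Omega>. f y = f x}" if "x \<in> \<Omega>" for x
  proof -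
    have "{y\<in>\<Omega>'. f' y = f' (g x)} = g ` {y\<in>\<Omega>. f y = f x}"
      using bij eq that by (auto simp: bij_betw_def)
    moreover have "inj_on g {y\<in>\<Omega>. f y = f x}" using bij by (auto simp: bij_betw_def inj_on_def)
    ultimately show ?thesis by (simp add: card_image)
  qed
  then have "(\<Sum>x\<in>\<Omega>. log 2 (real (card \<Omega>) / real (card {y\<in>\<Omega>. f y = f x}))) =
     (\<Sum>x\<in>\<Omega>. log 2 (real (card \<Omega>') / real (card {y\<in>\<Omega>'. f' y = f' (g x)})))"
    by (simp add: cd)
  also have "\<dots> = (\<Sum>x\<in>\<Omega>'. log 2 (real (card \<Omega>') / real (card {y\<in>\<Omega>'. f' y = f' x})))"
    by (rule sum.reindex_bij_betw[OF bij])
  finally show ?thesis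
    by (simp add: entropy2_map_uniform[OF fin ne] entropy2_map_uniform[OF fin' ne'] cd)
qed

text \<open>On each fibre the numbers \<open>w x / card \<Omega>\<close> form a subprobability, so
  Gibbs' inequality bounds the conditional entropy of the sample point given \<open>f x\<close> by
  \<open>log 2 (card \<Omega>)\<close> minus the average of \<open>log 2 (w x)\<close>. Subtracting
  this from the total entropy \<open>log 2 (card \<Omega>)\<close> leaves the average.\<close>

lemma entropy2_ge_weight:
  fixes w :: "'a \<Rightarrow> real"
  assumes fin: "finite \<Omega>" and ne: "\<Omega> \<noteq> {}" and wpos: "\<And>x. x \<in> \<Omega> \<Longrightarrow> w x > 0"
    and fibre: "\<And>x. x \<in> \<Omega> \<Longrightarrow> (\<Sum>y | y \<in> \<Omega> \<and> f y = f x. w y) \<le> real (card \<Omega>)"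
  shows "(\<Sum>x\<in>\<Omega>. log 2 (w x)) / real (card \<Omega>) \<le> entropy2 (map_pmf f (pmf_of_set \<Omega>))"
proof -
  let ?N = "real (card \<Omega>)"
  define c where "c x = real (card {y\<in>\<Omega>. f y = f x})" for x
  have N: "?N > 0" using fin ne by (simp add: card_gt_0_iff)
  have cpos: "c x > 0" if "x \<in> \<Omega>" for x using that fin unfolding c_def by (auto simp: card_gt_0_iff)
  have pt: "log 2 (w x) \<le> log 2 (?N / c x) - (1 - c x * w x / ?N) / ln 2" if x: "x \<in> \<Omega>" for x
  proof -
    have pos: "c x * w x / ?N > 0" using cpos[OF x] wpos[OF x] N by simp
    have "ln (c x * w x / ?N) \<le> c x * w x / ?N - 1" by (rule ln_le_minus_one[OF pos])
    then have "log 2 (c x * w x / ?N) \<le> (c x * w x / ?N - 1) / ln 2"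
      by (simp add: log_def divide_right_mono)
    moreover have "log 2 (c x * w x / ?N) = log 2 (w x) - log 2 (?N / c x)"
      using cpos[OF x] wpos[OF x] N by (simp add: log_mult log_divide)
    ultimately show ?thesis by (simp add: diff_divide_distrib)
  qed
  \<comment> \<open>Double counting of pairs with equal image: \<open>c x\<close> counts the
    partners of \<open>x\<close>, and summing over \<open>x\<close> first gives a fibre sum.\<close>
  have "(\<Sum>x\<in>\<Omega>. c x * w x) = (\<Sum>x\<in>\<Omega>. \<Sum>y\<in>\<Omega>. if f y = f x then w x else 0)"
  proof (rule sum.cong[OF refl])
    fix x assume "x \<in> \<Omega>"
    have "(\<Sum>y\<in>\<Omega>. if f y = f x then w x else 0) = (\<Sum>y\<in>{y\<in>\<Omega>. f y = f x}. w x)"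
      by (rule sum.inter_filter[OF fin, symmetric])
    then show "c x * w x = (\<Sum>y\<in>\<Omega>. if f y = f x then w x else 0)" by (simp add: c_def)
  qed
  also have "\<dots> = (\<Sum>y\<in>\<Omega>. \<Sum>x\<in>\<Omega>. if f y = f x then w x else 0)" by (rule sum.swap)
  also have "\<dots> \<le> (\<Sum>y\<in>\<Omega>. ?N)"
  proof (rule sum_mono)
    fix y assume y: "y \<in> \<Omega>"
    have "(\<Sum>x\<in>\<Omega>. if f y = f x then w x else 0) = (\<Sum>x\<in>\<Omega>. if f x = f y then w x else 0)"
      by (rule sum.cong) auto
    also have "\<dots> = (\<Sum>x\<in>{x\<in>\<Omega>. f x = f y}. w x)" by (rule sum.inter_filter[OF fin, symmetric])
    finally show "(\<Sum>x\<in>\<Omega>. if f y = f x then w x else 0) \<le> ?N" using fibre[OF y] by simp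
  qed
  finally have tot: "(\<Sum>x\<in>\<Omega>. c x * w x) \<le> ?N * ?N" by simp
  have "(\<Sum>x\<in>\<Omega>. log 2 (w x)) \<le> (\<Sum>x\<in>\<Omega>. log 2 (?N / c x) - (1 - c x * w x / ?N) / ln 2)"
    by (rule sum_mono) (rule pt)
  also have "\<dots> = (\<Sum>x\<in>\<Omega>. log 2 (?N / c x)) - (?N - (\<Sum>x\<in>\<Omega>. c x * w x) / ?N) / ln 2"
    by (simp add: sum_subtractf sum_divide_distrib[symmetric] sum_distrib_left[symmetric])
  also have "\<dots> \<le> (\<Sum>x\<in>\<Omega>. log 2 (?N / c x))"
    using tot N by (simp add: field_simps)
  finally show ?thesis
    using N by (simp add: entropy2_map_uniform[OF fin ne] c_def divide_right_mono)
qed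

text \<open>Summing \<open>Q (f x) / c x\<close> over the sample space counts each value once, so
  the error terms of \<open>ln t \<le> t - 1\<close>, taken at the ratio of \<open>Q\<close> to the
  true probability, add up to at most zero.\<close>

lemma entropy2_le_code:
  fixes Q :: "'b \<Rightarrow> real"
  assumes fin: "finite \<Omega>" and ne: "\<Omega> \<noteq> {}" and Qpos: "\<And>x. x \<in> \<Omega> \<Longrightarrow> Q (f x) > 0"
    and Kraft: "(\<Sum>a\<in>f ` \<Omega>. Q a) \<le> 1"
  shows "entropy2 (map_pmf f (pmf_of_set \<Omega>)) \<le> (\<Sum>x\<in>\<Omega>. - log 2 (Q (f x))) / real (card \<Omega>)"
proof -
  let ?N = "real (card \<Omega>)"
  define c where "c x = real (card {y\<in>\<Omega>. f y = f x})" for x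
  have N: "?N > 0" using fin ne by (simp add: card_gt_0_iff)
  have cpos: "c x > 0" if "x \<in> \<Omega>" for x using that fin unfolding c_def by (auto simp: card_gt_0_iff)
  have pt: "log 2 (?N / c x) \<le> - log 2 (Q (f x)) + (?N * (Q (f x) / c x) - 1) / ln 2" if x: "x \<in> \<Omega>" for x
  proof -
    have pos: "?N * (Q (f x) / c x) > 0" using cpos[OF x] Qpos[OF x] N by simp
    have "ln (?N * (Q (f x) / c x)) \<le> ?N * (Q (f x) / c x) - 1" by (rule ln_le_minus_one[OF pos])
    then have "log 2 (?N * (Q (f x) / c x)) \<le> (?N * (Q (f x) / c x) - 1) / ln 2"
      by (simp add: log_def divide_right_mono)
    moreover have "log 2 (?N * (Q (f x) / c x)) = log 2 (Q (f x)) + log 2 (?N / c x)"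
      using cpos[OF x] Qpos[OF x] N by (simp add: log_mult log_divide)
    ultimately show ?thesis by simp
  qed
  have "(\<Sum>x\<in>\<Omega>. Q (f x) / c x) = (\<Sum>a\<in>f ` \<Omega>. \<Sum>x | x \<in> \<Omega> \<and> f x = a. Q (f x) / c x)"
    by (rule sum.image_gen[OF fin])
  also have "\<dots> = (\<Sum>a\<in>f ` \<Omega>. Q a)"
  proof (rule sum.cong[OF refl])
    fix a assume "a \<in> f ` \<Omega>"
    then obtain z where z: "z \<in> \<Omega>" "a = f z" by auto
    have "(\<Sum>x | x \<in> \<Omega> \<and> f x = a. Q (f x) / c x) = (\<Sum>x | x \<in> \<Omega> \<and> f x = a. Q a / c z)"
      by (rule sum.cong) (auto simp: c_def z)
    also have "\<dots> = c z * (Q a / c z)" by (simp add: c_def z)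
    finally show "(\<Sum>x | x \<in> \<Omega> \<and> f x = a. Q (f x) / c x) = Q a" using cpos[OF z(1)] by simp
  qed
  finally have tot: "(\<Sum>x\<in>\<Omega>. Q (f x) / c x) \<le> 1" using Kraft by simp
  have "(\<Sum>x\<in>\<Omega>. log 2 (?N / c x)) \<le> (\<Sum>x\<in>\<Omega>. - log 2 (Q (f x)) + (?N * (Q (f x) / c x) - 1) / ln 2)"
    by (rule sum_mono) (rule pt)
  also have "\<dots> = (\<Sum>x\<in>\<Omega>. - log 2 (Q (f x))) + (?N * (\<Sum>x\<in>\<Omega>. Q (f x) / c x) - ?N) / ln 2"
    by (simp only: sum.distrib sum_divide_distrib[symmetric] sum_subtractf sum_distrib_left[symmetric]) simp
  also have "\<dots> \<le> (\<Sum>x\<in>\<Omega>. - log 2 (Q (f x)))"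
    using mult_left_mono[OF tot, of ?N] N by (simp add: divide_nonpos_pos)
  finally show ?thesis
    using N by (simp add: entropy2_map_uniform[OF fin ne] c_def divide_right_mono del: sum_negf)
qed

lemma entropy2_le_log_card:
  assumes fin: "finite \<Omega>" and ne: "\<Omega> \<noteq> {}"
  shows "entropy2 (map_pmf f (pmf_of_set \<Omega>)) \<le> log 2 (real (card \<Omega>))"
proof -
  have N: "real (card (f ` \<Omega>)) > 0" using fin ne by (simp add: card_gt_0_iff)
  have "entropy2 (map_pmf f (pmf_of_set \<Omega>)) \<le>
      (\<Sum>x\<in>\<Omega>. - log 2 (1 / real (card (f ` \<Omega>)))) / real (card \<Omega>)"
    by (rule entropy2_le_code[OF fin ne, where Q = "\<lambda>_. 1 / real (card (f ` \<Omega>))"]) (use N in auto)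
  also have "\<dots> = log 2 (real (card (f ` \<Omega>)))" using fin ne N by (simp add: log_divide)
  also have "\<dots> \<le> log 2 (real (card \<Omega>))" using N card_image_le[OF fin, of f] by simp
  finally show ?thesis .
qed

lemma entropy2_pos:
  assumes fin: "finite \<Omega>" and x: "x \<in> \<Omega>" and y: "y \<in> \<Omega>" and xy: "f x \<noteq> f y"
  shows "entropy2 (map_pmf f (pmf_of_set \<Omega>)) > 0"
proof -
  have ne: "\<Omega> \<noteq> {}" using x by auto
  have N: "real (card \<Omega>) > 0" using fin ne by (simp add: card_gt_0_iff)
  have le: "real (card {y\<in>\<Omega>. f y = f z}) \<le> real (card \<Omega>)" for z
    using card_mono[OF fin, of "{y\<in>\<Omega>. f y = f z}"] by auto
  have pos: "card {y\<in>\<Omega>. f y = f z} > 0" if "z \<in> \<Omega>" for z using that fin by (auto simp: card_gt_0_iff)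
  have "(\<Sum>z\<in>\<Omega>. log 2 (real (card \<Omega>) / real (card {y\<in>\<Omega>. f y = f z}))) > 0"
  proof (rule sum_pos2[OF fin x])
    have "y \<notin> {y\<in>\<Omega>. f y = f x}" using xy by simp
    then have "{y\<in>\<Omega>. f y = f x} \<subset> \<Omega>" using y by blast
    then have "card {y\<in>\<Omega>. f y = f x} < card \<Omega>" by (rule psubset_card_mono[OF fin])
    then show "0 < log 2 (real (card \<Omega>) / real (card {y\<in>\<Omega>. f y = f x}))"
      using pos[OF x] by simp
  next
    fix z assume "z \<in> \<Omega>"
    then show "0 \<le> log 2 (real (card \<Omega>) / real (card {y\<in>\<Omega>. f y = f z}))"
      using pos[of z] le[of z] by simp
  qed
  then show ?thesis using N by (simp add: entropy2_map_uniform[OF fin ne])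
qed

section \<open>Averages over walks in an abelian group\<close>

text \<open>Averaging one step at a time, instead of over the set of step lists, makes first-step
  analysis a matter of unfolding; \<open>E_eq_sum\<close> recovers the uniform average.\<close>

primrec walk_avg :: "'a set \<Rightarrow> nat \<Rightarrow> ('a list \<Rightarrow> real) \<Rightarrow> real" where
  "walk_avg D 0 F = F []"
| "walk_avg D (Suc n) F = (\<Sum>s\<in>D. walk_avg D n (\<lambda>xs. F (s # xs))) / real (card D)"

primrec visited :: "'a::ab_group_add \<Rightarrow> 'a list \<Rightarrow> 'a set" where
  "visited x [] = {x}"
| "visited x (s # xs) = insert x (visited (x + s) xs)"

lemma finite_visited [simp]: "finite (visited x xs)"
  by (induction xs arbitrary: x) auto

lemma visited_start [simp]: "x \<in> visited x xs"
  by (cases xs) auto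

lemma visited_append: "visited x (xs @ ys) = visited x xs \<union> visited (x + sum_list xs) ys"
proof (induction xs arbitrary: x)
  case Nil
  then show ?case using visited_start[of x ys] by auto
next
  case (Cons s xs)
  then show ?case by (simp add: add.assoc)
qed

lemma visited_translate: "visited (t + x) xs = (+) t ` visited x xs"
  by (induction xs arbitrary: x) (auto simp: add.assoc)

lemma sum_list_map_uminus: "sum_list (map uminus xs) = - sum_list (xs :: 'a::ab_group_add list)"
  by (induction xs) auto

lemma visited_conv_take: "visited x xs = {x + sum_list (take k xs) | k. k \<le> length xs}"
proof (induction xs arbitrary: x)
  case (Cons s xs)
  have "{x + sum_list (take k (s # xs)) | k. k \<le> length (s # xs)} =
    insert x {x + s + sum_list (take k xs) | k. k \<le> length xs}" (is "?L = ?R")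
  proof
    show "?L \<subseteq> ?R"
    proof
      fix z assume "z \<in> ?L"
      then obtain k where "z = x + sum_list (take k (s # xs))" "k \<le> length (s # xs)" by auto
      then show "z \<in> ?R" by (cases k) (auto simp: add.assoc)
    qed
    show "?R \<subseteq> ?L"
    proof
      fix z assume "z \<in> ?R"
      then consider "z = x" | k where "z = x + s + sum_list (take k xs)" "k \<le> length xs" by auto
      then show "z \<in> ?L"
      proof cases
        case 1
        then have "z = x + sum_list (take 0 (s # xs)) \<and> 0 \<le> length (s # xs)" by simp
        then show ?thesis by blast
      next
        case (2 k)
        then have "z = x + sum_list (take (Suc k) (s # xs)) \<and> Suc k \<le> length (s # xs)"
          by (simp add: add.assoc)
        then show ?thesis by blast
      qed
    qed
  qed
  then show ?case using Cons by simp
qed simp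

text \<open>Two instances are wanted: pairs of integers for the plane, and integer-valued functions
  on \<open>nat\<close> when the dimension is a variable. Symmetry of \<open>D\<close> allows time
  reversal, point reflection and block flips.\<close>

locale sym_walk =
  fixes D :: "'a::ab_group_add set"
  assumes finite_D: "finite D" and D_nonempty: "D \<noteq> {}"
    and D_uminus: "s \<in> D \<Longrightarrow> - s \<in> D"
begin

abbreviation E :: "nat \<Rightarrow> ('a list \<Rightarrow> real) \<Rightarrow> real" where "E \<equiv> walk_avg D"

abbreviation walks :: "nat \<Rightarrow> 'a list set" where "walks n \<equiv> {xs. set xs \<subseteq> D \<and> length xs = n}"

lemma card_D_pos: "real (card D) > 0"
  using finite_D D_nonempty by (simp add: card_gt_0_iff)

lemma finite_walks [simp]: "finite (walks n)"
  by (rule finite_lists_length_eq[OF finite_D])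

lemma card_walks: "card (walks n) = card D ^ n"
  by (rule card_lists_length_eq[OF finite_D])

lemma walks_nonempty: "walks n \<noteq> {}"
proof -
  obtain s where "s \<in> D" using D_nonempty by auto
  then have "replicate n s \<in> walks n" by auto
  then show ?thesis by blast
qed

section \<open>Averages: linearity, independence of consecutive pieces, symmetries\<close>

lemma E_mono:
  assumes "\<And>xs. set xs \<subseteq> D \<Longrightarrow> length xs = n \<Longrightarrow> F xs \<le> G xs"
  shows "E n F \<le> E n G"
  using assms
proof (induction n arbitrary: F G)
  case (Suc n)
  have "E n (\<lambda>xs. F (s # xs)) \<le> E n (\<lambda>xs. G (s # xs))" if "s \<in> D" for s
    by (rule Suc.IH) (use Suc.prems that in auto)
  then show ?case using card_D_pos by (auto intro!: divide_right_mono sum_mono)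
qed simp

lemma E_cong:
  assumes "\<And>xs. set xs \<subseteq> D \<Longrightarrow> length xs = n \<Longrightarrow> F xs = G xs"
  shows "E n F = E n G"
  by (intro antisym E_mono) (simp_all add: assms)

lemma E_plus: "E n (\<lambda>xs. F xs + G xs) = E n F + E n G"
  by (induction n arbitrary: F G) (simp_all add: sum.distrib add_divide_distrib)

lemma E_cmult: "E n (\<lambda>xs. c * F xs) = c * E n F"
  by (induction n arbitrary: F) (simp_all add: sum_distrib_left)

lemma E_const [simp]: "E n (\<lambda>_. c) = c"
  using card_D_pos by (induction n) auto

lemma E_minus: "E n (\<lambda>xs. F xs - G xs) = E n F - E n G"
  using E_plus[of n F "\<lambda>xs. -1 * G xs"] E_cmult[of n "-1" G] by simp

lemma E_sum: "E n (\<lambda>xs. \<Sum>i\<in>I. F i xs) = (\<Sum>i\<in>I. E n (F i))"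
  by (induction I rule: infinite_finite_induct) (simp_all add: E_plus)

lemma E_append: "E (m + n) F = E m (\<lambda>xs. E n (\<lambda>ys. F (xs @ ys)))"
  by (induction m arbitrary: F) simp_all

lemma E_Suc_end: "E (Suc n) F = E n (\<lambda>xs. (\<Sum>s\<in>D. F (xs @ [s])) / real (card D))"
  using E_append[of n 1 F] by simp

lemma E_rev: "E n (\<lambda>xs. F (rev xs)) = E n F"
proof (induction n arbitrary: F)
  case (Suc n)
  have "E (Suc n) (\<lambda>xs. F (rev xs)) = E n (\<lambda>xs. (\<Sum>s\<in>D. F (s # rev xs)) / real (card D))"
    by (simp only: E_Suc_end rev_append rev.simps append.simps)
  also have "\<dots> = E n (\<lambda>xs. (\<Sum>s\<in>D. F (s # xs)) / real (card D))" by (rule Suc.IH)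
  also have "\<dots> = E (Suc n) F"
    using E_cmult[of n "1 / real (card D)" "\<lambda>xs. \<Sum>s\<in>D. F (s # xs)"]
    by (simp add: E_sum)
  finally show ?case .
qed simp

lemma sum_D_uminus: "(\<Sum>s\<in>D. h (- s)) = (\<Sum>s\<in>D. h s)"
  by (rule sum.reindex_bij_witness[of _ uminus uminus]) (auto simp: D_uminus)

lemma E_uminus: "E n (\<lambda>xs. F (map uminus xs)) = E n F"
proof (induction n arbitrary: F)
  case (Suc n)
  have "E (Suc n) (\<lambda>xs. F (map uminus xs)) = (\<Sum>s\<in>D. E n (\<lambda>xs. F (- s # xs))) / real (card D)"
    using Suc.IH[of "\<lambda>xs. F (- s # xs)" for s] by simp
  also have "\<dots> = E (Suc n) F"
    using sum_D_uminus[of "\<lambda>s. E n (\<lambda>xs. F (s # xs))"] by simp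
  finally show ?case .
qed simp

lemma E_eq_sum: "E n F = (\<Sum>xs\<in>walks n. F xs) / real (card (walks n))"
proof (induction n arbitrary: F)
  case 0
  have "walks 0 = {[]}" by auto
  then show ?case by simp
next
  case (Suc n)
  have inj: "inj_on (\<lambda>p. fst p # snd p) (D \<times> walks n)" by (auto simp: inj_on_def)
  have "walks (Suc n) = (\<lambda>p. fst p # snd p) ` (D \<times> walks n)"
    by (force simp: length_Suc_conv image_iff)
  then have "(\<Sum>xs\<in>walks (Suc n). F xs) = (\<Sum>p\<in>D \<times> walks n. F (fst p # snd p))"
    by (simp only: sum.reindex[OF inj] o_def)
  also have "\<dots> = (\<Sum>s\<in>D. \<Sum>xs\<in>walks n. F (s # xs))"
    by (simp add: sum.cartesian_product case_prod_unfold)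
  finally show ?case by (simp add: Suc.IH card_walks sum_divide_distrib mult.commute)
qed

lemma E_nonneg: "(\<And>xs. set xs \<subseteq> D \<Longrightarrow> length xs = n \<Longrightarrow> 0 \<le> F xs) \<Longrightarrow> 0 \<le> E n F"
  using E_mono[of n "\<lambda>_. 0" F] by simp

lemma E_le_const: "(\<And>xs. set xs \<subseteq> D \<Longrightarrow> length xs = n \<Longrightarrow> F xs \<le> c) \<Longrightarrow> E n F \<le> c"
  using E_mono[of n F "\<lambda>_. c"] by simp

lemma entropy2_walk_visited_le_code:
  fixes Q :: "'a set \<Rightarrow> real"
  assumes "\<And>xs. set xs \<subseteq> D \<Longrightarrow> length xs = n \<Longrightarrow> Q (visited 0 xs) > 0"
    and "(\<Sum>A\<in>visited 0 ` walks n. Q A) \<le> 1"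
  shows "entropy2 (map_pmf (visited 0) (pmf_of_set (walks n))) \<le> E n (\<lambda>xs. - log 2 (Q (visited 0 xs)))"
  unfolding E_eq_sum
  by (rule entropy2_le_code) (use assms walks_nonempty in auto)

subsection \<open>Avoiding and covering sets\<close>

definition p :: "nat \<Rightarrow> 'a \<Rightarrow> real" where
  "p n z = E n (\<lambda>xs. of_bool (sum_list xs = z))"

definition green :: "nat \<Rightarrow> 'a \<Rightarrow> real" where
  "green n z = (\<Sum>k\<le>n. p k z)"

definition avoid :: "nat \<Rightarrow> 'a \<Rightarrow> 'a set \<Rightarrow> real" where
  "avoid n x A = E n (\<lambda>xs. of_bool (visited x xs \<inter> A = {}))"

definition uncovered :: "nat \<Rightarrow> 'a \<Rightarrow> 'a set \<Rightarrow> real" where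
  "uncovered n x A = E n (\<lambda>xs. of_bool (\<not> A \<subseteq> visited x xs))"

text \<open>The walk from \<open>a\<close> avoids \<open>A\<close> at the times \<open>1, \<dots>, n\<close>; unlike in \<open>avoid\<close>, time \<open>0\<close> does not count.\<close>
fun escape :: "'a set \<Rightarrow> 'a \<Rightarrow> nat \<Rightarrow> real" where
  "escape A a 0 = 1"
| "escape A a (Suc n) = (\<Sum>s\<in>D. avoid n (a + s) A) / real (card D)"

lemma p_0: "p 0 z = of_bool (z = 0)"
  by (auto simp: p_def)

lemma p_Suc: "p (Suc n) z = (\<Sum>s\<in>D. p n (z - s)) / real (card D)"
proof -
  have "(s + t = z) = (t = z - s)" for s t :: 'a by (auto simp: algebra_simps)
  then show ?thesis by (simp add: p_def)
qed

lemma p_nonneg: "0 \<le> p n z"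
  unfolding p_def by (rule E_nonneg) simp

lemma p_le_1: "p n z \<le> 1"
  unfolding p_def by (rule E_le_const) simp

lemma sum_p_le_1: "finite A \<Longrightarrow> (\<Sum>z\<in>A. p n z) \<le> 1"
proof -
  assume A: "finite A"
  have "(\<Sum>z\<in>A. p n z) = E n (\<lambda>xs. \<Sum>z\<in>A. of_bool (sum_list xs = z))"
    unfolding p_def by (simp add: E_sum)
  also have "\<dots> \<le> 1"
  proof (rule E_le_const)
    fix xs :: "'a list"
    have "(\<Sum>z\<in>A. of_bool (sum_list xs = z) :: real) = (\<Sum>z\<in>A. if sum_list xs = z then 1 else 0)"
      by (rule sum.cong) auto
    then show "(\<Sum>z\<in>A. of_bool (sum_list xs = z) :: real) \<le> 1" using A by simp
  qed
  finally show ?thesis .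
qed

lemma green_nonneg: "0 \<le> green n z"
  unfolding green_def by (simp add: sum_nonneg p_nonneg)

lemma green_mono: "m \<le> n \<Longrightarrow> green m z \<le> green n z"
  unfolding green_def by (rule sum_mono2) (auto simp: p_nonneg)

lemma green_Suc: "green (Suc n) (y - x) = of_bool (x = y) + (\<Sum>s\<in>D. green n (y - (x + s))) / real (card D)"
proof -
  have "green (Suc n) (y - x) = p 0 (y - x) + (\<Sum>k\<le>n. p (Suc k) (y - x))"
    unfolding green_def by (rule sum.atMost_Suc_shift)
  also have "(\<Sum>k\<le>n. p (Suc k) (y - x)) = (\<Sum>k\<le>n. \<Sum>s\<in>D. p k (y - (x + s))) / real (card D)"
    by (simp add: p_Suc sum_divide_distrib diff_diff_eq)
  also have "(\<Sum>k\<le>n. \<Sum>s\<in>D. p k (y - (x + s))) = (\<Sum>s\<in>D. green n (y - (x + s)))"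
    unfolding green_def by (rule sum.swap)
  finally show ?thesis by (auto simp: p_0)
qed

lemma avoid_0: "avoid 0 x A = of_bool (x \<notin> A)"
  by (simp add: avoid_def)

lemma avoid_start [simp]: "x \<in> A \<Longrightarrow> avoid n x A = 0"
proof -
  assume x: "x \<in> A"
  have "visited x xs \<inter> A \<noteq> {}" for xs using x visited_start[of x xs] by blast
  then show ?thesis by (simp add: avoid_def)
qed

lemma avoid_Suc: "x \<notin> A \<Longrightarrow> avoid (Suc n) x A = (\<Sum>s\<in>D. avoid n (x + s) A) / real (card D)"
  by (simp add: avoid_def)

lemma hit_Suc:
  assumes "x \<notin> A"
  shows "(1 - avoid (Suc n) x A) * c = (\<Sum>s\<in>D. (1 - avoid n (x + s) A) * c) / real (card D)"
proof -
  have "(\<Sum>s\<in>D. (1 - avoid n (x + s) A) * c) = (real (card D) - (\<Sum>s\<in>D. avoid n (x + s) A)) * c"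
    by (simp only: sum_distrib_right[symmetric] sum_subtractf) simp
  then show ?thesis using card_D_pos by (simp add: avoid_Suc[OF assms] field_simps)
qed

lemma avoid_nonneg: "0 \<le> avoid n x A"
  unfolding avoid_def by (rule E_nonneg) simp

lemma avoid_le_1: "avoid n x A \<le> 1"
  unfolding avoid_def by (rule E_le_const) simp

lemma avoid_antimono: "m \<le> n \<Longrightarrow> avoid n x A \<le> avoid m x A"
proof -
  assume "m \<le> n"
  then obtain k where k: "n = m + k" using le_Suc_ex by blast
  have "avoid n x A \<le> E m (\<lambda>xs. E k (\<lambda>ys. of_bool (visited x xs \<inter> A = {})))"
    unfolding avoid_def k E_append by (intro E_mono) (auto simp: visited_append)
  then show ?thesis by (simp add: avoid_def)
qed

lemma avoid_translate: "avoid n (t + x) ((+) t ` A) = avoid n x A"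
proof -
  have "visited (t + x) xs \<inter> (+) t ` A = (+) t ` (visited x xs \<inter> A)" for xs
    by (subst visited_translate) auto
  then show ?thesis by (simp add: avoid_def)
qed

lemma avoid_translate1: "avoid n (t + x) {t} = avoid n x {0}"
  using avoid_translate[of n t x "{0}"] by simp

lemma escape_nonneg: "0 \<le> escape A a n"
  by (cases n) (auto intro!: divide_nonneg_nonneg sum_nonneg avoid_nonneg)

lemma escape_antimono: "m \<le> n \<Longrightarrow> escape A a n \<le> escape A a m"
proof (cases n; cases m)
  fix n' m' assume *: "m \<le> n" "n = Suc n'" "m = Suc m'"
  then show ?thesis by (auto intro!: divide_right_mono sum_mono avoid_antimono)
next
  fix n' assume "n = Suc n'" "m = 0"
  have "(\<Sum>s\<in>D. avoid n' (a + s) A) \<le> (\<Sum>s\<in>D. 1)" by (intro sum_mono avoid_le_1)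
  then have "escape A a (Suc n') \<le> 1" using card_D_pos by simp
  then show ?thesis using \<open>n = Suc n'\<close> \<open>m = 0\<close> by simp
qed auto

lemma escape_le_1: "escape A a n \<le> 1"
  using escape_antimono[of 0 n] by simp

section \<open>Last exit decomposition\<close>

lemma avoid_later_eq:
  assumes A: "finite A"
  shows "E (Suc m) (\<lambda>xs. avoid n (z + sum_list xs) A) =
    E m (\<lambda>xs. avoid (Suc n) (z + sum_list xs) A) + (\<Sum>a\<in>A. p m (a - z) * escape A a (Suc n))"
proof -
  have "E (Suc m) (\<lambda>xs. avoid n (z + sum_list xs) A) =
     E m (\<lambda>xs. (\<Sum>s\<in>D. avoid n (z + sum_list xs + s) A) / real (card D))"
    by (simp only: E_Suc_end) (simp add: add.assoc)
  also have "\<dots> = E m (\<lambda>xs. avoid (Suc n) (z + sum_list xs) A +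
       (\<Sum>a\<in>A. escape A a (Suc n) * of_bool (sum_list xs = a - z)))"
  proof (rule E_cong)
    fix xs :: "'a list"
    let ?y = "z + sum_list xs"
    have eq: "(sum_list xs = a - z) = (?y = a)" for a by (auto simp: algebra_simps)
    have "(\<Sum>a\<in>A. escape A a (Suc n) * of_bool (sum_list xs = a - z)) =
        (\<Sum>a\<in>A. if ?y = a then escape A a (Suc n) else 0)"
      unfolding eq by (rule sum.cong) auto
    also have "\<dots> = (if ?y \<in> A then escape A ?y (Suc n) else 0)" using A by simp
    finally show "(\<Sum>s\<in>D. avoid n (?y + s) A) / real (card D) = avoid (Suc n) ?y A +
       (\<Sum>a\<in>A. escape A a (Suc n) * of_bool (sum_list xs = a - z))"
      using avoid_Suc[of ?y A n] by (cases "?y \<in> A") auto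
  qed
  also have "\<dots> = E m (\<lambda>xs. avoid (Suc n) (z + sum_list xs) A) +
      (\<Sum>a\<in>A. escape A a (Suc n) * E m (\<lambda>xs. of_bool (sum_list xs = a - z)))"
    by (simp only: E_plus E_sum E_cmult)
  finally show ?thesis by (simp only: p_def[symmetric] mult.commute)
qed

text \<open>A walk that avoids \<open>A\<close> during the times \<open>m\<close> to
  \<open>m + n\<close> either avoids it from time 0 on, or has a last visit at some time
  \<open>k < m\<close> and place \<open>a\<close>, after which it escapes for the remaining
  \<open>m + n - k\<close> steps.\<close>

lemma last_exit:
  assumes A: "finite A"
  shows "E m (\<lambda>xs. avoid n (z + sum_list xs) A) =
    avoid (m + n) z A + (\<Sum>k<m. \<Sum>a\<in>A. p k (a - z) * escape A a (m + n - k))"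
proof (induction m arbitrary: n)
  case (Suc m)
  have "E (Suc m) (\<lambda>xs. avoid n (z + sum_list xs) A) = avoid (m + Suc n) z A +
     (\<Sum>k<m. \<Sum>a\<in>A. p k (a - z) * escape A a (m + Suc n - k)) + (\<Sum>a\<in>A. p m (a - z) * escape A a (Suc n))"
    by (simp only: avoid_later_eq[OF A] Suc.IH)
  also have "\<dots> = avoid (Suc m + n) z A + (\<Sum>k<Suc m. \<Sum>a\<in>A. p k (a - z) * escape A a (Suc m + n - k))"
    by simp
  finally show ?case .
qed simp

text \<open>\<open>last_exit\<close> with no steps after time \<open>n\<close> misses the walks that
  are in \<open>A\<close> at time \<open>n\<close> itself. They supply the term
  \<open>k = n\<close>, where the escape has length 0 and probability 1.\<close>

lemma last_exit_total:
  assumes A: "finite A"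
  shows "avoid n z A + (\<Sum>k\<le>n. \<Sum>a\<in>A. p k (a - z) * escape A a (n - k)) = 1"
proof -
  have "E n (\<lambda>xs. avoid 0 (z + sum_list xs) A) = E n (\<lambda>xs. 1 - (\<Sum>a\<in>A. of_bool (sum_list xs = a - z)))"
  proof (rule E_cong)
    fix xs :: "'a list"
    have eq: "(sum_list xs = a - z) = (z + sum_list xs = a)" for a by (auto simp: algebra_simps)
    have "(\<Sum>a\<in>A. of_bool (sum_list xs = a - z) :: real) = (\<Sum>a\<in>A. if z + sum_list xs = a then 1 else 0)"
      unfolding eq by (rule sum.cong) auto
    then show "avoid 0 (z + sum_list xs) A = 1 - (\<Sum>a\<in>A. of_bool (sum_list xs = a - z))"
      using A by (simp add: avoid_0)
  qed
  also have "\<dots> = 1 - (\<Sum>a\<in>A. p n (a - z))" by (simp add: E_minus E_sum p_def)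
  finally have "avoid n z A + (\<Sum>k<n. \<Sum>a\<in>A. p k (a - z) * escape A a (n - k)) = 1 - (\<Sum>a\<in>A. p n (a - z))"
    using last_exit[OF A, of n 0 z] by simp
  moreover have "{..n} = insert n {..<n}" by auto
  ultimately show ?thesis by simp
qed

text \<open>Every escape in the total decomposition has at most \<open>n\<close> steps left, so it
  is at least as likely as the one of length \<open>n\<close>.\<close>

lemma escape_green_le: "escape {0} 0 n * green n 0 \<le> 1"
proof -
  have "escape {0} 0 n * green n 0 = (\<Sum>k\<le>n. p k 0 * escape {0} 0 n)"
    by (simp add: green_def sum_distrib_left mult.commute)
  also have "\<dots> \<le> (\<Sum>k\<le>n. p k 0 * escape {0} 0 (n - k))"
    by (intro sum_mono mult_left_mono escape_antimono p_nonneg) auto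
  also have "\<dots> = 1" using last_exit_total[of "{0}" n 0] by simp
  finally show ?thesis .
qed

text \<open>The start lies in the target, so the term without any visit vanishes. A last visit
  before time \<open>m\<close> leaves more than \<open>n\<close> steps, and such visits have total
  mass at most \<open>green m 0\<close>.\<close>

lemma no_late_return_le: "E m (\<lambda>xs. avoid n (sum_list xs) {0}) \<le> green m 0 * escape {0} 0 n"
proof -
  have "E m (\<lambda>xs. avoid n (sum_list xs) {0}) = (\<Sum>k<m. p k 0 * escape {0} 0 (m + n - k))"
    using last_exit[of "{0}" m n 0] by simp
  also have "\<dots> \<le> (\<Sum>k<m. p k 0 * escape {0} 0 n)"
    by (intro sum_mono mult_left_mono escape_antimono p_nonneg) auto
  also have "\<dots> \<le> (\<Sum>k\<le>m. p k 0 * escape {0} 0 n)"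
    by (intro sum_mono2) (auto simp: p_nonneg escape_nonneg)
  also have "\<dots> = green m 0 * escape {0} 0 n" by (simp add: green_def sum_distrib_right)
  finally show ?thesis .
qed

section \<open>Hitting probabilities against Green's function\<close>

lemma green_le_hit: "green n (y - x) \<le> (1 - avoid n x {y}) * green n 0"
proof (cases "x = y")
  case False
  then show ?thesis
  proof (induction n arbitrary: x)
    case 0
    then show ?case by (simp add: green_def p_0 avoid_0)
  next
    case (Suc n)
    have le: "green n (y - (x + s)) \<le> (1 - avoid n (x + s) {y}) * green (Suc n) 0" for s
    proof (cases "x + s = y")
      case True
      then show ?thesis using green_mono[of n "Suc n" 0] by simp
    next
      case False
      have "green n (y - (x + s)) \<le> (1 - avoid n (x + s) {y}) * green n 0" by (rule Suc.IH[OF False])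
      also have "\<dots> \<le> (1 - avoid n (x + s) {y}) * green (Suc n) 0"
        by (intro mult_left_mono green_mono) (auto simp: avoid_le_1)
      finally show ?thesis .
    qed
    have "green (Suc n) (y - x) = (\<Sum>s\<in>D. green n (y - (x + s))) / real (card D)"
      using Suc.prems by (simp add: green_Suc)
    also have "\<dots> \<le> (\<Sum>s\<in>D. (1 - avoid n (x + s) {y}) * green (Suc n) 0) / real (card D)"
      using card_D_pos by (intro divide_right_mono sum_mono le) auto
    also have "\<dots> = (1 - avoid (Suc n) x {y}) * green (Suc n) 0"
      by (rule hit_Suc[symmetric]) (use Suc.prems in auto)
    finally show ?case .
  qed
qed simp

text \<open>Once \<open>B\<close> is hit within \<open>n\<close> steps, at least \<open>m\<close> of
  the \<open>n + m\<close> steps remain, and from any point of \<open>B\<close> these spend expected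
  time at least \<open>g\<close> in \<open>B\<close>. Induction on the first step, through
  \<open>hit_Suc\<close>, stands in for the strong Markov property.\<close>

lemma hit_set_le_green:
  assumes B: "\<And>b. b \<in> B \<Longrightarrow> g \<le> (\<Sum>y\<in>B. green m (y - b))" and g: "g \<ge> 0"
  shows "(1 - avoid n x B) * g \<le> (\<Sum>y\<in>B. green (n + m) (y - x))"
proof (induction n arbitrary: x)
  case 0
  show ?case
    using B[of x] by (cases "x \<in> B") (auto simp: avoid_0 intro!: sum_nonneg green_nonneg)
next
  case (Suc n)
  show ?case
  proof (cases "x \<in> B")
    case True
    have "g \<le> (\<Sum>y\<in>B. green m (y - x))" by (rule B[OF True])
    also have "\<dots> \<le> (\<Sum>y\<in>B. green (Suc n + m) (y - x))" by (intro sum_mono green_mono) simp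
    finally show ?thesis using True by simp
  next
    case False
    have "(1 - avoid (Suc n) x B) * g = (\<Sum>s\<in>D. (1 - avoid n (x + s) B) * g) / real (card D)"
      by (rule hit_Suc) (rule False)
    also have "\<dots> \<le> (\<Sum>s\<in>D. \<Sum>y\<in>B. green (n + m) (y - (x + s))) / real (card D)"
      using card_D_pos by (intro divide_right_mono sum_mono Suc.IH) auto
    also have "\<dots> = (\<Sum>y\<in>B. (\<Sum>s\<in>D. green (n + m) (y - (x + s))) / real (card D))"
      by (subst sum.swap) (simp add: sum_divide_distrib)
    also have "\<dots> \<le> (\<Sum>y\<in>B. green (Suc n + m) (y - x))"
      by (intro sum_mono) (simp add: green_Suc)
    finally show ?thesis .
  qed
qed

section \<open>Covering a set in rounds\<close>

lemma uncovered_nonneg: "0 \<le> uncovered n x A"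
  unfolding uncovered_def by (rule E_nonneg) simp

lemma uncovered_le_1: "uncovered n x A \<le> 1"
  unfolding uncovered_def by (rule E_le_const) simp

lemma uncovered_empty [simp]: "uncovered n x {} = 0"
  by (simp add: uncovered_def)

lemma uncovered_antimono: "m \<le> n \<Longrightarrow> uncovered n x A \<le> uncovered m x A"
proof -
  assume "m \<le> n"
  then obtain k where k: "n = m + k" using le_Suc_ex by blast
  have "uncovered n x A \<le> E m (\<lambda>xs. E k (\<lambda>ys. of_bool (\<not> A \<subseteq> visited x xs)))"
    unfolding uncovered_def k E_append by (intro E_mono) (auto simp: visited_append)
  then show ?thesis by (simp add: uncovered_def)
qed

lemma uncovered_Suc_le: "uncovered (Suc n) x A \<le> (\<Sum>s\<in>D. uncovered n (x + s) A) / real (card D)"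
  unfolding uncovered_def walk_avg.simps using card_D_pos
  by (intro divide_right_mono sum_mono E_mono) auto

text \<open>A walk that reaches \<open>x\<close> within \<open>m\<close> steps has at least
  \<open>n\<close> steps left, and forgetting what it saw on the way only makes covering
  harder.\<close>

lemma uncovered_restart: "uncovered (m + n) y A \<le> avoid m y {x} + uncovered n x A"
proof (induction m arbitrary: y)
  case 0
  then show ?case
    using uncovered_le_1[of n y A] uncovered_nonneg[of n x A] by (cases "y = x") (auto simp: avoid_0)
next
  case (Suc m)
  show ?case
  proof (cases "y = x")
    case True
    then show ?thesis using uncovered_antimono[of n "Suc m + n" x A] by simp
  next
    case False
    have "uncovered (Suc m + n) y A \<le> (\<Sum>s\<in>D. uncovered (m + n) (y + s) A) / real (card D)"
      using uncovered_Suc_le[of "m + n" y A] by simp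
    also have "\<dots> \<le> (\<Sum>s\<in>D. avoid m (y + s) {x} + uncovered n x A) / real (card D)"
      using card_D_pos by (intro divide_right_mono sum_mono Suc.IH) auto
    also have "\<dots> = avoid (Suc m) y {x} + uncovered n x A"
      using False card_D_pos by (simp add: avoid_Suc sum.distrib add_divide_distrib)
    finally show ?thesis .
  qed
qed

text \<open>Points seen in the first \<open>m\<close> steps are deleted from the target; then the
  walk has \<open>k\<close> steps to come back to \<open>x\<close>. Coming back to the same point is
  what makes all rounds alike.\<close>

lemma uncovered_round:
  "uncovered (m + (k + n)) x A \<le>
    E m (\<lambda>xs. avoid k (sum_list xs) {0}) + E m (\<lambda>xs. uncovered n x (A - visited x xs))"
proof -
  have "uncovered (m + (k + n)) x A = E m (\<lambda>xs. uncovered (k + n) (x + sum_list xs) (A - visited x xs))"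
    unfolding uncovered_def E_append
    by (intro E_cong) (auto simp: E_append[symmetric] visited_append intro!: E_cong)
  also have "\<dots> \<le> E m (\<lambda>xs. avoid k (x + sum_list xs) {x} + uncovered n x (A - visited x xs))"
    by (intro E_mono uncovered_restart)
  finally show ?thesis by (simp add: E_plus avoid_translate1)
qed

text \<open>A failed return costs \<open>f\<close> only while \<open>y\<close> is still missing, so
  one round maps a bound \<open>u\<close> to \<open>f + \<rho> * u\<close>. The fixed point
  \<open>f / (1 - \<rho>)\<close> of this map does not depend on the number of rounds.\<close>

lemma uncovered_rounds_point:
  assumes f: "E m (\<lambda>xs. avoid k (sum_list xs) {0}) \<le> f" and \<rho>: "avoid m x {y} \<le> \<rho>" "\<rho> < 1"
  shows "uncovered (j * (m + k)) x {y} \<le> f / (1 - \<rho>) + \<rho> ^ j"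
proof (induction j)
  case 0
  have "f \<ge> 0" using f E_nonneg[of m "\<lambda>xs. avoid k (sum_list xs) {0}"] avoid_nonneg by fastforce
  then show ?case using \<rho> uncovered_le_1[of 0 x "{y}"] by (simp add: add_increasing)
next
  case (Suc j)
  let ?n = "j * (m + k)"
  have \<rho>0: "0 \<le> \<rho>" using \<rho> avoid_nonneg[of m x "{y}"] by linarith
  have "uncovered (Suc j * (m + k)) x {y} \<le>
      E m (\<lambda>xs. avoid k (sum_list xs) {0}) + E m (\<lambda>xs. uncovered ?n x ({y} - visited x xs))"
    using uncovered_round[of m k ?n x "{y}"] by (simp add: algebra_simps)
  also have "E m (\<lambda>xs. uncovered ?n x ({y} - visited x xs)) =
      E m (\<lambda>xs. uncovered ?n x {y} * of_bool (visited x xs \<inter> {y} = {}))"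
    by (rule E_cong) (auto simp: insert_Diff_if)
  also have "\<dots> = uncovered ?n x {y} * avoid m x {y}"
    by (simp add: E_cmult avoid_def)
  also have "\<dots> \<le> (f / (1 - \<rho>) + \<rho> ^ j) * \<rho>"
    by (intro mult_mono' Suc.IH \<rho> uncovered_nonneg avoid_nonneg)
  finally have "uncovered (Suc j * (m + k)) x {y} \<le> f + (f / (1 - \<rho>) + \<rho> ^ j) * \<rho>" using f by linarith
  also have "\<dots> = f / (1 - \<rho>) + \<rho> ^ Suc j" using \<rho> by (simp add: field_simps)
  finally show ?case .
qed

text \<open>The bound is linear in the cardinality of the target, so it can be averaged over the
  random set left by a round, whose expected size is at most \<open>\<rho> * card A\<close>. The
  failures of \<open>j\<close> rounds add up, and the survivors are charged \<open>\<alpha>\<close>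
  each by a union bound.\<close>

lemma uncovered_rounds:
  assumes f: "E m (\<lambda>xs. avoid k (sum_list xs) {0}) \<le> f"
    and \<rho>: "\<And>y. y \<in> A \<Longrightarrow> avoid m x {y} \<le> \<rho>" "0 \<le> \<rho>"
    and \<alpha>: "\<And>y. y \<in> A \<Longrightarrow> uncovered n x {y} \<le> \<alpha>" "0 \<le> \<alpha>" and A: "finite A"
  shows "uncovered (j * (m + k) + n) x A \<le> real j * f + real (card A) * \<rho> ^ j * \<alpha>"
  using A \<rho>(1) \<alpha>(1)
proof (induction j arbitrary: A)
  case 0
  have "uncovered n x A \<le> E n (\<lambda>xs. \<Sum>y\<in>A. of_bool (\<not> {y} \<subseteq> visited x xs))"
    unfolding uncovered_def
  proof (rule E_mono)
    fix xs :: "'a list"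
    show "of_bool (\<not> A \<subseteq> visited x xs) \<le> (\<Sum>y\<in>A. of_bool (\<not> {y} \<subseteq> visited x xs) :: real)"
    proof (cases "A \<subseteq> visited x xs")
      case False
      then obtain y where y: "y \<in> A" "\<not> {y} \<subseteq> visited x xs" by auto
      have "of_bool (\<not> {y} \<subseteq> visited x xs) \<le> (\<Sum>y\<in>A. of_bool (\<not> {y} \<subseteq> visited x xs) :: real)"
        by (rule member_le_sum) (use y 0 in auto)
      then show ?thesis using False y by simp
    qed (simp add: sum_nonneg)
  qed
  also have "\<dots> = (\<Sum>y\<in>A. uncovered n x {y})" by (simp add: E_sum uncovered_def)
  also have "\<dots> \<le> (\<Sum>y\<in>A. \<alpha>)" by (rule sum_mono) (use 0 in auto)
  finally show ?case by simp
next
  case (Suc j)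
  let ?n = "j * (m + k) + n"
  have "uncovered (Suc j * (m + k) + n) x A \<le>
      E m (\<lambda>xs. avoid k (sum_list xs) {0}) + E m (\<lambda>xs. uncovered ?n x (A - visited x xs))"
    using uncovered_round[of m k ?n x A] by (simp add: algebra_simps)
  also have "E m (\<lambda>xs. uncovered ?n x (A - visited x xs)) \<le>
     E m (\<lambda>xs. real j * f + (\<rho> ^ j * \<alpha>) * real (card (A - visited x xs)))"
  proof (rule E_mono)
    fix xs :: "'a list"
    have "uncovered ?n x (A - visited x xs) \<le> real j * f + real (card (A - visited x xs)) * \<rho> ^ j * \<alpha>"
      by (rule Suc.IH) (use Suc.prems in auto)
    then show "uncovered ?n x (A - visited x xs) \<le> real j * f + (\<rho> ^ j * \<alpha>) * real (card (A - visited x xs))"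
      by (simp add: mult_ac)
  qed
  also have "\<dots> = real j * f + (\<rho> ^ j * \<alpha>) * E m (\<lambda>xs. real (card (A - visited x xs)))"
    by (simp add: E_plus E_cmult)
  also have "E m (\<lambda>xs. real (card (A - visited x xs))) = E m (\<lambda>xs. \<Sum>y\<in>A. of_bool (visited x xs \<inter> {y} = {}))"
  proof (rule E_cong)
    fix xs :: "'a list"
    have "A - visited x xs = {y \<in> A. visited x xs \<inter> {y} = {}}" by auto
    then show "real (card (A - visited x xs)) = (\<Sum>y\<in>A. of_bool (visited x xs \<inter> {y} = {}))"
      using Suc.prems(1) by (simp add: Int_def)
  qed
  also have "\<dots> = (\<Sum>y\<in>A. avoid m x {y})" by (simp add: E_sum avoid_def)
  also have "(\<rho> ^ j * \<alpha>) * \<dots> \<le> (\<rho> ^ j * \<alpha>) * (\<Sum>y\<in>A. \<rho>)"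
    by (intro mult_left_mono sum_mono Suc.prems) (use \<rho>(2) \<alpha>(2) in auto)
  finally show ?case using f by (simp add: algebra_simps)
qed

text \<open>Strong Markov property at the first visit to \<open>B\<close>, as induction on the first
  step: a visit by time \<open>m\<close> leaves at least \<open>n\<close> steps to cover
  \<open>B\<close>.\<close>

lemma hit_and_uncovered_le:
  assumes \<kappa>: "\<And>b. b \<in> B \<Longrightarrow> uncovered n b B \<le> \<kappa>"
  shows "E (m + n) (\<lambda>xs. of_bool (visited x (take m xs) \<inter> B \<noteq> {} \<and> \<not> B \<subseteq> visited x xs))
    \<le> (1 - avoid m x B) * \<kappa>"
proof -
  have start: "E (m + n) (\<lambda>xs. of_bool (visited x (take m xs) \<inter> B \<noteq> {} \<and> \<not> B \<subseteq> visited x xs))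
    \<le> (1 - avoid m x B) * \<kappa>" if "x \<in> B" for m x
  proof -
    have "E (m + n) (\<lambda>xs. of_bool (visited x (take m xs) \<inter> B \<noteq> {} \<and> \<not> B \<subseteq> visited x xs)) \<le> uncovered (m + n) x B"
      unfolding uncovered_def by (rule E_mono) auto
    also have "\<dots> \<le> uncovered n x B" by (rule uncovered_antimono) simp
    also have "\<dots> \<le> \<kappa>" by (rule \<kappa>[OF that])
    finally show ?thesis using that by simp
  qed
  show ?thesis
  proof (induction m arbitrary: x)
    case 0
    show ?case using start[of x 0] by (cases "x \<in> B") (auto simp: avoid_0)
  next
    case (Suc m)
    show ?case
    proof (cases "x \<in> B")
      case True
      then show ?thesis by (rule start)
    next
      case False
      have "E (Suc m + n) (\<lambda>xs. of_bool (visited x (take (Suc m) xs) \<inter> B \<noteq> {} \<and> \<not> B \<subseteq> visited x xs)) =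
        (\<Sum>s\<in>D. E (m + n) (\<lambda>xs. of_bool (visited (x + s) (take m xs) \<inter> B \<noteq> {} \<and> \<not> B \<subseteq> visited (x + s) xs))) / real (card D)"
        using False by (simp add: subset_insert)
      also have "\<dots> \<le> (\<Sum>s\<in>D. (1 - avoid m (x + s) B) * \<kappa>) / real (card D)"
        using card_D_pos by (intro divide_right_mono sum_mono Suc.IH) auto
      also have "\<dots> = (1 - avoid (Suc m) x B) * \<kappa>"
        by (rule hit_Suc[symmetric]) (rule False)
      finally show ?thesis .
    qed
  qed
qed

end

section \<open>Flipping blocks of three steps\<close>

context sym_walk
begin

context
  fixes s :: 'a
  assumes s_in: "s \<in> D" and ss: "s + s \<noteq> 0"
begin

lemma s_nonzero: "s \<noteq> 0"
  using ss by auto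

lemma s_neq_uminus: "s \<noteq> - s" "- s \<noteq> s"
  using ss by (metis add.right_inverse)+

definition pos :: "nat \<Rightarrow> 'a list \<Rightarrow> 'a" where
  "pos k w = sum_list (take k w)"

definition blockA :: "nat \<Rightarrow> 'a list \<Rightarrow> bool" where
  "blockA i w \<longleftrightarrow> w ! (3*i) = s \<and> w ! (3*i+1) = s \<and> w ! (3*i+2) = - s"

definition blockB :: "nat \<Rightarrow> 'a list \<Rightarrow> bool" where
  "blockB i w \<longleftrightarrow> w ! (3*i) = s \<and> w ! (3*i+1) = - s \<and> w ! (3*i+2) = s"

text \<open>Blocks of type A and B started at \<open>y\<close> both end at \<open>y + s\<close>, and they visit the same points except
  for the apex \<open>y + 2s\<close>, which only A visits. In a good block the range therefore reveals the type. The
  last condition makes goodness invariant under flips of other good blocks, whose apex could coincide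
  with this one only if they started at the same point.\<close>
definition good :: "'a list \<Rightarrow> nat set" where
  "good w = {i. i < length w div 3 \<and> (blockA i w \<or> blockB i w) \<and>
     (\<forall>k\<le>length w. k < 3*i \<or> k > 3*i+3 \<longrightarrow> pos k w \<noteq> pos (3*i) w + s + s) \<and>
     (\<forall>j<length w div 3. j \<noteq> i \<longrightarrow> pos (3*j) w \<noteq> pos (3*i) w)}"

text \<open>Negating steps by their index alone, without reference to block types, makes
  \<open>flip I\<close> an involution on all step lists. On good blocks it exchanges the two
  types.\<close>

definition flip :: "nat set \<Rightarrow> 'a list \<Rightarrow> 'a list" where
  "flip I w = map (\<lambda>k. if k div 3 \<in> I \<and> k mod 3 \<noteq> 0 then - (w ! k) else w ! k) [0..<length w]"

lemma length_flip [simp]: "length (flip I w) = length w"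
  by (simp add: flip_def)

lemma nth_flip: "k < length w \<Longrightarrow> flip I w ! k = (if k div 3 \<in> I \<and> k mod 3 \<noteq> 0 then - (w ! k) else w ! k)"
  by (simp add: flip_def)

lemma flip_flip [simp]: "flip I (flip I w) = w"
  by (rule nth_equalityI) (auto simp: nth_flip)

lemma set_flip: "set w \<subseteq> D \<Longrightarrow> set (flip I w) \<subseteq> D"
proof -
  assume "set w \<subseteq> D"
  then have "w ! k \<in> D" if "k < length w" for k using that nth_mem by blast
  then show ?thesis using D_uminus by (auto simp: flip_def)
qed

lemma pos_Suc: "k < length w \<Longrightarrow> pos (Suc k) w = pos k w + w ! k"
  by (simp add: pos_def take_Suc_conv_app_nth)

lemma pos_0 [simp]: "pos 0 w = 0"
  by (simp add: pos_def)

lemma visited_pos: "visited 0 w = {pos k w | k. k \<le> length w}"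
  by (simp add: visited_conv_take pos_def)

lemma good_finite: "finite (good w)"
  by (rule finite_subset[of _ "{..<length w div 3}"]) (auto simp: good_def)

lemma good_D:
  assumes "i \<in> good w"
  shows "3*i+2 < length w" "blockA i w \<or> blockB i w" "w ! (3*i) = s"
    "w ! (3*i+1) + w ! (3*i+2) = 0" "w ! (3*i+1) = s \<or> w ! (3*i+1) = - s"
proof -
  have "i < length w div 3" using assms by (simp add: good_def)
  then show "3*i+2 < length w" by presburger
qed (use assms in \<open>auto simp: good_def blockA_def blockB_def\<close>)

text \<open>The two negated steps of a good block cancel each other, so only the position between
  them moves.\<close>

lemma pos_flip:
  assumes I: "I \<subseteq> good w" and k: "k \<le> length w"
  shows "pos k (flip I w) = pos k w - (if k mod 3 = 2 \<and> k div 3 \<in> I then w ! (k - 1) + w ! (k - 1) else 0)"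
  using k
proof (induction k)
  case (Suc k)
  have IH: "pos k (flip I w) = pos k w - (if k mod 3 = 2 \<and> k div 3 \<in> I then w ! (k - 1) + w ! (k - 1) else 0)"
    using Suc by simp
  have lt: "k < length w" using Suc.prems by simp
  have st: "pos (Suc k) (flip I w) = pos k (flip I w) + (if k div 3 \<in> I \<and> k mod 3 \<noteq> 0 then - (w ! k) else w ! k)"
    using lt by (simp add: pos_Suc nth_flip)
  consider "k mod 3 = 0" | "k mod 3 = 1" | "k mod 3 = 2" by linarith
  then show ?case
  proof cases
    case 1
    then have "Suc k mod 3 = 1" by presburger
    then show ?thesis using 1 st IH lt by (simp add: pos_Suc)
  next
    case 2
    then have "Suc k mod 3 = 2" "Suc k div 3 = k div 3" by presburger+
    then show ?thesis using 2 st IH lt by (simp add: pos_Suc)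
  next
    case 3
    then have m: "Suc k mod 3 = 0" by presburger
    show ?thesis
    proof (cases "k div 3 \<in> I")
      case True
      then have "w ! (3*(k div 3)+1) + w ! (3*(k div 3)+2) = 0" using I good_D(4) by blast
      moreover have "3*(k div 3)+1 = k - 1" "3*(k div 3)+2 = k" using 3 by presburger+
      ultimately have "w ! (k - 1) = - (w ! k)" by (metis add_eq_0_iff2)
      then show ?thesis using 3 m st IH lt True by (simp add: pos_Suc)
    next
      case False
      then show ?thesis using 3 m st IH lt by (simp add: pos_Suc)
    qed
  qed
qed simp

lemma pos_flip_base:
  assumes "I \<subseteq> good w" "i \<le> length w div 3"
  shows "pos (3*i) (flip I w) = pos (3*i) w"
proof -
  have "3*i \<le> length w" using assms(2) by presburger
  then show ?thesis using pos_flip[OF assms(1), of "3*i"] by simp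
qed

lemma block_flip:
  assumes "3*i+2 < length w"
  shows "blockA i (flip I w) \<longleftrightarrow> (if i \<in> I then blockB i w else blockA i w)"
    "blockB i (flip I w) \<longleftrightarrow> (if i \<in> I then blockA i w else blockB i w)"
proof -
  have d: "(3*i) div 3 = i" "(3*i+1) div 3 = i" "(3*i+2) div 3 = i" "(3*i+1) mod 3 = 1" "(3*i+2) mod 3 = 2"
    by presburger+
  have n: "flip I w ! (3*i) = w ! (3*i)" "flip I w ! (3*i+1) = (if i \<in> I then - (w ! (3*i+1)) else w ! (3*i+1))"
    "flip I w ! (3*i+2) = (if i \<in> I then - (w ! (3*i+2)) else w ! (3*i+2))"
    using assms by (simp_all only: nth_flip d) (auto simp: nth_flip d)
  show "blockA i (flip I w) \<longleftrightarrow> (if i \<in> I then blockB i w else blockA i w)"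
    "blockB i (flip I w) \<longleftrightarrow> (if i \<in> I then blockA i w else blockB i w)"
    unfolding blockA_def blockB_def n by (auto simp: minus_equation_iff[of _ s] eq_commute[of s])
qed

text \<open>A flipped block \<open>j\<close> creates one new position. If it was of type A, this is
  its own base, an old position that cannot be the apex of block \<open>i\<close>. If it was of type
  B, it is the apex of block \<open>j\<close>, and two apexes coincide only if the bases do.\<close>

lemma good_subset_good_flip:
  assumes I: "I \<subseteq> good w"
  shows "good w \<subseteq> good (flip I w)"
proof
  fix i assume i: "i \<in> good w"
  have lt: "i < length w div 3" using i by (simp add: good_def)
  have base: "pos (3*j) (flip I w) = pos (3*j) w" if "j < length w div 3" for j
    using pos_flip_base[OF I, of j] that by simp
  have ge: "3*i+2 < length w" by (rule good_D(1)[OF i])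
  have "pos k (flip I w) \<noteq> pos (3*i) w + s + s" if k: "k \<le> length w" "k < 3*i \<or> k > 3*i+3" for k
  proof (cases "k mod 3 = 2 \<and> k div 3 \<in> I")
    case False
    then show ?thesis using pos_flip[OF I k(1)] k i by (auto simp: good_def)
  next
    case True
    define j where "j = k div 3"
    have "k mod 3 = 2" using True by simp
    then have kj: "k = 3*j+2" unfolding j_def by presburger
    have jI: "j \<in> I" using True j_def by simp
    then have jg: "j \<in> good w" using I by blast
    have ji: "j \<noteq> i" using k(2) kj by auto
    have jlt: "j < length w div 3" using jg by (simp add: good_def)
    have jl: "3*j+2 < length w" by (rule good_D(1)[OF jg])
    have pk: "pos k w = pos (3*j) w + s + w ! (3*j+1)"
      using pos_Suc[of "3*j" w] pos_Suc[of "3*j+1" w] jl good_D(3)[OF jg] kj by simp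
    have pf: "pos k (flip I w) = pos k w - (w ! (3*j+1) + w ! (3*j+1))"
      using pos_flip[OF I k(1)] True kj by simp
    show ?thesis
    proof (cases "w ! (3*j+1) = s")
      case True
      then have e: "pos k (flip I w) = pos (3*j) w" using pk pf by simp
      show ?thesis
      \<comment> \<open>The block right after \<open>i\<close> has its base at index
        \<open>3*i+3\<close>, which the clause on visits to the apex leaves out; that base is
        \<open>pos (3*i) w + s\<close>, one step short of the apex.\<close>
      proof (cases "j = i + 1")
        case True
        have "pos (3*j) w = pos (3*i) w + s + (w ! (3*i+1) + w ! (3*i+2))"
          using pos_Suc[of "3*i" w] pos_Suc[of "3*i+1" w] pos_Suc[of "3*i+2" w] ge good_D(3)[OF i] True
          by (simp add: eval_nat_numeral add.assoc)
        then have "pos (3*j) w = pos (3*i) w + s" using good_D(4)[OF i] by simp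
        then show ?thesis using e s_nonzero by (simp add: add.assoc)
      next
        case False
        then have "3*j < 3*i \<or> 3*j > 3*i+3" "3*j \<le> length w" using ji jl by auto
        then show ?thesis using e i by (auto simp: good_def)
      qed
    next
      case False
      then have "w ! (3*j+1) = - s" using good_D(5)[OF jg] by simp
      then have "pos k (flip I w) = pos (3*j) w + s + s" using pk pf by (simp add: algebra_simps)
      moreover have "pos (3*j) w \<noteq> pos (3*i) w" using i ji jlt by (auto simp: good_def)
      ultimately show ?thesis by simp
    qed
  qed
  moreover have "pos (3*j) (flip I w) \<noteq> pos (3*i) (flip I w)" if "j < length w div 3" "j \<noteq> i" for j
    using that i lt by (auto simp: base good_def)
  ultimately show "i \<in> good (flip I w)"
    using lt good_D(2)[OF i] block_flip[OF ge, of I] base[OF lt] by (auto simp: good_def)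
qed

lemma good_flip:
  assumes I: "I \<subseteq> good w"
  shows "good (flip I w) = good w"
proof -
  have "I \<subseteq> good (flip I w)" using I good_subset_good_flip by blast
  then have "good (flip I w) \<subseteq> good (flip I (flip I w))" by (rule good_subset_good_flip)
  then show ?thesis using good_subset_good_flip[OF I] by simp
qed

lemma apex_in_visited:
  assumes i: "i \<in> good w"
  shows "pos (3*i) w + s + s \<in> visited 0 w \<longleftrightarrow> blockA i w"
proof
  have ge: "3*i+2 < length w" by (rule good_D(1)[OF i])
  have p1: "pos (3*i+1) w = pos (3*i) w + s" using pos_Suc[of "3*i" w] ge good_D(3)[OF i] by simp
  have p2: "pos (3*i+2) w = pos (3*i) w + s + w ! (3*i+1)"
    using pos_Suc[of "3*i+1" w] ge p1 by simp
  have p3: "pos (3*i+3) w = pos (3*i) w + s"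
    using pos_Suc[of "3*i+2" w] ge p2 good_D(4)[OF i] by (simp add: eval_nat_numeral add.assoc)
  {
    assume "blockA i w"
    then have "pos (3*i+2) w = pos (3*i) w + s + s" using p2 by (simp add: blockA_def)
    then show "pos (3*i) w + s + s \<in> visited 0 w" using ge by (auto simp: visited_pos intro!: exI[of _ "3*i+2"])
  next
    assume "pos (3*i) w + s + s \<in> visited 0 w"
    then obtain k where k: "k \<le> length w" "pos k w = pos (3*i) w + s + s" by (force simp: visited_pos)
    then have "\<not> (k < 3*i \<or> k > 3*i+3)" using i by (auto simp: good_def)
    then have "k = 3*i \<or> k = 3*i+1 \<or> k = 3*i+2 \<or> k = 3*i+3" by linarith
    then have "k = 3*i+2" using k(2) p1 p3 s_nonzero ss by (auto simp: add.assoc)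
    then have "w ! (3*i+1) = s" using k(2) p2 by simp
    then show "blockA i w" using good_D(2)[OF i] s_neq_uminus by (auto simp: blockB_def)
  }
qed

text \<open>Both walks are flips of one walk \<open>u\<close>, hence have the same good blocks with
  the same bases. For each of these the visited set shows whether the apex was reached, hence the
  type, and the types determine \<open>I\<close> and \<open>J\<close>.\<close>

lemma flip_eq_if_same_visited:
  assumes I: "I \<subseteq> good v" and J: "J \<subseteq> good w" and eq: "flip I v = flip J w" and tr: "visited 0 v = visited 0 w"
  shows "v = w"
proof -
  define u where "u = flip I v"
  have v: "v = flip I u" and w: "w = flip J u" using eq by (auto simp: u_def) (metis flip_flip)
  have g: "good v = good u" "good w = good u"
    using good_flip[OF I] good_flip[OF J] eq by (simp_all add: u_def)
  have "i \<in> I \<longleftrightarrow> i \<in> J" if i: "i \<in> good u" for i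
  proof -
    have ge: "3*i+2 < length u" by (rule good_D(1)[OF i])
    have base: "pos (3*i) v = pos (3*i) u" "pos (3*i) w = pos (3*i) u"
      using pos_flip_base[of I u i] pos_flip_base[of J u i] I J g i v w by (auto simp: good_def)
    have "blockA i v \<longleftrightarrow> blockA i w"
      using apex_in_visited[of i v] apex_in_visited[of i w] i g base tr by simp
    then have "(if i \<in> I then blockB i u else blockA i u) \<longleftrightarrow> (if i \<in> J then blockB i u else blockA i u)"
      using block_flip(1)[OF ge] v w by simp
    moreover have "\<not> (blockA i u \<and> blockB i u)" using s_neq_uminus by (auto simp: blockA_def blockB_def)
    moreover have "blockA i u \<or> blockB i u" by (rule good_D(2)[OF i])
    ultimately show ?thesis by (auto split: if_splits)
  qed
  then have "I = J" using I J g by blast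
  then show ?thesis using v w by simp
qed

lemma card_flips: "card ((\<lambda>I. flip I w) ` Pow (good w)) = 2 ^ card (good w)"
proof -
  have "inj_on (\<lambda>I. flip I w) (Pow (good w))"
  proof (rule inj_onI)
    fix I J assume IJ: "I \<in> Pow (good w)" "J \<in> Pow (good w)" and eq: "flip I w = flip J w"
    have "i \<in> I \<longleftrightarrow> i \<in> J" if i: "i \<in> good w" for i
    proof -
      have "\<not> (blockA i w \<and> blockB i w)" using s_neq_uminus by (auto simp: blockA_def blockB_def)
      moreover have "blockA i w \<or> blockB i w" by (rule good_D(2)[OF i])
      moreover have "(if i \<in> I then blockB i w else blockA i w) \<longleftrightarrow> (if i \<in> J then blockB i w else blockA i w)"
        using block_flip(1)[OF good_D(1)[OF i]] eq by metis
      ultimately show ?thesis by (auto split: if_splits)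
    qed
    then show "I = J" using IJ by blast
  qed
  then show ?thesis using good_finite by (simp add: card_image card_Pow)
qed

text \<open>The flips of distinct walks with the same visited set are disjoint, and \<open>w\<close>
  has \<open>2 ^ card (good w)\<close> of them. So these weights add up to at most the number of all
  walks on each fibre.\<close>

lemma entropy_ge_good:
  "E n (\<lambda>w. real (card (good w))) \<le> entropy2 (map_pmf (visited 0) (pmf_of_set (walks n)))"
proof -
  have "(\<Sum>w\<in>walks n. log 2 (2 ^ card (good w))) / real (card (walks n))
     \<le> entropy2 (map_pmf (visited 0) (pmf_of_set (walks n)))"
  proof (rule entropy2_ge_weight)
    fix x assume x: "x \<in> walks n"
    let ?W = "{w. w \<in> walks n \<and> visited 0 w = visited 0 x}"
    let ?F = "\<lambda>w. (\<lambda>I. flip I w) ` Pow (good w)"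
    have fin: "finite ?W" by (rule finite_subset[OF _ finite_walks[of n]]) auto
    have "(\<Sum>w\<in>?W. 2 ^ card (good w) :: real) = real (\<Sum>w\<in>?W. card (?F w))"
      by (simp add: card_flips)
    also have "(\<Sum>w\<in>?W. card (?F w)) = card (\<Union>w\<in>?W. ?F w)"
    proof (rule card_UN_disjoint[symmetric, OF fin])
      show "\<forall>w\<in>?W. finite (?F w)" using good_finite by simp
      show "\<forall>v\<in>?W. \<forall>w\<in>?W. v \<noteq> w \<longrightarrow> ?F v \<inter> ?F w = {}"
      proof (intro ballI impI)
        fix v w assume vw: "v \<in> ?W" "w \<in> ?W" "v \<noteq> w"
        show "?F v \<inter> ?F w = {}"
        proof (rule ccontr)
          assume "?F v \<inter> ?F w \<noteq> {}"
          then obtain I J where "I \<subseteq> good v" "J \<subseteq> good w" "flip I v = flip J w" by auto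
          then have "v = w" using flip_eq_if_same_visited[of I v J w] vw by simp
          then show False using vw by simp
        qed
      qed
    qed
    also have "card (\<Union>w\<in>?W. ?F w) \<le> card (walks n)"
      by (rule card_mono[OF finite_walks]) (use set_flip in auto)
    finally show "(\<Sum>w\<in>?W. 2 ^ card (good w)) \<le> real (card (walks n))" by simp
  qed (use walks_nonempty in auto)
  then show ?thesis by (simp add: E_eq_sum log_nat_power)
qed

section \<open>Probability of a good block\<close>

lemma escape_eq:
  "escape A 0 n = E n (\<lambda>w. of_bool (\<forall>k\<le>n. k > 0 \<longrightarrow> sum_list (take k w) \<notin> A))"
proof (cases n)
  case (Suc m)
  have "(visited s w \<inter> A = {}) = (\<forall>k\<le>Suc m. k > 0 \<longrightarrow> sum_list (take k (s # w)) \<notin> A)" if "length w = m" for s w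
  proof -
    have "(\<forall>k\<le>Suc m. k > 0 \<longrightarrow> sum_list (take k (s # w)) \<notin> A) = (\<forall>k\<le>m. s + sum_list (take k w) \<notin> A)"
    proof
      assume *: "\<forall>k\<le>Suc m. k > 0 \<longrightarrow> sum_list (take k (s # w)) \<notin> A"
      show "\<forall>k\<le>m. s + sum_list (take k w) \<notin> A"
      proof (intro allI impI)
        fix k assume "k \<le> m"
        then show "s + sum_list (take k w) \<notin> A" using *[rule_format, of "Suc k"] by simp
      qed
    next
      assume *: "\<forall>k\<le>m. s + sum_list (take k w) \<notin> A"
      show "\<forall>k\<le>Suc m. k > 0 \<longrightarrow> sum_list (take k (s # w)) \<notin> A"
      proof (intro allI impI)
        fix k assume "k \<le> Suc m" "k > 0"
        then show "sum_list (take k (s # w)) \<notin> A" using * by (cases k) auto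
      qed
    qed
    then show ?thesis using that by (auto simp: visited_conv_take)
  qed
  then have "E m (\<lambda>w. of_bool (\<forall>k\<le>Suc m. k > 0 \<longrightarrow> sum_list (take k (s # w)) \<notin> A)) = avoid m s A" for s
    unfolding avoid_def by (intro E_cong) simp
  then show ?thesis by (simp add: Suc)
qed simp

text \<open>Past, block and future are independent. The past read backwards with negated steps is
  again a walk started at the base, and it must not return to the base or meet the apex; the future
  starts at the base plus \<open>s\<close> and must avoid both. Lengthening both horizons to
  \<open>n\<close> lowers the probability and makes the bound uniform in \<open>i\<close>.\<close>

lemma prob_good_ge:
  assumes i: "i < n div 3"
  shows "2 / real (card D) ^ 3 * escape {0, s + s} 0 n * avoid n s {0, s + s}
    \<le> E n (\<lambda>w. of_bool (i \<in> good w))"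
proof -
  define A where "A = {0, s + s}"
  define m where "m = n - (3*i+3)"
  have n: "n = 3*i + (3 + m)" using i unfolding m_def by presburger
  let ?P = "\<lambda>xs. \<forall>k\<le>3*i. k > 0 \<longrightarrow> sum_list (take k (rev (map uminus xs))) \<notin> A"
  let ?Q = "\<lambda>b. b = [s, s, - s] \<or> b = [s, - s, s]"
  let ?R = "\<lambda>ys. visited s ys \<inter> A = {}"
  have good: "i \<in> good (xs @ b @ ys)"
    if len: "length xs = 3*i" "length ys = m" and P: "?P xs" and Q: "?Q b" and R: "?R ys" for xs b ys
  proof -
    let ?w = "xs @ b @ ys"
    have lb: "length b = 3" using Q by auto
    have lw: "length ?w = n" using len lb n by simp
    define Y where "Y = sum_list xs"
    have sb: "sum_list b = s" using Q by auto
    have base: "pos (3*i) ?w = Y" using len by (simp add: pos_def Y_def)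
    have past: "pos k ?w - Y \<notin> A" if k: "k < 3*i" for k
    proof -
      have "pos k ?w = sum_list (take k xs)" using k len by (simp add: pos_def)
      moreover have "Y = sum_list (take k xs) + sum_list (drop k xs)"
        unfolding Y_def by (metis append_take_drop_id sum_list_append)
      moreover have "sum_list (take (3*i - k) (rev (map uminus xs))) = - sum_list (drop k xs)"
        using len k by (simp add: take_rev drop_map sum_list_rev sum_list_map_uminus)
      ultimately have "pos k ?w - Y = sum_list (take (3*i - k) (rev (map uminus xs)))" by simp
      then show ?thesis using P k by auto
    qed
    have fut: "pos k ?w - Y \<notin> A" if k: "3*i+3 \<le> k" "k \<le> n" for k
    proof -
      define l where "l = k - (3*i+3)"
      have kl: "k = 3*i+3 + l" "l \<le> length ys" using k len n by (auto simp: l_def)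
      have "pos k ?w = Y + s + sum_list (take l ys)"
        using len lb kl by (simp add: pos_def Y_def sb[symmetric] add.assoc)
      moreover have "s + sum_list (take l ys) \<in> visited s ys" using kl by (auto simp: visited_conv_take)
      ultimately show ?thesis using R by (auto simp: add.assoc)
    qed
    have "pos k ?w \<noteq> Y + s + s" if "k \<le> n" "k < 3*i \<or> k > 3*i+3" for k
    proof -
      have "pos k ?w - Y \<notin> A" using that past[of k] fut[of k] by auto
      then show ?thesis by (auto simp: A_def add.assoc)
    qed
    moreover have "pos (3*j) ?w \<noteq> Y" if "j < n div 3" "j \<noteq> i" for j
    proof -
      have "3*j \<le> n" using that(1) by linarith
      then have "3*j < 3*i \<or> (3*i+3 \<le> 3*j \<and> 3*j \<le> n)" using that(2) by linarith
      then have "pos (3*j) ?w - Y \<notin> A" using past[of "3*j"] fut[of "3*j"] by auto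
      then show ?thesis by (auto simp: A_def)
    qed
    moreover have "blockA i ?w \<or> blockB i ?w"
      using Q len by (auto simp: blockA_def blockB_def nth_append)
    ultimately show ?thesis using i unfolding good_def mem_Collect_eq lw base by blast
  qed
  have two: "E 3 (\<lambda>b. of_bool (?Q b)) = 2 / real (card D) ^ 3"
  proof -
    have "{[s, s, - s], [s, - s, s]} \<subseteq> walks 3" using s_in D_uminus by auto
    then have "{b \<in> walks 3. ?Q b} = {[s, s, - s], [s, - s, s]}" by auto
    moreover have "card {[s, s, - s], [s, - s, s]} = 2" using s_neq_uminus by simp
    ultimately have c: "card {b \<in> walks 3. ?Q b} = 2" by (simp only:)
    have "(\<Sum>b\<in>walks 3. of_bool (?Q b) :: real) = (\<Sum>b\<in>walks 3. if ?Q b then 1 else 0)"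
      by (rule sum.cong) auto
    also have "\<dots> = (\<Sum>b\<in>{b \<in> walks 3. ?Q b}. 1)"
      by (rule sum.inter_filter[OF finite_walks, symmetric])
    also have "\<dots> = 2" using c by simp
    finally have "(\<Sum>b\<in>walks 3. of_bool (?Q b) :: real) = 2" .
    then show ?thesis by (simp add: E_eq_sum card_walks)
  qed
  have "2 / real (card D) ^ 3 * escape A 0 n * avoid n s A \<le> 2 / real (card D) ^ 3 * escape A 0 (3*i) * avoid m s A"
    using n by (intro mult_mono escape_antimono avoid_antimono mult_nonneg_nonneg escape_nonneg avoid_nonneg) auto
  also have "\<dots> = E (3*i) (\<lambda>xs. of_bool (?P xs)) * (E 3 (\<lambda>b. of_bool (?Q b)) * E m (\<lambda>ys. of_bool (?R ys)))"
  proof -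
    have "E (3*i) (\<lambda>xs. of_bool (?P xs)) =
      E (3*i) (\<lambda>w. of_bool (\<forall>k\<le>3*i. k > 0 \<longrightarrow> sum_list (take k (rev w)) \<notin> A))"
      by (rule E_uminus)
    also have "\<dots> = escape A 0 (3*i)" unfolding escape_eq by (rule E_rev)
    finally have past: "E (3*i) (\<lambda>xs. of_bool (?P xs)) = escape A 0 (3*i)" .
    show ?thesis unfolding past two avoid_def by simp
  qed
  also have "\<dots> = E (3*i) (\<lambda>xs. E 3 (\<lambda>b. E m (\<lambda>ys. of_bool (?P xs) * (of_bool (?Q b) * of_bool (?R ys)))))"
  proof -
    have r: "E k (\<lambda>xs. F xs * c) = E k F * c" for k F c
      using E_cmult[of k c F] by (simp add: mult.commute)
    show ?thesis by (simp only: E_cmult r)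
  qed
  also have "\<dots> \<le> E (3*i) (\<lambda>xs. E 3 (\<lambda>b. E m (\<lambda>ys. of_bool (i \<in> good (xs @ b @ ys)))))"
  proof (intro E_mono)
    fix xs b ys :: "'a list" assume "length xs = 3*i" "length ys = m"
    then show "of_bool (?P xs) * (of_bool (?Q b) * of_bool (?R ys)) \<le> (of_bool (i \<in> good (xs @ b @ ys)) :: real)"
      using good[of xs ys b] by (cases "?P xs"; cases "?Q b"; cases "?R ys") simp_all
  qed
  also have "\<dots> = E n (\<lambda>w. of_bool (i \<in> good w))" by (simp only: n E_append)
  finally show ?thesis by (simp add: A_def)
qed

lemma entropy_range_ge:
  "real (n div 3) * (2 / real (card D) ^ 3 * escape {0, s + s} 0 n * avoid n s {0, s + s})
    \<le> entropy2 (map_pmf (visited 0) (pmf_of_set (walks n)))"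
proof -
  let ?c = "2 / real (card D) ^ 3 * escape {0, s + s} 0 n * avoid n s {0, s + s}"
  have "real (n div 3) * ?c = (\<Sum>i<n div 3. ?c)" by simp
  also have "\<dots> \<le> (\<Sum>i<n div 3. E n (\<lambda>w. of_bool (i \<in> good w)))"
    by (intro sum_mono prob_good_ge) simp
  also have "\<dots> = E n (\<lambda>w. \<Sum>i<n div 3. of_bool (i \<in> good w))" by (rule E_sum[symmetric])
  also have "\<dots> = E n (\<lambda>w. real (card (good w)))"
  proof (rule E_cong)
    fix w :: "'a list" assume "length w = n"
    then have "{..<n div 3} \<inter> {i. i \<in> good w} = good w" by (auto simp: good_def)
    then show "(\<Sum>i<n div 3. of_bool (i \<in> good w)) = real (card (good w))" by simp
  qed
  also have "\<dots> \<le> entropy2 (map_pmf (visited 0) (pmf_of_set (walks n)))" by (rule entropy_ge_good)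
  finally show ?thesis .
qed

end

end

section \<open>Green's function in the plane\<close>

fun binom_walk :: "nat \<Rightarrow> int \<Rightarrow> real" where
  "binom_walk 0 u = of_bool (u = 0)"
| "binom_walk (Suc k) u = (binom_walk k (u - 1) + binom_walk k (u + 1)) / 2"

lemma binom_walk_nonneg: "0 \<le> binom_walk k u"
  by (induction k arbitrary: u) auto

lemma binom_walk_uminus: "binom_walk k (- u) = binom_walk k u"
proof (induction k arbitrary: u)
  case (Suc k)
  have "- u - 1 = - (u + 1)" "- u + 1 = - (u - 1)" by auto
  then show ?case by (simp only: binom_walk.simps Suc add.commute)
qed auto

lemma binom_walk_outside: "\<bar>u\<bar> > int k \<Longrightarrow> binom_walk k u = 0"
  by (induction k arbitrary: u) auto

lemma binom_walk_odd: "odd (u + int k) \<Longrightarrow> binom_walk k u = 0"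
  by (induction k arbitrary: u) auto

lemma binom_walk_eq: "binom_walk k (2 * int j - int k) = real (k choose j) / 2 ^ k"
proof (induction k arbitrary: j)
  case 0
  then show ?case by (cases j) auto
next
  case (Suc k)
  show ?case
  proof (cases j)
    case 0
    have e: "2 * int j - int (Suc k) + 1 = 2 * int j - int k" by simp
    show ?thesis using 0 Suc.IH[of 0] by (simp add: binom_walk_outside e[symmetric])
  next
    case (Suc i)
    have e: "2 * int j - int (Suc k) + 1 = 2 * int j - int k" "2 * int j - int (Suc k) - 1 = 2 * int i - int k"
      using Suc by simp_all
    show ?thesis by (simp only: binom_walk.simps e Suc.IH) (simp add: Suc field_simps)
  qed
qed

text \<open>The return probability of the one-dimensional walk at time \<open>2 * m\<close>. Planar
  probabilities are products of two such numbers, so it is enough to estimate its square, and this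
  follows from the rational recursion \<open>central_Suc\<close>.\<close>

definition central :: "nat \<Rightarrow> real" where
  "central m = real ((2 * m) choose m) / 4 ^ m"

lemma central_Suc: "central (Suc m) = central m * (2 * real m + 1) / (2 * real m + 2)"
proof -
  have "(2 * m + 2) choose (m + 1) = ((2*m+1) choose m) + ((2*m+1) choose (m+1))"
    by (simp add: numeral_2_eq_2)
  also have sy: "(2*m+1) choose (m+1) = (2*m+1) choose m"
    using binomial_symmetric[of "m+1" "2*m+1"] by simp
  finally have 1: "(2 * m + 2) choose (m + 1) = 2 * ((2*m+1) choose m)" by simp
  define X Y where "X = ((2*m+1) choose m)" and "Y = ((2*m) choose m)"
  have "(m+1) * X = (2*m+1) * Y"
    using Suc_times_binomial_eq[of "2*m" m] unfolding X_def Y_def sy[symmetric] by (simp add: mult.commute)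
  then have "real ((m+1) * X) = real ((2*m+1) * Y)" by (simp only:)
  then have 3: "real X = (2 * real m + 1) * real Y / (real m + 1)"
    by (simp add: field_simps)
  have "central (Suc m) = real ((2 * m + 2) choose (m + 1)) / 4 ^ Suc m" by (simp add: central_def)
  also have "\<dots> = 2 * real X / 4 ^ Suc m" by (simp only: 1 X_def of_nat_mult of_nat_numeral)
  also have "\<dots> = central m * (2 * real m + 1) / (2 * real m + 2)"
  proof -
    have "2 * (a * y / x) / (4 * c) = y / c * a / (2 * x)" if "x > 0" "c > 0" for a x y c :: real
      using that by (simp add: field_simps)
    from this[of "real m + 1" "4 ^ m" "2 * real m + 1" "real Y"] show ?thesis
      unfolding central_def Y_def[symmetric] 3 by (simp add: algebra_simps)
  qed
  finally show ?thesis .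
qed

lemma central_pos: "central m > 0"
  by (simp add: central_def)

lemma central_sq_le: "(central m)\<^sup>2 \<le> 1 / (2 * real m + 1)"
proof (induction m)
  case 0
  then show ?case by (simp add: central_def)
next
  case (Suc m)
  have "(central (Suc m))\<^sup>2 = (central m)\<^sup>2 * ((2 * real m + 1) / (2 * real m + 2))\<^sup>2"
    by (simp add: central_Suc power_mult_distrib power_divide)
  also have "\<dots> \<le> 1 / (2 * real m + 1) * ((2 * real m + 1) / (2 * real m + 2))\<^sup>2"
    by (rule mult_right_mono[OF Suc]) simp
  also have "\<dots> = (2 * real m + 1) / (2 * real m + 2)\<^sup>2"
  proof -
    have "1 / a * (a / b)\<^sup>2 = a / b\<^sup>2" for a b :: real by (simp add: power_divide power2_eq_square)
    then show ?thesis .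
  qed
  also have "\<dots> \<le> 1 / (2 * real (Suc m) + 1)"
  proof -
    have "a / (a + 1)\<^sup>2 \<le> 1 / (a + 2)" if "a > 0" for a :: real
    proof -
      have "a * (a + 2) \<le> 1 * (a + 1)\<^sup>2" by (simp add: power2_eq_square algebra_simps)
      then show ?thesis using that by (subst frac_le_eq) (auto intro!: divide_nonpos_pos)
    qed
    from this[of "2 * real m + 1"] show ?thesis by (simp add: algebra_simps)
  qed
  finally show ?case .
qed

lemma central_sq_ge: "m \<ge> 1 \<Longrightarrow> 1 / (4 * real m) \<le> (central m)\<^sup>2"
proof (induction m rule: nat_induct_at_least)
  case base
  then show ?case by (simp add: central_def power2_eq_square)
next
  case (Suc m)
  have "1 / (4 * real (Suc m)) \<le> 1 / (4 * real m) * ((2 * real m + 1) / (2 * real m + 2))\<^sup>2"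
  proof -
    have "1 / (4 * x) * ((2 * x + 1) / (2 * x + 2))\<^sup>2 - 1 / (4 * (x + 1)) = 1 / (16 * x * (x + 1)\<^sup>2)"
      if "x > 0" for x :: real
    proof -
      have e: "2 * x + 2 = 2 * (x + 1)" by simp
      show ?thesis unfolding e power_divide power_mult_distrib using that
        by (simp add: divide_simps) (simp add: power2_eq_square algebra_simps)
    qed
    from this[of "real m"] Suc.hyps
    have "1 / (4 * real m) * ((2 * real m + 1) / (2 * real m + 2))\<^sup>2 - 1 / (4 * (real m + 1)) \<ge> 0" by simp
    then show ?thesis by (simp add: add.commute)
  qed
  also have "\<dots> \<le> (central m)\<^sup>2 * ((2 * real m + 1) / (2 * real m + 2))\<^sup>2"
    by (rule mult_right_mono[OF Suc.IH]) simp
  also have "\<dots> = (central (Suc m))\<^sup>2"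
    by (simp add: central_Suc power_mult_distrib power_divide)
  finally show ?case .
qed

lemma binom_walk_le_central: "binom_walk k u \<le> central (k div 2)"
proof -
  have even: "binom_walk (2 * m) u \<le> central m" for m u
  proof (cases "\<bar>u\<bar> > int (2 * m) \<or> odd u")
    case True
    then have "binom_walk (2 * m) u = 0" using binom_walk_outside binom_walk_odd[of u "2*m"] by auto
    then show ?thesis using central_pos[of m] by simp
  next
    case False
    define j where "j = nat ((u + int (2 * m)) div 2)"
    have u: "u = 2 * int j - int (2 * m)" using False unfolding j_def by (auto elim!: evenE)
    have "binom_walk (2 * m) u = real ((2 * m) choose j) / 2 ^ (2 * m)"
      unfolding u by (rule binom_walk_eq)
    also have "\<dots> \<le> central m"
      unfolding central_def power_mult using binomial_maximum'[of m j] by (simp add: divide_right_mono)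
    finally show ?thesis .
  qed
  show ?thesis
  proof (cases "even k")
    case True
    then obtain m where m: "k = 2 * m" by auto
    show ?thesis using even[of m u] by (simp add: m)
  next
    case False
    then obtain m where m: "k = 2 * m + 1" by (auto elim!: oddE)
    show ?thesis using even[of m "u - 1"] even[of m "u + 1"] by (simp add: m)
  qed
qed

text \<open>The ratio of neighbouring binomial coefficients, \<open>(m - j) / (m + j + 1)\<close>,
  is at least \<open>1 - (2*j + 1) / m\<close>, and the first \<open>j\<close> odd numbers sum to
  \<open>j^2\<close>. So displacement \<open>2 * j\<close> keeps a share \<open>1 - j^2 / m\<close>
  of the central probability.\<close>

lemma binom_walk_ge_even:
  assumes "2 * i\<^sup>2 \<le> int m" "m \<ge> 1"
  shows "central m / 2 \<le> binom_walk (2 * m) (2 * i)"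
proof -
  have main: "real ((2 * m) choose (m + j)) \<ge> real ((2 * m) choose m) * (1 - (real j)\<^sup>2 / real m)" for j
  proof (induction j)
    case (Suc j)
    show ?case
    proof (cases "j < m \<and> (real j)\<^sup>2 \<le> real m")
      case False
      \<comment> \<open>Outside the range of the ratio argument the claimed lower bound is not
        positive.\<close>
      have "1 - (real (Suc j))\<^sup>2 / real m \<le> 0"
      proof (cases "j < m")
        case True
        then have "(real j)\<^sup>2 > real m" using False by auto
        moreover have "(real j)\<^sup>2 \<le> (real (Suc j))\<^sup>2" by (rule power_mono) auto
        ultimately have "real m \<le> (real (Suc j))\<^sup>2" by linarith
        then have "1 \<le> (real (Suc j))\<^sup>2 / real m" using assms(2) by (subst le_divide_eq_1_pos) auto
        then show ?thesis by linarith
      next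
        case False
        then have "real m \<le> real (Suc j) * 1" by simp
        also have "\<dots> \<le> real (Suc j) * real (Suc j)" by (rule mult_left_mono) auto
        finally show ?thesis using assms(2) by (simp add: field_simps power2_eq_square)
      qed
      then have "real ((2 * m) choose m) * (1 - (real (Suc j))\<^sup>2 / real m) \<le> 0"
        by (simp add: mult_nonneg_nonpos)
      then show ?thesis by (rule order_trans) simp
    next
      case True
      have "(m + Suc j) * ((2 * m) choose (m + Suc j)) = (2 * m - (m + j)) * ((2 * m) choose (m + j))"
        using binomial_absorb_comp[of "2*m" "m+j"] binomial_absorption[of "m+j" "2*m"] by simp
      then have "real (m + Suc j) * real ((2 * m) choose (m + Suc j)) = real (m - j) * real ((2 * m) choose (m + j))"
        by (metis of_nat_mult diff_add_inverse2 diff_diff_left mult_2 add_diff_cancel_left')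
      then have step: "real ((2 * m) choose (m + Suc j)) = real ((2 * m) choose (m + j)) * ((real m - real j) / (real m + real j + 1))"
        using True by (simp add: field_simps of_nat_diff)
      have frac: "1 - (2 * real j + 1) / real m \<le> (real m - real j) / (real m + real j + 1)"
      proof -
        have "(real m - real j) / (real m + real j + 1) = 1 - (2 * real j + 1) / (real m + real j + 1)"
          by (simp add: field_simps)
        moreover have "(2 * real j + 1) / (real m + real j + 1) \<le> (2 * real j + 1) / real m"
          using assms(2) by (intro divide_left_mono) auto
        ultimately show ?thesis by simp
      qed
      have "1 - (real (Suc j))\<^sup>2 / real m \<le> (1 - (real j)\<^sup>2 / real m) * (1 - (2 * real j + 1) / real m)"
      proof -
        have "(real (Suc j))\<^sup>2 / real m = (real j)\<^sup>2 / real m + (2 * real j + 1) / real m"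
          by (simp add: power2_eq_square add_divide_distrib[symmetric] algebra_simps)
        moreover have "(1 - a) * (1 - b) = 1 - (a + b) + a * b" for a b :: real by (simp add: algebra_simps)
        moreover have "(real j)\<^sup>2 / real m * ((2 * real j + 1) / real m) \<ge> 0" by simp
        ultimately show ?thesis by simp
      qed
      also have "\<dots> \<le> (1 - (real j)\<^sup>2 / real m) * ((real m - real j) / (real m + real j + 1))"
        using True by (intro mult_left_mono frac) (simp add: field_simps)
      finally have "real ((2 * m) choose m) * (1 - (real (Suc j))\<^sup>2 / real m) \<le>
         real ((2 * m) choose m) * ((1 - (real j)\<^sup>2 / real m) * ((real m - real j) / (real m + real j + 1)))"
        by (rule mult_left_mono) simp
      also have "\<dots> \<le> real ((2 * m) choose (m + j)) * ((real m - real j) / (real m + real j + 1))"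
        unfolding mult.assoc[symmetric] using True by (intro mult_right_mono Suc.IH) auto
      finally show ?thesis by (simp only: step)
    qed
  qed simp
  define j where "j = nat \<bar>i\<bar>"
  have ji: "int j = \<bar>i\<bar>" by (simp add: j_def)
  have "2 * (int j)\<^sup>2 \<le> int m" using assms(1) by (simp add: ji)
  then have "2 * j\<^sup>2 \<le> m" by (metis of_nat_le_iff of_nat_mult of_nat_numeral of_nat_power)
  then have "2 * (real j)\<^sup>2 \<le> real m" by (metis of_nat_le_iff of_nat_mult of_nat_numeral of_nat_power)
  then have half: "1 / 2 \<le> 1 - (real j)\<^sup>2 / real m" using assms(2) by (simp add: field_simps)
  have "binom_walk (2 * m) (2 * i) = binom_walk (2 * m) (2 * int j)"
    using binom_walk_uminus[of "2*m" "2*i"] ji by (cases "i \<ge> 0") auto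
  also have "2 * int j = 2 * int (m + j) - int (2 * m)" by simp
  also have "binom_walk (2 * m) \<dots> = real ((2 * m) choose (m + j)) / 4 ^ m"
    unfolding binom_walk_eq by (simp add: power_mult)
  finally have e: "binom_walk (2 * m) (2 * i) = real ((2 * m) choose (m + j)) / 4 ^ m" .
  have "central m / 2 = real ((2 * m) choose m) * (1 / 2) / 4 ^ m" by (simp add: central_def)
  also have "\<dots> \<le> real ((2 * m) choose m) * (1 - (real j)\<^sup>2 / real m) / 4 ^ m"
    by (intro divide_right_mono mult_left_mono half) auto
  also have "\<dots> \<le> binom_walk (2 * m) (2 * i)" unfolding e by (intro divide_right_mono main) auto
  finally show ?thesis .
qed

section \<open>Dyadic harmonic sums\<close>

lemma harmonic_dyadic_ge: "i \<le> a \<Longrightarrow> (real a - real i) / 2 \<le> (\<Sum>m\<in>{2^i..<2^a}. 1 / real m)"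
proof (induction a rule: dec_induct)
  case (step a)
  have "1 / 2 = (\<Sum>m\<in>{2^a..<2^Suc a::nat}. 1 / real (2 ^ Suc a))" by simp
  also have "\<dots> \<le> (\<Sum>m\<in>{2^a..<2^Suc a}. 1 / real m)"
  proof (rule sum_mono)
    fix m :: nat assume m: "m \<in> {2^a..<2^Suc a}"
    then have "real m \<le> real (2 ^ Suc a)" by (intro of_nat_mono) auto
    moreover have "(1::nat) \<le> 2 ^ a" by simp
    then have "m \<ge> 1" using m by (meson atLeastLessThan_iff le_trans)
    then have "real m > 0" by simp
    ultimately show "1 / real (2 ^ Suc a) \<le> 1 / real m" by (intro divide_left_mono) auto
  qed
  finally have h: "1 / 2 \<le> (\<Sum>m\<in>{2^a..<2^Suc a}. 1 / real m)" .
  have "{2^i..<2^Suc a::nat} = {2^i..<2^a} \<union> {2^a..<2^Suc a}"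
    using step.hyps by (intro ivl_disj_un(17)[symmetric] power_increasing) auto
  then have "(\<Sum>m\<in>{2^i..<2^Suc a}. 1 / real m) = (\<Sum>m\<in>{2^i..<2^a}. 1 / real m) + (\<Sum>m\<in>{2^a..<2^Suc a}. 1 / real m)"
    by (simp add: sum.union_disjoint ivl_disj_int)
  then show ?case using step.IH h by (simp add: field_simps)
qed simp

lemma harmonic_dyadic_le: "(\<Sum>k\<in>{1..2^a}. 1 / real k) \<le> real a + 1"
proof (induction a)
  case (Suc a)
  have "{1..2^Suc a::nat} = {1..2^a} \<union> {2^a<..2^Suc a}" by auto
  then have "(\<Sum>k\<in>{1..2^Suc a}. 1 / real k) = (\<Sum>k\<in>{1..2^a}. 1 / real k) + (\<Sum>k\<in>{2^a<..2^Suc a}. 1 / real k)"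
    by (simp add: sum.union_disjoint ivl_disj_int)
  also have "(\<Sum>k\<in>{2^a<..2^Suc a}. 1 / real k) \<le> (\<Sum>k\<in>{2^a<..2^Suc a::nat}. 1 / real (2 ^ a))"
  proof (rule sum_mono)
    fix k :: nat assume "k \<in> {2^a<..2^Suc a}"
    then have le: "real (2 ^ a) \<le> real k" by (intro of_nat_mono) auto
    have "0 < real (2 ^ a)" by simp
    with le have "0 < real k" by linarith
    with le show "1 / real k \<le> 1 / real (2 ^ a)" by (intro divide_left_mono) auto
  qed
  also have "\<dots> = 1" by simp
  finally show ?case using Suc by simp
qed simp

section \<open>The planar walk\<close>

definition D2 :: "(int \<times> int) set" where
  "D2 = {(1, 0), (-1, 0), (0, 1), (0, -1)}"

interpretation plane: sym_walk D2
  by unfold_locales (auto simp: D2_def)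

lemma card_D2 [simp]: "card D2 = 4"
  by (simp add: D2_def)

lemma sum_D2: "(\<Sum>s\<in>D2. h s) = h (1, 0) + h (-1, 0) + h (0, 1) + h (0, -1)"
  by (simp add: D2_def add.assoc)

text \<open>In the coordinates \<open>x + y\<close> and \<open>x - y\<close> a planar step is a pair of independent signs.\<close>
lemma plane_p: "plane.p k (x, y) = binom_walk k (x + y) * binom_walk k (x - y)"
proof (induction k arbitrary: x y)
  case 0
  show ?case by (auto simp: plane.p_0 zero_prod_def)
next
  case (Suc k)
  have "plane.p (Suc k) (x, y) = (plane.p k (x - 1, y) + plane.p k (x + 1, y) + plane.p k (x, y - 1) + plane.p k (x, y + 1)) / 4"
    by (simp add: plane.p_Suc sum_D2)
  also have "\<dots> = binom_walk (Suc k) (x + y) * binom_walk (Suc k) (x - y)"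
    by (simp add: Suc algebra_simps add_divide_distrib)
  finally show ?case .
qed

lemma plane_p_le: "k \<ge> 1 \<Longrightarrow> plane.p k z \<le> 1 / real k"
proof -
  assume k: "k \<ge> 1"
  obtain x y where z: "z = (x, y)" by (cases z)
  have "plane.p k z \<le> central (k div 2) * central (k div 2)"
    unfolding z plane_p by (intro mult_mono binom_walk_le_central binom_walk_nonneg) (simp add: central_pos less_imp_le)
  also have "\<dots> \<le> 1 / (2 * real (k div 2) + 1)" using central_sq_le[of "k div 2"] by (simp add: power2_eq_square)
  also have "\<dots> \<le> 1 / real k"
  proof (rule divide_left_mono)
    have "k \<le> 2 * (k div 2) + 1" by presburger
    then have "real k \<le> real (2 * (k div 2) + 1)" by (rule of_nat_mono)
    then show "real k \<le> 2 * real (k div 2) + 1" by simp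
  qed (use k in auto)
  finally show ?thesis .
qed

lemma plane_green_le: "n \<le> 2 ^ a \<Longrightarrow> plane.green n z \<le> real a + 2"
proof -
  assume n: "n \<le> 2 ^ a"
  have "plane.green n z \<le> plane.green (2 ^ a) z" by (rule plane.green_mono[OF n])
  also have "\<dots> = plane.p 0 z + (\<Sum>k\<in>{1..2^a}. plane.p k z)"
  proof -
    have "{..2^a::nat} = insert 0 {1..2^a}" by auto
    then show ?thesis by (simp add: plane.green_def)
  qed
  also have "\<dots> \<le> 1 + (\<Sum>k\<in>{1..2^a}. 1 / real k)"
    by (intro add_mono plane.p_le_1 sum_mono plane_p_le) simp
  also have "\<dots> \<le> real a + 2" using harmonic_dyadic_le[of a] by simp
  finally show ?thesis .
qed

text \<open>Parity forces one more step when \<open>x + y\<close> is odd. An odd displacement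
  \<open>2*i+1\<close> averages the even ones \<open>2*i\<close> and \<open>2*i+2\<close>, which is
  why the condition on \<open>m\<close> involves \<open>r + 1\<close> instead of
  \<open>r\<close>.\<close>

lemma plane_p_ge:
  assumes xy: "\<bar>x\<bar> + \<bar>y\<bar> \<le> 2 * int r" and m: "m \<ge> 2 * (r + 1)\<^sup>2"
  shows "1 / (16 * real m) \<le> plane.p (2 * m + (if even (x + y) then 0 else 1)) (x, y)"
proof -
  have m1: "m \<ge> 1" using m by (auto simp: power2_eq_square)
  have sq: "2 * i\<^sup>2 \<le> int m" if "\<bar>i\<bar> \<le> int r + 1" for i :: int
  proof -
    have "i\<^sup>2 \<le> (int r + 1)\<^sup>2" using that by (simp add: abs_le_square_iff[symmetric])
    moreover have "2 * (int r + 1)\<^sup>2 = int (2 * (r + 1)\<^sup>2)" by simp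
    ultimately show ?thesis using m by linarith
  qed
  have even: "central m / 2 \<le> binom_walk (2 * m) (2 * i)" if "\<bar>i\<bar> \<le> int r + 1" for i
    by (rule binom_walk_ge_even[OF sq[OF that] m1])
  have bd: "\<bar>x + y\<bar> \<le> 2 * int r" "\<bar>x - y\<bar> \<le> 2 * int r" using xy by auto
  have b: "central m / 2 \<le> binom_walk (2 * m + (if even (x + y) then 0 else 1)) u"
    if "\<bar>u\<bar> \<le> 2 * int r" "even u \<longleftrightarrow> even (x + y)" for u
  proof (cases "even u")
    case True
    then obtain i where "u = 2 * i" by auto
    then show ?thesis using even[of i] that True by auto
  next
    case False
    then obtain i where i: "u = 2 * i + 1" by (auto elim!: oddE)
    have "binom_walk (2 * m + 1) u = (binom_walk (2 * m) (2 * i) + binom_walk (2 * m) (2 * (i + 1))) / 2"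
      by (simp add: i algebra_simps)
    moreover have "\<bar>i\<bar> \<le> int r + 1" "\<bar>i + 1\<bar> \<le> int r + 1" using that(1) i by linarith+
    ultimately have "central m / 2 \<le> binom_walk (2 * m + 1) u" using even[of i] even[of "i + 1"] by simp
    then show ?thesis using False that by simp
  qed
  have "1 / (16 * real m) = (1 / (4 * real m)) / 4" by simp
  also have "\<dots> \<le> (central m)\<^sup>2 / 4" by (intro divide_right_mono central_sq_ge m1) simp
  also have "\<dots> = (central m / 2) * (central m / 2)" by (simp add: power2_eq_square)
  also have "\<dots> \<le> plane.p (2 * m + (if even (x + y) then 0 else 1)) (x, y)"
    unfolding plane_p
    by (intro mult_mono b bd binom_walk_nonneg) (auto simp: central_pos less_imp_le)
  finally show ?thesis .
qed

text \<open>Half-times from \<open>2^(2*j+3) \<ge> 2 * (2^j + 1)^2\<close> on are in the diffusive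
  regime, where a probability is at least \<open>1 / (16 * m)\<close>. Each doubling of
  \<open>m\<close> adds 1/2 to the harmonic sum, hence 1/32 in all.\<close>

lemma plane_green_ge:
  assumes xy: "\<bar>x\<bar> + \<bar>y\<bar> \<le> 2 * 2 ^ j" and a: "2 * j + 3 \<le> a" and n: "2 ^ (a + 1) \<le> n"
  shows "(real a - (2 * real j + 3)) / 32 \<le> plane.green n (x, y)"
proof -
  define e :: nat where "e = (if even (x + y) then 0 else 1)"
  let ?M = "{2^(2*j+3)..<2^a::nat}"
  have "(2 ^ j + 1 :: nat)\<^sup>2 \<le> (2 * 2 ^ j)\<^sup>2" by (rule power_mono) simp_all
  then have "(2 ^ j + 1 :: nat)\<^sup>2 \<le> 4 * (2 ^ j)\<^sup>2" by (simp add: power_mult_distrib)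
  moreover have "(2 ^ (2*j+3) :: nat) = 8 * (2 ^ j)\<^sup>2" by (simp add: power_add power_even_eq)
  ultimately have r: "2 * (2 ^ j + 1 :: nat)\<^sup>2 \<le> 2 ^ (2*j+3)" by linarith
  have "(real a - (2 * real j + 3)) / 32 = ((real a - real (2*j+3)) / 2) / 16" by simp
  also have "\<dots> \<le> (\<Sum>m\<in>?M. 1 / real m) / 16" by (intro divide_right_mono harmonic_dyadic_ge a) simp
  also have "\<dots> = (\<Sum>m\<in>?M. 1 / (16 * real m))" by (simp add: sum_divide_distrib mult.commute)
  also have "\<dots> \<le> (\<Sum>m\<in>?M. plane.p (2 * m + e) (x, y))"
    unfolding e_def using r xy by (intro sum_mono plane_p_ge[where r = "2 ^ j"]) auto
  also have "\<dots> = (\<Sum>k\<in>(\<lambda>m. 2 * m + e) ` ?M. plane.p k (x, y))"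
    by (simp add: sum.reindex inj_on_def)
  also have "\<dots> \<le> plane.green n (x, y)"
    unfolding plane.green_def
  proof (rule sum_mono2)
    show "(\<lambda>m. 2 * m + e) ` ?M \<subseteq> {..n}"
    proof
      fix k assume "k \<in> (\<lambda>m. 2 * m + e) ` ?M"
      then obtain m where m: "m < 2 ^ a" "k = 2 * m + e" by auto
      then show "k \<in> {..n}" using n by (auto simp: e_def)
    qed
  qed (auto simp: plane.p_nonneg)
  finally show ?thesis .
qed

lemma plane_escape_le:
  assumes "a \<ge> 4" "2 ^ (a + 1) \<le> n"
  shows "plane.escape {0} 0 n \<le> 32 / (real a - 3)"
proof -
  have g: "(real a - 3) / 32 \<le> plane.green n 0"
    using plane_green_ge[of 0 0 0 a n] assms by (simp add: zero_prod_def)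
  have "plane.escape {0} 0 n * ((real a - 3) / 32) \<le> plane.escape {0} 0 n * plane.green n 0"
    by (intro mult_left_mono g plane.escape_nonneg)
  also have "\<dots> \<le> 1" by (rule plane.escape_green_le)
  finally show ?thesis using assms by (simp add: field_simps)
qed

section \<open>Planar lower bound: escaping from a pair of points\<close>

context sym_walk
begin

lemma avoid_reflect: "avoid n (t - x) ((-) t ` A) = avoid n x A"
proof -
  have "visited (t - x) (map uminus xs) = (-) t ` visited x xs" for xs
    by (induction xs arbitrary: x) (auto simp: diff_diff_eq)
  then have "(visited (t - x) (map uminus xs) \<inter> (-) t ` A = {}) = (visited x xs \<inter> A = {})" for xs
    by auto
  then have "E n (\<lambda>xs. of_bool (visited (t - x) (map uminus xs) \<inter> (-) t ` A = {})) = avoid n x A"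
    by (simp add: avoid_def)
  then show ?thesis
    unfolding avoid_def[of n "t - x"] using E_uminus[of n "\<lambda>xs. of_bool (visited (t - x) xs \<inter> (-) t ` A = {})"] by simp
qed

text \<open>The reflection sending \<open>x\<close> to \<open>t - x\<close> exchanges the two
  points. The last exit decomposition of the pair then contains a single unknown function.\<close>

lemma escape_pair_symmetric: "escape {0, t} t n = escape {0, t} 0 n"
proof (cases n)
  case (Suc m)
  have im: "(-) t ` {0, t} = {0, t}" by auto
  have "(\<Sum>s\<in>D. avoid m (t + s) {0, t}) = (\<Sum>s\<in>D. avoid m (t + - s) {0, t})"
    using sum_D_uminus[of "\<lambda>s. avoid m (t + s) {0, t}"] by simp
  also have "\<dots> = (\<Sum>s\<in>D. avoid m (0 + s) {0, t})"
  proof (rule sum.cong[OF refl])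
    fix s
    show "avoid m (t + - s) {0, t} = avoid m (0 + s) {0, t}"
      using avoid_reflect[of m t s "{0, t}"] unfolding im by simp
  qed
  finally show ?thesis by (simp add: Suc)
qed simp

lemma avoid_step:
  assumes "x \<notin> A" "s \<in> D"
  shows "avoid n (x + s) A \<le> real (card D) * avoid (Suc n) x A"
proof -
  have "avoid n (x + s) A \<le> (\<Sum>s\<in>D. avoid n (x + s) A)"
    by (rule member_le_sum[OF assms(2)]) (auto simp: avoid_nonneg finite_D)
  then show ?thesis using card_D_pos by (simp add: avoid_Suc[OF assms(1)])
qed

end

text \<open>Take the horizon \<open>5 * n\<close>. Last exits after time \<open>4 * n\<close> have
  total mass at most \<open>n * (2 / (4 * n)) = 1 / 2\<close>. The earlier ones, which leave at
  least \<open>n\<close> steps, carry the other half, while their weights sum to at most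
  \<open>2 * (a + 2)\<close>.\<close>

lemma plane_escape_pair_ge:
  assumes t: "t \<noteq> 0" and n: "n \<ge> 1" and a: "4 * n \<le> 2 ^ a"
  shows "1 / (4 * (real a + 2)) \<le> plane.escape {0, t} 0 n"
proof -
  define e where "e = plane.escape {0, t} 0"
  define h where "h k = (plane.p k 0 + plane.p k t) * e (5 * n - k)" for k
  have h0: "h k \<le> (plane.p k 0 + plane.p k t) * e n" if "k \<le> 4 * n" for k
    unfolding h_def e_def using that
    by (intro mult_left_mono plane.escape_antimono) (auto simp: plane.p_nonneg)
  have h1: "h k \<le> 1 / (2 * real n)" if "k > 4 * n" for k
  proof -
    have "plane.p k z \<le> 1 / (4 * real n)" for z
    proof -
      have "plane.p k z \<le> 1 / real k" by (rule plane_p_le) (use that in auto)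
      also have "\<dots> \<le> 1 / (4 * real n)" using that n by (intro divide_left_mono) auto
      finally show ?thesis .
    qed
    from this[of 0] this[of t] have "plane.p k 0 + plane.p k t \<le> 1 / (2 * real n)" by simp
    moreover have "h k \<le> (plane.p k 0 + plane.p k t) * 1"
      unfolding h_def e_def by (intro mult_left_mono plane.escape_le_1) (simp add: plane.p_nonneg)
    ultimately show ?thesis by simp
  qed
  have "1 = (\<Sum>k\<le>5*n. h k)"
    using plane.last_exit_total[of "{0, t}" "5*n" 0] t
    by (simp add: h_def e_def plane.escape_pair_symmetric algebra_simps)
  also have "{..5*n} = {..4*n} \<union> {4*n<..5*n}" by auto
  also have "(\<Sum>k\<in>{..4*n} \<union> {4*n<..5*n}. h k) = (\<Sum>k\<le>4*n. h k) + (\<Sum>k\<in>{4*n<..5*n}. h k)"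
    by (rule sum.union_disjoint) auto
  also have "\<dots> \<le> (\<Sum>k\<le>4*n. (plane.p k 0 + plane.p k t) * e n) + (\<Sum>k\<in>{4*n<..5*n}. 1 / (2 * real n))"
    by (intro add_mono sum_mono h0 h1) auto
  also have "(\<Sum>k\<in>{4*n<..5*n}. 1 / (2 * real n)) = 1 / 2" using n by simp
  also have "(\<Sum>k\<le>4*n. (plane.p k 0 + plane.p k t) * e n) = (plane.green (4*n) 0 + plane.green (4*n) t) * e n"
    by (simp only: plane.green_def sum.distrib[symmetric] sum_distrib_right[symmetric])
  also have "\<dots> \<le> ((real a + 2) + (real a + 2)) * e n"
    unfolding e_def by (intro mult_right_mono add_mono plane_green_le a plane.escape_nonneg)
  finally show ?thesis by (simp add: e_def field_simps)
qed

text \<open>The path (1,0), (1,1), (0,1), (-1,1), (-1,0), together with the mirror image of its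
  first half, leads from (1,0) around the pair to the other neighbours of 0. Each prescribed step
  costs a factor 4, and the longest path has four steps.\<close>

lemma plane_avoid_pair_ge: "plane.escape {0, (2, 0)} 0 (Suc n) \<le> 256 * plane.avoid n (1, 0) {0, (2, 0)}"
proof -
  let ?A = "{0, (2, 0)} :: (int \<times> int) set"
  have st: "plane.avoid n (x + s) ?A \<le> 4 * plane.avoid (Suc n) x ?A" if "x \<notin> ?A" "s \<in> D2" for n x s
    using plane.avoid_step[OF that, of n] by simp
  have up: "plane.avoid n (0, 1) ?A \<le> 16 * plane.avoid (Suc (Suc n)) (1, 0) ?A" for n
    using st[of "(1, 1)" "(-1, 0)" n] st[of "(1, 0)" "(0, 1)" "Suc n"] by (simp add: D2_def zero_prod_def)
  have down: "plane.avoid n (0, -1) ?A \<le> 16 * plane.avoid (Suc (Suc n)) (1, 0) ?A" for n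
    using st[of "(1, -1)" "(-1, 0)" n] st[of "(1, 0)" "(0, -1)" "Suc n"] by (simp add: D2_def zero_prod_def)
  have left: "plane.avoid n (-1, 0) ?A \<le> 16 * plane.avoid (Suc (Suc n)) (0, 1) ?A"
    using st[of "(-1, 1)" "(0, -1)" n] st[of "(0, 1)" "(-1, 0)" "Suc n"] by (simp add: D2_def zero_prod_def)
  have m: "plane.avoid (n + k) (1, 0) ?A \<le> plane.avoid n (1, 0) ?A" for k
    by (rule plane.avoid_antimono) simp
  have nn: "0 \<le> plane.avoid n (1, 0) ?A" by (rule plane.avoid_nonneg)
  have "plane.avoid n (0, 1) ?A \<le> 16 * plane.avoid n (1, 0) ?A"
    "plane.avoid n (0, -1) ?A \<le> 16 * plane.avoid n (1, 0) ?A"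
    "plane.avoid n (-1, 0) ?A \<le> 256 * plane.avoid n (1, 0) ?A"
    using up[of n] down[of n] left up[of "Suc (Suc n)"] m[of 2] m[of 4] by (simp_all add: eval_nat_numeral)
  then show ?thesis using nn by (simp add: sum_D2)
qed

text \<open>The factor 4 is the one demanded by \<open>plane_escape_pair_ge\<close>, which is
  applied both at \<open>n\<close> and at \<open>Suc n\<close>.\<close>

lemma log2_dyadic_bound:
  assumes "n \<ge> 2"
  shows "\<exists>a. 4 * (n + 1) \<le> 2 ^ a \<and> real a \<le> log 2 (real n) + 4"
proof -
  define a where "a = nat \<lceil>log 2 (real (4 * (n + 1)))\<rceil>"
  have l: "log 2 (real (4 * (n + 1))) \<ge> 0" by simp
  have "real (4 * (n + 1)) = 2 powr log 2 (real (4 * (n + 1)))" by simp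
  also have "\<dots> \<le> 2 powr real a" unfolding a_def by (intro powr_mono) (use l in linarith)+
  also have "\<dots> = real (2 ^ a)" by (simp add: powr_realpow)
  finally have 1: "4 * (n + 1) \<le> 2 ^ a" by (simp only: of_nat_le_iff)
  have "real a \<le> log 2 (real (4 * (n + 1))) + 1" unfolding a_def using l by linarith
  also have "log 2 (real (4 * (n + 1))) \<le> log 2 (real n * 2 ^ 3)" using assms by (intro log_mono) auto
  also have "\<dots> = log 2 (real n) + 3"
    using assms by (simp add: log_mult log_nat_power del: power_numeral)
  finally show ?thesis using 1 by auto
qed

lemma plane_entropy_ge:
  assumes n: "n \<ge> 3"
  shows "1 / 10 ^ 8 * real n / (log 2 (real n))\<^sup>2 \<le> entropy2 (map_pmf (visited 0) (pmf_of_set (plane.walks n)))"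
proof -
  define L where "L = log 2 (real n)"
  have L: "L \<ge> 1" using n by (simp add: L_def)
  obtain a where a: "4 * (n + 1) \<le> 2 ^ a" "real a \<le> L + 4" using log2_dyadic_bound[of n] n by (auto simp: L_def)
  let ?A = "{0, (2, 0)} :: (int \<times> int) set"
  have bd: "1 / (28 * L) \<le> 1 / (4 * (real a + 2))" using a(2) L by (intro divide_left_mono) auto
  have e1: "1 / (28 * L) \<le> plane.escape ?A 0 n"
    using plane_escape_pair_ge[of "(2, 0)" n a] a n bd by (simp add: zero_prod_def)
  have "1 / (28 * L) \<le> plane.escape ?A 0 (Suc n)"
    using plane_escape_pair_ge[of "(2, 0)" "Suc n" a] a n bd by (simp add: zero_prod_def)
  then have e2: "1 / (28 * L) / 256 \<le> plane.avoid n (1, 0) ?A" using plane_avoid_pair_ge[of n] by simp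
  have n5: "real n / 5 \<le> real (n div 3)"
  proof -
    have "n \<le> 5 * (n div 3)" using n by presburger
    then have "real n \<le> real (5 * (n div 3))" by (rule of_nat_mono)
    then show ?thesis by simp
  qed
  \<comment> \<open>\<open>n div 3\<close> is at least \<open>n / 5\<close> for
    \<open>n \<ge> 3\<close>; 28 comes from \<open>4 * (a + 2) \<le> 4 * (L + 6)\<close> and
    \<open>L \<ge> 1\<close>; 256 is the cost of walking around the pair.\<close>
  have "1 / 10 ^ 8 * real n / L\<^sup>2 \<le> real n / 5 * (2 / 4 ^ 3 * (1 / (28 * L)) * (1 / (28 * L) / 256))"
    using L by (simp add: power2_eq_square field_simps)
  also have "\<dots> \<le> real (n div 3) * (2 / 4 ^ 3 * plane.escape ?A 0 n * plane.avoid n (1, 0) ?A)"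
    using L by (intro mult_mono n5 e1 e2 mult_left_mono mult_nonneg_nonneg plane.escape_nonneg plane.avoid_nonneg) auto
  also have "\<dots> \<le> entropy2 (map_pmf (visited 0) (pmf_of_set (plane.walks n)))"
    using plane.entropy_range_ge[of "(1, 0)" n] by (simp add: D2_def zero_prod_def)
  finally show ?thesis by (simp add: L_def)
qed

section \<open>Covering a box\<close>

text \<open>The horizon is of the order of the fourth power of the scale \<open>2 ^ j\<close>. Then
  Green's function is at least \<open>(2*j+3) / 32\<close> at the displacement and at most
  \<open>3 * (2*j+3)\<close> at 0, and the quotient 1/96 bounds the hitting probability from
  below.\<close>

lemma plane_avoid_point_le:
  assumes "\<bar>fst y - fst x\<bar> + \<bar>snd y - snd x\<bar> \<le> 2 * 2 ^ j"
  shows "plane.avoid (2 ^ (4 * j + 7)) x {y} \<le> 95 / 96"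
proof -
  let ?m = "2 ^ (4 * j + 7) :: nat"
  have yx: "y - x = (fst y - fst x, snd y - snd x)" by (simp add: prod_eq_iff)
  have "(2 * real j + 3) / 32 \<le> plane.green ?m (y - x)"
    unfolding yx using plane_green_ge[OF assms, of "4 * j + 6" ?m] by simp
  also have "\<dots> \<le> (1 - plane.avoid ?m x {y}) * plane.green ?m 0" by (rule plane.green_le_hit)
  also have "\<dots> \<le> (1 - plane.avoid ?m x {y}) * (3 * (2 * real j + 3))"
  proof (rule mult_left_mono)
    have "plane.green ?m 0 \<le> real (4 * j + 7) + 2" by (rule plane_green_le) simp
    then show "plane.green ?m 0 \<le> 3 * (2 * real j + 3)" by simp
  qed (simp add: plane.avoid_le_1)
  finally have "(2 * real j + 3) * (1 / 96) \<le> (2 * real j + 3) * (1 - plane.avoid ?m x {y})"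
    by (simp add: algebra_simps)
  then have "1 / 96 \<le> 1 - plane.avoid ?m x {y}" by (subst (asm) mult_le_cancel_left_pos) auto
  then show ?thesis by simp
qed

lemma plane_no_late_return_le:
  assumes "t \<ge> 4"
  shows "plane.E (2 ^ (4 * j + 7)) (\<lambda>xs. plane.avoid (2 ^ (t + 1)) (sum_list xs) {0}) \<le> (4 * real j + 9) * (32 / (real t - 3))"
proof -
  have "plane.E (2 ^ (4 * j + 7)) (\<lambda>xs. plane.avoid (2 ^ (t + 1)) (sum_list xs) {0})
     \<le> plane.green (2 ^ (4 * j + 7)) 0 * plane.escape {0} 0 (2 ^ (t + 1))"
    by (rule plane.no_late_return_le)
  also have "\<dots> \<le> (real (4 * j + 7) + 2) * (32 / (real t - 3))"
    using assms by (intro mult_mono plane_green_le plane_escape_le plane.escape_nonneg) auto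
  finally show ?thesis by (simp add: add.commute)
qed

text \<open>Two phases of equal rounds. \<open>M * j\<close> rounds bring the expected number of
  missing points from \<open>4 ^ j\<close> down to 1, at the cost of a failure probability
  \<open>f\<close> of order \<open>(j + 1) / t\<close> per round. Then \<open>2 ^ t\<close> further
  rounds are charged to single points, for which all failures together cost \<open>96 * f\<close>,
  where 96 is \<open>1 / (1 - \<rho>)\<close>. The total has order
  \<open>(j + 1)^2 / t\<close>.\<close>

lemma plane_uncovered_box_le:
  "\<exists>C M. C > 0 \<and> (\<forall>j t x B. t \<ge> 4 * j + 7 \<longrightarrow> M * j \<le> 2 ^ t \<longrightarrow> card B \<le> 4 ^ j \<longrightarrow> finite B \<longrightarrow>
     (\<forall>y\<in>B. \<bar>fst y - fst x\<bar> + \<bar>snd y - snd x\<bar> \<le> 2 * 2 ^ j) \<longrightarrow>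
     plane.uncovered (2 ^ (2 * t + 3)) x B \<le> C * (real j + 1)\<^sup>2 / real t)"
proof -
  define \<rho> :: real where "\<rho> = 95 / 96"
  have "0 < (1 / 4 :: real)" "\<rho> < 1" by (simp_all add: \<rho>_def)
  \<comment> \<open>\<open>M\<close> rounds gain the factor 4 by which the number of points grows
    when the side of a box doubles.\<close>
  then obtain M where M: "\<rho> ^ M < 1 / 4" using real_arch_pow_inv by blast
  define C :: real where "C = 800 * (real M + 96) + 95"
  have "plane.uncovered (2 ^ (2 * t + 3)) x B \<le> C * (real j + 1)\<^sup>2 / real t"
    if tj: "t \<ge> 4 * j + 7" and Mj: "M * j \<le> 2 ^ t" and cB: "card B \<le> 4 ^ j" and fB: "finite B"
      and near: "\<And>y. y \<in> B \<Longrightarrow> \<bar>fst y - fst x\<bar> + \<bar>snd y - snd x\<bar> \<le> 2 * 2 ^ j" for j t x B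
  proof -
    \<comment> \<open>\<open>m\<close> steps explore the box and \<open>k\<close> steps are allowed
      for the return. As \<open>m + k \<le> 3 * 2^t\<close>, both phases fit into
      \<open>6 * 4^t\<close> steps, within the budget \<open>2 ^ (2 * t + 3)\<close>.\<close>
    define m k J :: nat where "m = 2 ^ (4 * j + 7)" and "k = 2 ^ (t + 1)" and "J = 2 ^ t"
    define f where "f = (4 * real j + 9) * (32 / (real t - 3))"
    define \<alpha> where "\<alpha> = 96 * f + \<rho> ^ J"
    have t: "real t \<ge> 7" using tj by simp
    have f0: "f \<ge> 0" using t by (simp add: f_def)
    have f: "plane.E m (\<lambda>xs. plane.avoid k (sum_list xs) {0}) \<le> f"
      unfolding m_def k_def f_def by (rule plane_no_late_return_le) (use tj in simp)
    have \<rho>: "plane.avoid m x {y} \<le> \<rho>" if "y \<in> B" for y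
      unfolding m_def \<rho>_def by (rule plane_avoid_point_le[OF near[OF that]])
    have \<rho>01: "0 \<le> \<rho>" "\<rho> < 1" "\<rho> \<le> 1" by (simp_all add: \<rho>_def)
    have \<alpha>: "plane.uncovered (J * (m + k)) x {y} \<le> \<alpha>" if "y \<in> B" for y
      using plane.uncovered_rounds_point[OF f \<rho>[OF that] \<rho>01(2), of J] by (simp add: \<alpha>_def \<rho>_def)
    have \<alpha>0: "\<alpha> \<ge> 0" using f0 \<rho>01 by (simp add: \<alpha>_def)
    have len: "(M * j) * (m + k) + J * (m + k) \<le> 2 ^ (2 * t + 3)"
    proof -
      define P :: nat where "P = 2 ^ t"
      have "m \<le> P" unfolding m_def P_def by (rule power_increasing) (use tj in auto)
      then have mk: "m + k \<le> 3 * P" by (simp add: k_def P_def)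
      have "(M * j) * (m + k) \<le> P * (3 * P)" using Mj unfolding P_def[symmetric] by (rule mult_le_mono[OF _ mk])
      moreover have "J * (m + k) \<le> P * (3 * P)" unfolding J_def P_def[symmetric] by (rule mult_le_mono[OF order_refl mk])
      moreover have "P * (3 * P) = 3 * (P * P)" by (rule mult.left_commute)
      moreover have "2 ^ (2 * t + 3) = 8 * (P * P)"
        by (simp only: P_def power_add power_even_eq power2_eq_square) simp
      ultimately show ?thesis by linarith
    qed
    have cr: "real (card B) * \<rho> ^ (M * j) \<le> 1"
    proof -
      have "\<rho> ^ (M * j) \<le> (1 / 4) ^ j"
        unfolding power_mult using M \<rho>01 by (intro power_mono) auto
      moreover have "real (card B) \<le> 4 ^ j" using cB by (metis of_nat_le_iff of_nat_numeral of_nat_power)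
      ultimately have "real (card B) * \<rho> ^ (M * j) \<le> 4 ^ j * (1 / 4) ^ j" using \<rho>01 by (intro mult_mono) auto
      then show ?thesis by (simp add: power_mult_distrib[symmetric])
    qed
    have "plane.uncovered (2 ^ (2 * t + 3)) x B \<le> plane.uncovered ((M * j) * (m + k) + J * (m + k)) x B"
      by (rule plane.uncovered_antimono[OF len])
    also have "\<dots> \<le> real (M * j) * f + real (card B) * \<rho> ^ (M * j) * \<alpha>"
      by (rule plane.uncovered_rounds[OF f \<rho> \<rho>01(1) \<alpha> \<alpha>0 fB])
    also have "\<dots> \<le> real (M * j) * f + 1 * \<alpha>"
      by (intro add_left_mono mult_right_mono \<alpha>0 cr)
    also have "\<dots> = (real M * real j + 96) * f + \<rho> ^ J" by (simp add: \<alpha>_def algebra_simps)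
    also have "\<dots> \<le> (real M + 96) * (real j + 1) * (800 * (real j + 1) / real t) + 95 / real t"
    proof (intro add_mono mult_mono)
      show "real M * real j + 96 \<le> (real M + 96) * (real j + 1)" by (simp add: algebra_simps)
      have "32 * (4 * real j + 9) * real t \<le> 32 * (4 * real j + 9) * (2 * (real t - 3))"
        by (rule mult_left_mono) (use t in auto)
      also have "\<dots> \<le> 800 * (real j + 1) * (real t - 3)"
      proof -
        have "64 * (4 * real j + 9) \<le> 800 * (real j + 1)" by simp
        then have "64 * (4 * real j + 9) * (real t - 3) \<le> 800 * (real j + 1) * (real t - 3)"
          by (rule mult_right_mono) (use t in simp)
        then show ?thesis by (simp add: algebra_simps)
      qed
      finally show "f \<le> 800 * (real j + 1) / real t"
        unfolding f_def using t by (simp add: field_simps)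
      \<comment> \<open>\<open>\<rho> ^ J\<close> is far smaller than needed; Bernoulli's inequality
        reduces it to the order \<open>1 / t\<close> of the main term.\<close>
      have "1 + real J * (1 / 95) \<le> (1 + 1 / 95) ^ J"
        by (rule Bernoulli_inequality) simp
      then have "real J / 95 \<le> (96 / 95) ^ J" by simp
      moreover have "real t \<le> real J" unfolding J_def using less_exp[of t] by (metis less_imp_le of_nat_le_iff)
      ultimately have "real t / 95 \<le> (96 / 95) ^ J" by linarith
      then have "1 / (96 / 95) ^ J \<le> 1 / (real t / 95)" using t by (intro divide_left_mono) auto
      then show "\<rho> ^ J \<le> 95 / real t" by (simp add: \<rho>_def power_divide)
    qed (use f0 in auto)
    also have "\<dots> \<le> C * (real j + 1)\<^sup>2 / real t"
    proof -
      have "1 * 1 \<le> (real j + 1) * (real j + 1)" by (intro mult_mono) auto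
      then have "95 / real t \<le> 95 * (real j + 1)\<^sup>2 / real t"
        using t by (intro divide_right_mono) (auto simp: power2_eq_square)
      moreover have "(real M + 96) * (real j + 1) * (800 * (real j + 1) / real t) = 800 * (real M + 96) * (real j + 1)\<^sup>2 / real t"
        by (simp add: power2_eq_square algebra_simps)
      ultimately show ?thesis by (simp add: C_def add_divide_distrib distrib_right)
    qed
    finally show ?thesis .
  qed
  moreover have "C > 0" by (simp add: C_def)
  ultimately show ?thesis by blast
qed

section \<open>Partially visited dyadic boxes\<close>

definition box_of :: "nat \<Rightarrow> int \<times> int \<Rightarrow> int \<times> int" where
  "box_of j z = (fst z div 2 ^ j, snd z div 2 ^ j)"

definition dyadic_box :: "nat \<Rightarrow> int \<times> int \<Rightarrow> (int \<times> int) set" where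
  "dyadic_box j q = {z. box_of j z = q}"

definition mixed :: "nat \<Rightarrow> (int \<times> int) set \<Rightarrow> (int \<times> int) set" where
  "mixed j A = {q. dyadic_box j q \<inter> A \<noteq> {} \<and> \<not> dyadic_box j q \<subseteq> A}"

lemma dyadic_box_eq: "dyadic_box j (a, b) = {a * 2 ^ j..<(a + 1) * 2 ^ j} \<times> {b * 2 ^ j..<(b + 1) * 2 ^ j}"
proof -
  have d: "x div 2 ^ j = a \<longleftrightarrow> a * 2 ^ j \<le> x \<and> x < (a + 1) * 2 ^ j" for x a :: int
  proof
    assume "x div 2 ^ j = a"
    then have "x = a * 2 ^ j + x mod 2 ^ j" using div_mult_mod_eq[of x "2 ^ j"] by simp
    moreover have "0 \<le> x mod 2 ^ j" "x mod 2 ^ j < 2 ^ j" by auto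
    moreover have "(a + 1) * 2 ^ j = a * 2 ^ j + 2 ^ j" by (simp add: algebra_simps)
    ultimately show "a * 2 ^ j \<le> x \<and> x < (a + 1) * 2 ^ j" by linarith
  next
    assume "a * 2 ^ j \<le> x \<and> x < (a + 1) * 2 ^ j"
    then show "x div 2 ^ j = a" by (intro int_div_pos_eq[of _ _ _ "x - a * 2 ^ j"]) (auto simp: algebra_simps)
  qed
  show ?thesis by (auto simp: dyadic_box_def box_of_def d)
qed

lemma finite_box [simp]: "finite (dyadic_box j q)"
  by (cases q) (simp add: dyadic_box_eq)

lemma card_box: "card (dyadic_box j q) = 4 ^ j"
proof -
  have "nat ((c + 1) * 2 ^ j - c * 2 ^ j) = 2 ^ j" for c :: int
    by (simp add: algebra_simps nat_power_eq)
  then show ?thesis by (cases q) (simp add: dyadic_box_eq nat_power_eq power_mult_distrib[symmetric])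
qed

lemma box_close:
  assumes "x \<in> dyadic_box j q" "y \<in> dyadic_box j q"
  shows "\<bar>fst y - fst x\<bar> + \<bar>snd y - snd x\<bar> \<le> 2 * 2 ^ j"
  using assms by (cases q) (auto simp: dyadic_box_eq algebra_simps abs_if)

lemma box_disjoint: "q \<noteq> q' \<Longrightarrow> dyadic_box j q \<inter> dyadic_box j q' = {}"
  by (auto simp: dyadic_box_def)

lemma mixed_subset: "mixed j A \<subseteq> box_of j ` A"
proof
  fix q assume "q \<in> mixed j A"
  then obtain z where "z \<in> A" "box_of j z = q" by (auto simp: mixed_def dyadic_box_def)
  then show "q \<in> box_of j ` A" by blast
qed

lemma finite_mixed: "finite A \<Longrightarrow> finite (mixed j A)"
  by (rule finite_subset[OF mixed_subset]) simp

lemma card_mixed_le: "finite A \<Longrightarrow> card (mixed j A) \<le> card (box_of j ` A)"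
  by (rule card_mono[OF _ mixed_subset]) simp

text \<open>After a first hit, \<open>n\<close> further steps spend expected time at least
  \<open>4^j * a / 64\<close> in the box, since \<open>4*j + 6 \<le> a\<close> leaves half of
  \<open>a\<close> in the Green's function bound. The boxes are disjoint, so these times sum to at
  most \<open>m + n + 1 \<le> 3 * n\<close>, and 192 is 3 times 64.\<close>

lemma sum_hit_box_le:
  assumes Q: "finite Q" and a: "4 * j + 6 \<le> a" and n: "2 ^ (a + 1) \<le> n" and m: "m \<le> n"
  shows "(\<Sum>q\<in>Q. 1 - plane.avoid m 0 (dyadic_box j q)) \<le> 192 * real n / (4 ^ j * real a)"
proof -
  define g where "g = 4 ^ j * ((real a - (2 * real j + 3)) / 32)"
  have g: "4 ^ j * real a / 64 \<le> g"
  proof -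
    have "real (4 * j + 6) \<le> real a" using a by (rule of_nat_mono)
    then have "real a / 64 \<le> (real a - (2 * real j + 3)) / 32" by simp
    then have "4 ^ j * (real a / 64) \<le> g" unfolding g_def by (rule mult_left_mono) simp
    then show ?thesis by simp
  qed
  have a0: "real a > 0" using a by simp
  have hit: "(1 - plane.avoid m 0 (dyadic_box j q)) * g \<le> (\<Sum>y\<in>dyadic_box j q. plane.green (m + n) (y - 0))" for q
  proof (rule plane.hit_set_le_green)
    fix b assume b: "b \<in> dyadic_box j q"
    have "g = (\<Sum>y\<in>dyadic_box j q. (real a - (2 * real j + 3)) / 32)" by (simp add: g_def card_box)
    also have "\<dots> \<le> (\<Sum>y\<in>dyadic_box j q. plane.green n (y - b))"
    proof (rule sum_mono)
      fix y assume y: "y \<in> dyadic_box j q"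
      have yb: "y - b = (fst y - fst b, snd y - snd b)" by (simp add: prod_eq_iff)
      show "(real a - (2 * real j + 3)) / 32 \<le> plane.green n (y - b)"
        unfolding yb by (rule plane_green_ge[OF box_close[OF b y] _ n]) (use a in simp)
    qed
    finally show "g \<le> (\<Sum>y\<in>dyadic_box j q. plane.green n (y - b))" .
  next
    show "0 \<le> g" by (rule order_trans[OF _ g]) simp
  qed
  have "(\<Sum>q\<in>Q. 1 - plane.avoid m 0 (dyadic_box j q)) * g \<le> (\<Sum>q\<in>Q. \<Sum>y\<in>dyadic_box j q. plane.green (m + n) y)"
    unfolding sum_distrib_right by (rule sum_mono) (use hit in simp)
  also have "\<dots> = (\<Sum>y\<in>(\<Union>q\<in>Q. dyadic_box j q). plane.green (m + n) y)"
    by (rule sum.UNION_disjoint[symmetric]) (auto simp: Q box_disjoint)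
  also have "\<dots> = (\<Sum>k\<le>m + n. \<Sum>y\<in>(\<Union>q\<in>Q. dyadic_box j q). plane.p k y)"
    unfolding plane.green_def by (rule sum.swap)
  also have "\<dots> \<le> (\<Sum>k\<le>m + n. 1)" by (intro sum_mono plane.sum_p_le_1) (simp add: Q)
  also have "\<dots> \<le> 3 * real n"
  proof -
    have "(1::nat) \<le> 2 ^ (a + 1)" by simp
    then have "1 \<le> n" using n by linarith
    then show ?thesis using m by simp
  qed
  finally have "(\<Sum>q\<in>Q. 1 - plane.avoid m 0 (dyadic_box j q)) * g \<le> 3 * real n" .
  moreover have "(\<Sum>q\<in>Q. 1 - plane.avoid m 0 (dyadic_box j q)) * (4 ^ j * real a / 64) \<le> (\<Sum>q\<in>Q. 1 - plane.avoid m 0 (dyadic_box j q)) * g"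
    by (intro mult_left_mono g sum_nonneg) (simp add: plane.avoid_le_1)
  ultimately show ?thesis using a0 by (simp add: field_simps)
qed

section \<open>Counting the boxes met by a walk\<close>

lemma visited_bounded:
  assumes "set xs \<subseteq> D2" "z \<in> visited x xs"
  shows "\<bar>fst z - fst x\<bar> \<le> int (length xs) \<and> \<bar>snd z - snd x\<bar> \<le> int (length xs)"
  using assms
proof (induction xs arbitrary: x)
  case (Cons s xs)
  then consider "z = x" | "z \<in> visited (x + s) xs" by auto
  then show ?case
  proof cases
    case 2
    then have "\<bar>fst z - fst (x + s)\<bar> \<le> int (length xs) \<and> \<bar>snd z - snd (x + s)\<bar> \<le> int (length xs)"
      using Cons.IH[of "x + s"] Cons.prems by simp
    moreover have "\<bar>fst s\<bar> \<le> 1 \<and> \<bar>snd s\<bar> \<le> 1" using Cons.prems by (auto simp: D2_def)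
    ultimately show ?thesis by simp linarith
  qed simp
qed simp

lemma div_near:
  fixes u v r :: int
  assumes "\<bar>u - v\<bar> \<le> r" "r > 0"
  shows "u div r \<in> {v div r - 1, v div r, v div r + 1}"
proof -
  have "u div r \<le> (v + r) div r" "(v - r) div r \<le> u div r"
    by (rule zdiv_mono1; use assms in linarith)+
  moreover have "(v + r) div r = v div r + 1" "(v - r) div r = v div r - 1"
    using assms div_add_self2[of r v] div_add_self2[of r "v - r"] by auto
  ultimately show ?thesis by auto
qed

text \<open>Each piece of \<open>2 ^ j\<close> steps stays within sup-distance \<open>2 ^ j\<close>
  of its start, hence inside a 3 by 3 array of boxes.\<close>

lemma card_boxes_visited_le:
  assumes "set xs \<subseteq> D2" "length xs \<le> K * 2 ^ j"
  shows "card (box_of j ` visited x xs) \<le> 9 * (K + 1)"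
  using assms
proof (induction K arbitrary: x xs)
  case 0
  then show ?case by simp
next
  case (Suc K)
  define ys where "ys = take (2 ^ j) xs"
  define zs where "zs = drop (2 ^ j) xs"
  have xs: "xs = ys @ zs" by (simp add: ys_def zs_def)
  have ly: "int (length ys) \<le> 2 ^ j"
  proof -
    have "length ys \<le> 2 ^ j" by (simp add: ys_def)
    then have "int (length ys) \<le> int (2 ^ j)" by (rule of_nat_mono)
    then show ?thesis by simp
  qed
  let ?N = "\<lambda>v::int. {v div 2 ^ j - 1, v div 2 ^ j, v div 2 ^ j + 1}"
  have "box_of j ` visited x ys \<subseteq> ?N (fst x) \<times> ?N (snd x)"
  proof
    fix q assume "q \<in> box_of j ` visited x ys"
    then obtain z where z: "z \<in> visited x ys" "q = box_of j z" by auto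
    have "set ys \<subseteq> D2" using Suc.prems by (simp add: xs)
    then have b: "\<bar>fst z - fst x\<bar> \<le> 2 ^ j" "\<bar>snd z - snd x\<bar> \<le> 2 ^ j"
      using visited_bounded[OF _ z(1)] ly by linarith+
    have "fst z div 2 ^ j \<in> ?N (fst x)" by (rule div_near[OF b(1)]) simp
    moreover have "snd z div 2 ^ j \<in> ?N (snd x)" by (rule div_near[OF b(2)]) simp
    ultimately show "q \<in> ?N (fst x) \<times> ?N (snd x)" by (simp only: z box_of_def mem_Times_iff fst_conv snd_conv)
  qed
  then have "card (box_of j ` visited x ys) \<le> card (?N (fst x) \<times> ?N (snd x))"
    by (intro card_mono) auto
  also have "\<dots> = 9" by (simp add: card_cartesian_product)
  finally have 1: "card (box_of j ` visited x ys) \<le> 9" .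
  have 2: "card (box_of j ` visited (x + sum_list ys) zs) \<le> 9 * (K + 1)"
    by (rule Suc.IH) (use Suc.prems in \<open>auto simp: zs_def dest: in_set_dropD\<close>)
  have "box_of j ` visited x xs = box_of j ` visited x ys \<union> box_of j ` visited (x + sum_list ys) zs"
    unfolding xs visited_append image_Un ..
  then have "card (box_of j ` visited x xs) \<le> card (box_of j ` visited x ys) + card (box_of j ` visited (x + sum_list ys) zs)"
    using card_Un_le by (simp only:)
  then show ?case using 1 2 by simp
qed

lemma expected_mixed_le_crude:
  "plane.E n (\<lambda>xs. real (card (mixed j (visited 0 xs)))) \<le> 9 * real n / 2 ^ j + 18"
proof (rule plane.E_le_const)
  fix xs :: "(int \<times> int) list" assume xs: "set xs \<subseteq> D2" "length xs = n"
  let ?K = "n div 2 ^ j + 1"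
  have "n \<le> ?K * 2 ^ j"
  proof -
    have "n mod 2 ^ j < 2 ^ j" by simp
    moreover have "?K * 2 ^ j = n div 2 ^ j * 2 ^ j + 2 ^ j" by (simp add: algebra_simps)
    ultimately show ?thesis using div_mult_mod_eq[of n "2 ^ j"] by linarith
  qed
  then have "card (box_of j ` visited 0 xs) \<le> 9 * (?K + 1)"
    using xs by (intro card_boxes_visited_le) auto
  then have "card (mixed j (visited 0 xs)) \<le> 9 * (?K + 1)"
    using card_mixed_le[of "visited 0 xs" j] by (meson finite_visited le_trans)
  then have "real (card (mixed j (visited 0 xs))) \<le> real (9 * (?K + 1))" by (rule of_nat_mono)
  also have "\<dots> = 9 * real (n div 2 ^ j) + 18" by simp
  also have "real (n div 2 ^ j) \<le> real n / 2 ^ j"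
  proof -
    have "real (n div 2 ^ j * 2 ^ j) \<le> real n" by (intro of_nat_mono) simp
    then show ?thesis by (simp add: le_divide_eq)
  qed
  finally show "real (card (mixed j (visited 0 xs))) \<le> 9 * real n / 2 ^ j + 18" by simp
qed

lemma card_visited_le: "card (visited x xs) \<le> length xs + 1"
  by (induction xs arbitrary: x) (auto simp: card_insert_if intro: le_SucI)

text \<open>A mixed box is either hit by time \<open>n - T\<close>, so that \<open>T\<close> steps
  fail to fill it, or met only afterwards; the last \<open>T\<close> steps see at most
  \<open>T + 1\<close> points.\<close>

lemma expected_mixed_le:
  assumes \<kappa>: "\<And>q b. b \<in> dyadic_box j q \<Longrightarrow> plane.uncovered T b (dyadic_box j q) \<le> \<kappa>" and \<kappa>0: "\<kappa> \<ge> 0"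
    and T: "T \<le> n" and a: "4 * j + 6 \<le> a" and n: "2 ^ (a + 1) \<le> n"
  shows "plane.E n (\<lambda>xs. real (card (mixed j (visited 0 xs)))) \<le> 192 * real n / (4 ^ j * real a) * \<kappa> + (real T + 1)"
proof -
  define m where "m = n - T"
  have nm: "n = m + T" using T by (simp add: m_def)
  \<comment> \<open>All boxes that some walk of length \<open>n\<close> can meet: a finite index set
    that does not depend on the walk, so that sum and average can be exchanged.\<close>
  define U where "U = (\<Union>xs\<in>plane.walks n. box_of j ` visited 0 xs)"
  have U: "finite U" by (simp add: U_def)
  let ?e = "\<lambda>q xs. visited 0 (take m xs) \<inter> dyadic_box j q \<noteq> {} \<and> \<not> dyadic_box j q \<subseteq> visited 0 xs"
  have "plane.E n (\<lambda>xs. real (card (mixed j (visited 0 xs)))) \<le> plane.E n (\<lambda>xs. (\<Sum>q\<in>U. of_bool (?e q xs)) + (real T + 1))"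
  proof (rule plane.E_mono)
    fix xs assume xs: "set xs \<subseteq> D2" "length xs = n"
    let ?V = "box_of j ` visited (sum_list (take m xs)) (drop m xs)"
    have "mixed j (visited 0 xs) \<subseteq> {q\<in>U. ?e q xs} \<union> ?V"
    proof
      fix q assume q: "q \<in> mixed j (visited 0 xs)"
      then obtain z where z: "z \<in> visited 0 xs" "box_of j z = q" by (auto simp: mixed_def dyadic_box_def)
      have qU: "q \<in> U" using z xs by (auto simp: U_def)
      have "visited 0 xs = visited 0 (take m xs) \<union> visited (sum_list (take m xs)) (drop m xs)"
        using visited_append[of 0 "take m xs" "drop m xs"] by simp
      then consider "z \<in> visited 0 (take m xs)" | "z \<in> visited (sum_list (take m xs)) (drop m xs)" using z by auto
      then show "q \<in> {q\<in>U. ?e q xs} \<union> ?V"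
      proof cases
        case 1
        then have "?e q xs" using q z by (auto simp: mixed_def dyadic_box_def)
        then show ?thesis using qU by simp
      next
        case 2
        then show ?thesis using z by auto
      qed
    qed
    then have "card (mixed j (visited 0 xs)) \<le> card ({q\<in>U. ?e q xs} \<union> ?V)"
      by (rule card_mono[rotated]) (simp add: U)
    also have "\<dots> \<le> card {q\<in>U. ?e q xs} + card ?V" by (rule card_Un_le)
    also have "card ?V \<le> card (visited (sum_list (take m xs)) (drop m xs))" by (rule card_image_le) simp
    also have "\<dots> \<le> T + 1" using card_visited_le[of "sum_list (take m xs)" "drop m xs"] xs nm by simp
    finally have "real (card (mixed j (visited 0 xs))) \<le> real (card {q\<in>U. ?e q xs} + (T + 1))" by simp
    also have "real (card {q\<in>U. ?e q xs}) = (\<Sum>q\<in>U. if ?e q xs then 1 else 0)"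
      using sum.inter_filter[OF U, of "\<lambda>_. 1::real" "\<lambda>q. ?e q xs"] by simp
    then have "real (card {q\<in>U. ?e q xs} + (T + 1)) = (\<Sum>q\<in>U. of_bool (?e q xs)) + (real T + 1)"
      by (simp add: of_bool_def)
    finally show "real (card (mixed j (visited 0 xs))) \<le> (\<Sum>q\<in>U. of_bool (?e q xs)) + (real T + 1)" .
  qed
  also have "\<dots> = (\<Sum>q\<in>U. plane.E n (\<lambda>xs. of_bool (?e q xs))) + (real T + 1)"
    by (simp only: plane.E_plus plane.E_sum plane.E_const)
  also have "(\<Sum>q\<in>U. plane.E n (\<lambda>xs. of_bool (?e q xs))) \<le> (\<Sum>q\<in>U. (1 - plane.avoid m 0 (dyadic_box j q)) * \<kappa>)"
    unfolding nm by (intro sum_mono plane.hit_and_uncovered_le \<kappa>)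
  also have "\<dots> = (\<Sum>q\<in>U. 1 - plane.avoid m 0 (dyadic_box j q)) * \<kappa>" by (simp only: sum_distrib_right)
  also have "\<dots> \<le> 192 * real n / (4 ^ j * real a) * \<kappa>"
    by (intro mult_right_mono sum_hit_box_le U a n \<kappa>0) (simp add: m_def)
  finally show ?thesis by simp
qed

section \<open>The quadtree code\<close>

lemma sum_Pow_Un_disjoint:
  fixes f g :: "'a set \<Rightarrow> real"
  assumes "finite A" "finite B" "A \<inter> B = {}"
  shows "(\<Sum>X\<in>Pow (A \<union> B). f (X \<inter> A) * g (X \<inter> B)) = (\<Sum>X\<in>Pow A. f X) * (\<Sum>Y\<in>Pow B. g Y)"
proof -
  have e: "(X \<union> Y) \<inter> A = X" "(X \<union> Y) \<inter> B = Y" if "X \<subseteq> A" "Y \<subseteq> B" for X Y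
    using that assms(3) by blast+
  have "(\<Sum>X\<in>Pow A. f X) * (\<Sum>Y\<in>Pow B. g Y) = (\<Sum>p\<in>Pow A \<times> Pow B. f (fst p) * g (snd p))"
    by (simp add: sum_product sum.cartesian_product case_prod_unfold)
  also have "\<dots> = (\<Sum>X\<in>Pow (A \<union> B). f (X \<inter> A) * g (X \<inter> B))"
    by (rule sum.reindex_bij_witness[of _ "\<lambda>X. (X \<inter> A, X \<inter> B)" "\<lambda>p. fst p \<union> snd p"])
      (use assms(3) in \<open>auto simp: e disjoint_iff\<close>)
  finally show ?thesis by simp
qed

lemma sum_Pow_UN_disjoint:
  fixes f :: "'i \<Rightarrow> 'a set \<Rightarrow> real"
  assumes "finite I" "\<And>i. finite (B i)" "\<And>i j. i \<noteq> j \<Longrightarrow> B i \<inter> B j = {}"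
  shows "(\<Sum>X\<in>Pow (\<Union>i\<in>I. B i). \<Prod>i\<in>I. f i (X \<inter> B i)) = (\<Prod>i\<in>I. \<Sum>X\<in>Pow (B i). f i X)"
  using assms(1)
proof (induction I)
  case (insert i I)
  let ?U = "\<Union>i\<in>I. B i"
  have dis: "B i \<inter> B k = {}" if "k \<in> I" for k using assms(3) insert.hyps(2) that by metis
  have "(\<Sum>X\<in>Pow (\<Union>i\<in>insert i I. B i). \<Prod>i\<in>insert i I. f i (X \<inter> B i)) =
     (\<Sum>X\<in>Pow (B i \<union> ?U). f i (X \<inter> B i) * (\<Prod>k\<in>I. f k (X \<inter> ?U \<inter> B k)))"
  proof (rule sum.cong)
    fix X
    have "X \<inter> ?U \<inter> B k = X \<inter> B k" if "k \<in> I" for k using that by auto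
    then have "(\<Prod>k\<in>I. f k (X \<inter> ?U \<inter> B k)) = (\<Prod>k\<in>I. f k (X \<inter> B k))" by simp
    then show "(\<Prod>i\<in>insert i I. f i (X \<inter> B i)) = f i (X \<inter> B i) * (\<Prod>k\<in>I. f k (X \<inter> ?U \<inter> B k))"
      using insert.hyps by simp
  qed simp
  also have "\<dots> = (\<Sum>X\<in>Pow (B i). f i X) * (\<Sum>X\<in>Pow ?U. \<Prod>k\<in>I. f k (X \<inter> B k))"
    by (rule sum_Pow_Un_disjoint[where f = "f i" and g = "\<lambda>Y. \<Prod>k\<in>I. f k (Y \<inter> B k)"])
      (use insert.hyps(1) assms(2) dis in auto)
  finally show ?case using insert by simp
qed simp

definition kids :: "int \<times> int \<Rightarrow> (int \<times> int) set" where
  "kids q = {2 * fst q, 2 * fst q + 1} \<times> {2 * snd q, 2 * snd q + 1}"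

lemma finite_kids [simp]: "finite (kids q)"
  by (simp add: kids_def)

lemma card_kids: "card (kids q) = 4"
  by (simp add: kids_def card_cartesian_product)

lemma mem_kids: "c \<in> kids q \<longleftrightarrow> q = (fst c div 2, snd c div 2)"
proof -
  have "x = 2 * a \<or> x = 2 * a + 1 \<longleftrightarrow> a = x div 2" for x a :: int by presburger
  then show ?thesis by (cases c; cases q) (auto simp: kids_def)
qed

lemma dyadic_box_Suc: "dyadic_box (Suc j) q = (\<Union>c\<in>kids q. dyadic_box j c)"
proof -
  have d: "x div 2 ^ Suc j = x div 2 ^ j div 2" for x :: int
    by (simp only: power_Suc2) (simp add: zdiv_zmult2_eq)
  show ?thesis unfolding dyadic_box_def box_of_def d by (auto simp: mem_kids)
qed

text \<open>The weight of the code that labels a node of the quadtree empty, full or mixed and recurses into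
  the mixed ones.\<close>
fun quad_weight :: "nat \<Rightarrow> int \<times> int \<Rightarrow> (int \<times> int) set \<Rightarrow> real" where
  "quad_weight 0 q A = 1 / 3"
| "quad_weight (Suc j) q A =
    (if q \<in> mixed (Suc j) A then (\<Prod>c\<in>kids q. quad_weight j c (A \<inter> dyadic_box j c)) / 3 else 1 / 3)"

fun quad_count :: "nat \<Rightarrow> int \<times> int \<Rightarrow> (int \<times> int) set \<Rightarrow> nat" where
  "quad_count 0 q A = 0"
| "quad_count (Suc j) q A =
    (if q \<in> mixed (Suc j) A then 1 + (\<Sum>c\<in>kids q. quad_count j c (A \<inter> dyadic_box j c)) else 0)"

lemma quad_weight_pos: "quad_weight j q A > 0"
  by (induction j arbitrary: q A) (auto intro!: prod_pos)

lemma quad_weight_nonzero [simp]: "quad_weight j q A \<noteq> 0"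
  using quad_weight_pos[of j q A] by linarith

text \<open>A subset of the box is empty, full or mixed. The first two contribute 1/3 each. The
  mixed ones contribute at most 1/3, because the sum of the products factorises over the disjoint
  children and each factor is at most 1 by induction.\<close>

lemma quad_weight_Kraft: "(\<Sum>A\<in>Pow (dyadic_box j q). quad_weight j q A) \<le> 1"
proof (induction j arbitrary: q)
  case 0
  have "card (Pow (dyadic_box 0 q)) = 2" by (simp add: card_Pow card_box)
  then show ?case by simp
next
  case (Suc j)
  let ?B = "dyadic_box (Suc j) q"
  let ?P = "\<lambda>A. (\<Prod>c\<in>kids q. quad_weight j c (A \<inter> dyadic_box j c))"
  have "(\<Sum>A\<in>Pow ?B. quad_weight (Suc j) q A) \<le>
    (\<Sum>A\<in>Pow ?B. ?P A / 3 + ((if A = {} then 1 / 3 else 0) + (if A = ?B then 1 / 3 else 0)))"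
  proof (rule sum_mono)
    fix A assume A: "A \<in> Pow ?B"
    have P0: "0 \<le> ?P A" by (intro prod_nonneg) (simp add: quad_weight_pos less_imp_le)
    show "quad_weight (Suc j) q A \<le> ?P A / 3 + ((if A = {} then 1 / 3 else 0) + (if A = ?B then 1 / 3 else 0))"
    proof (cases "q \<in> mixed (Suc j) A")
      case False
      then have "A = {} \<or> A = ?B" using A by (auto simp: mixed_def)
      then show ?thesis using False P0 by auto
    qed simp
  qed
  also have "\<dots> = (\<Sum>A\<in>Pow ?B. ?P A) / 3 + (1 / 3 + 1 / 3)"
    by (simp add: sum.distrib sum_divide_distrib[symmetric])
  also have "(\<Sum>A\<in>Pow ?B. ?P A) = (\<Prod>c\<in>kids q. \<Sum>A\<in>Pow (dyadic_box j c). quad_weight j c A)"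
    unfolding dyadic_box_Suc by (rule sum_Pow_UN_disjoint) (auto simp: box_disjoint)
  also have "\<dots> \<le> 1" by (intro prod_le_1) (auto intro!: Suc.IH sum_nonneg simp: quad_weight_pos less_imp_le)
  finally show ?case by simp
qed

text \<open>The labelled nodes are the root and the four children of each mixed node; every label
  costs \<open>log 2 3\<close>.\<close>

lemma log_quad_weight: "- log 2 (quad_weight j q A) \<le> log 2 3 * (1 + 4 * real (quad_count j q A))"
proof (induction j arbitrary: q A)
  case 0
  then show ?case by (simp add: log_divide)
next
  case (Suc j)
  show ?case
  proof (cases "q \<in> mixed (Suc j) A")
    case False
    then show ?thesis by (simp add: log_divide)
  next
    case True
    let ?w = "\<lambda>c. quad_weight j c (A \<inter> dyadic_box j c)"
    define P where "P = (\<Prod>c\<in>kids q. ?w c)"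
    have pos: "P > 0" unfolding P_def by (intro prod_pos) (simp add: quad_weight_pos)
    have eq: "quad_weight (Suc j) q A = P / 3" using True by (simp add: P_def)
    have "log 2 (P / 3) = log 2 P - log 2 3" using pos by (simp add: log_divide)
    then have "- log 2 (quad_weight (Suc j) q A) = log 2 3 - log 2 P" unfolding eq by simp
    also have "log 2 P = (\<Sum>c\<in>kids q. log 2 (?w c))"
    proof -
      have "ln (\<Prod>c\<in>kids q. ?w c) = (\<Sum>c\<in>kids q. ln (?w c))"
        by (rule ln_prod) (simp_all add: quad_weight_pos)
      then show ?thesis by (simp add: P_def log_def sum_divide_distrib)
    qed
    also have "log 2 3 - (\<Sum>c\<in>kids q. log 2 (?w c)) = log 2 3 + (\<Sum>c\<in>kids q. - log 2 (?w c))"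
      by (simp add: sum_negf)
    also have "\<dots> \<le> log 2 3 + (\<Sum>c\<in>kids q. log 2 3 * (1 + 4 * real (quad_count j c (A \<inter> dyadic_box j c))))"
      by (intro add_left_mono sum_mono Suc.IH)
    also have "\<dots> = log 2 3 * (1 + 4 * real (quad_count (Suc j) q A))"
      using True
      by (simp add: sum_distrib_left[symmetric] sum.distrib card_kids distrib_left)
    finally show ?thesis .
  qed
qed

lemma mixed_Int_box: "q \<in> mixed j (A \<inter> dyadic_box j q) \<longleftrightarrow> q \<in> mixed j A"
  by (auto simp: mixed_def)

lemma quad_count_Int_box: "quad_count j q (A \<inter> dyadic_box j q) = quad_count j q A"
proof (cases j)
  case (Suc i)
  have "A \<inter> dyadic_box j q \<inter> dyadic_box i c = A \<inter> dyadic_box i c" if "c \<in> kids q" for c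
    using that by (auto simp: Suc dyadic_box_Suc)
  then show ?thesis using mixed_Int_box[of q j A] by (simp add: Suc)
qed simp

lemma sum_quad_count_le:
  assumes "finite A" "finite S"
  shows "(\<Sum>q\<in>S. quad_count j q A) \<le> (\<Sum>i\<in>{1..j}. card (mixed i A))"
  using assms(2)
proof (induction j arbitrary: S)
  case (Suc j)
  let ?M = "S \<inter> mixed (Suc j) A"
  have "(\<Sum>q\<in>S. quad_count (Suc j) q A) = (\<Sum>q\<in>S. if q \<in> mixed (Suc j) A then 1 + (\<Sum>c\<in>kids q. quad_count j c A) else 0)"
    by (simp add: quad_count_Int_box cong: if_cong)
  also have "\<dots> = (\<Sum>q\<in>?M. 1 + (\<Sum>c\<in>kids q. quad_count j c A))"
    by (rule sum.inter_restrict[OF Suc.prems, symmetric])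
  also have "\<dots> = card ?M + (\<Sum>q\<in>?M. \<Sum>c\<in>kids q. quad_count j c A)"
    by (simp only: sum.distrib) simp
  also have "(\<Sum>q\<in>?M. \<Sum>c\<in>kids q. quad_count j c A) = (\<Sum>c\<in>(\<Union>q\<in>?M. kids q). quad_count j c A)"
    using Suc.prems by (intro sum.UNION_disjoint[symmetric]) (auto simp: mem_kids)
  also have "\<dots> \<le> (\<Sum>i\<in>{1..j}. card (mixed i A))" using Suc.prems by (intro Suc.IH) auto
  also have "card ?M \<le> card (mixed (Suc j) A)"
    by (intro card_mono finite_mixed assms(1)) auto
  finally show ?case by simp
qed simp

lemma plane_entropy_le_mixed:
  assumes K: "n < 2 ^ K"
  shows "entropy2 (map_pmf (visited 0) (pmf_of_set (plane.walks n))) \<le>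
    log 2 3 * (4 + 4 * (\<Sum>j\<in>{1..K}. plane.E n (\<lambda>xs. real (card (mixed j (visited 0 xs))))))"
proof -
  \<comment> \<open>The four boxes of side \<open>2 ^ K\<close> that surround the origin; fewer than
    \<open>2 ^ K\<close> steps cannot leave their union.\<close>
  define R :: "(int \<times> int) set" where "R = {-1, 0} \<times> {-1, 0}"
  have R: "finite R" "card R = 4" by (simp_all add: R_def card_cartesian_product)
  define Q where "Q A = (\<Prod>q\<in>R. quad_weight K q (A \<inter> dyadic_box K q))" for A
  have Qpos: "Q A > 0" for A unfolding Q_def by (intro prod_pos) (simp add: quad_weight_pos)
  have sub: "visited 0 xs \<subseteq> (\<Union>q\<in>R. dyadic_box K q)" if xs: "set xs \<subseteq> D2" "length xs = n" for xs
  proof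
    fix z assume z: "z \<in> visited 0 xs"
    have nK: "int n < 2 ^ K" using K by (metis of_nat_less_iff of_nat_numeral of_nat_power)
    have d: "u div 2 ^ K \<in> {-1, 0}" if u: "\<bar>u\<bar> \<le> int n" for u :: int
    proof (cases "u \<ge> 0")
      case True
      then have "u < 2 ^ K" using u nK by linarith
      then show ?thesis using True by simp
    next
      case False
      have "u div 2 ^ K = -1" by (rule int_div_pos_eq[of _ _ _ "u + 2 ^ K"]; use False u nK in linarith)
      then show ?thesis by simp
    qed
    have "\<bar>fst z\<bar> \<le> int n \<and> \<bar>snd z\<bar> \<le> int n" using visited_bounded[OF xs(1) z] xs by simp
    then have "box_of K z \<in> R" using d[of "fst z"] d[of "snd z"] by (auto simp: box_of_def R_def)
    then show "z \<in> (\<Union>q\<in>R. dyadic_box K q)" by (intro UN_I[of "box_of K z"]) (simp_all add: dyadic_box_def)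
  qed
  have "(\<Sum>A\<in>visited 0 ` plane.walks n. Q A) \<le> (\<Sum>A\<in>Pow (\<Union>q\<in>R. dyadic_box K q). Q A)"
    by (rule sum_mono2) (use sub R Qpos in \<open>auto simp: less_imp_le\<close>)
  also have "\<dots> = (\<Prod>q\<in>R. \<Sum>A\<in>Pow (dyadic_box K q). quad_weight K q A)"
    unfolding Q_def by (rule sum_Pow_UN_disjoint) (auto simp: R box_disjoint)
  also have "\<dots> \<le> 1"
    by (intro prod_le_1) (auto intro!: quad_weight_Kraft sum_nonneg simp: quad_weight_pos less_imp_le)
  finally have Kraft: "(\<Sum>A\<in>visited 0 ` plane.walks n. Q A) \<le> 1" .
  have "entropy2 (map_pmf (visited 0) (pmf_of_set (plane.walks n))) \<le> plane.E n (\<lambda>xs. - log 2 (Q (visited 0 xs)))"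
    by (rule plane.entropy2_walk_visited_le_code[OF Qpos Kraft])
  also have "\<dots> \<le> plane.E n (\<lambda>xs. log 2 3 * (4 + 4 * (\<Sum>j\<in>{1..K}. real (card (mixed j (visited 0 xs))))))"
  proof (rule plane.E_mono)
    fix xs :: "(int \<times> int) list"
    let ?A = "visited 0 xs"
    have "log 2 (Q ?A) = (\<Sum>q\<in>R. log 2 (quad_weight K q (?A \<inter> dyadic_box K q)))"
    proof -
      have "ln (Q ?A) = (\<Sum>q\<in>R. ln (quad_weight K q (?A \<inter> dyadic_box K q)))"
        unfolding Q_def by (rule ln_prod) (simp_all add: R quad_weight_pos)
      then show ?thesis by (simp add: log_def sum_divide_distrib)
    qed
    then have "- log 2 (Q ?A) = (\<Sum>q\<in>R. - log 2 (quad_weight K q (?A \<inter> dyadic_box K q)))"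
      by (simp add: sum_negf)
    also have "\<dots> \<le> (\<Sum>q\<in>R. log 2 3 * (1 + 4 * real (quad_count K q ?A)))"
    proof (rule sum_mono)
      fix q
      show "- log 2 (quad_weight K q (?A \<inter> dyadic_box K q)) \<le> log 2 3 * (1 + 4 * real (quad_count K q ?A))"
        using log_quad_weight[of K q "?A \<inter> dyadic_box K q"] by (simp only: quad_count_Int_box)
    qed
    also have "\<dots> = log 2 3 * (4 + 4 * real (\<Sum>q\<in>R. quad_count K q ?A))"
      by (simp add: sum_distrib_left[symmetric] sum.distrib R distrib_left)
    also have "\<dots> \<le> log 2 3 * (4 + 4 * real (\<Sum>j\<in>{1..K}. card (mixed j ?A)))"
      by (intro mult_left_mono add_left_mono of_nat_mono sum_quad_count_le R) auto
    finally show "- log 2 (Q ?A) \<le> log 2 3 * (4 + 4 * (\<Sum>j\<in>{1..K}. real (card (mixed j ?A))))" by simp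
  qed
  also have "\<dots> = log 2 3 * (4 + 4 * (\<Sum>j\<in>{1..K}. plane.E n (\<lambda>xs. real (card (mixed j (visited 0 xs))))))"
    by (simp only: plane.E_cmult plane.E_plus plane.E_const plane.E_sum)
  finally show ?thesis .
qed

section \<open>Entropy of the planar range\<close>

lemma sum_half_powers_from_le: "(\<Sum>j\<in>{j0..K}. 1 / 2 ^ j :: real) \<le> 2 / 2 ^ j0"
proof (cases "j0 \<le> K")
  case True
  then have "(\<Sum>j\<in>{j0..K}. 1 / 2 ^ j :: real) = 2 / 2 ^ j0 - 1 / 2 ^ K"
  proof (induction K rule: dec_induct)
    case (step K)
    then have "{j0..Suc K} = insert (Suc K) {j0..K}" by auto
    then show ?case using step by simp
  qed simp
  then show ?thesis by simp
qed simp

text \<open>Turns the bound \<open>(j + 1)^2 / 4^j\<close> for the scale \<open>2 ^ j\<close> into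
  \<open>4 / 2^j\<close>, which is summable over \<open>j\<close>.\<close>

lemma Suc_sq_le_power: "(real j + 1)\<^sup>2 \<le> 4 * 2 ^ j"
proof (induction j rule: nat_less_induct)
  case (1 j)
  show ?case
  proof (cases "j \<le> 2")
    case True
    then have "j = 0 \<or> j = 1 \<or> j = 2" by auto
    then show ?thesis by (auto simp: power2_eq_square)
  next
    case False
    then obtain i where i: "j = Suc i" "i \<ge> 2" by (cases j) auto
    have "2 * 1 \<le> real i * real i" using i by (intro mult_mono) auto
    then have "(real j + 1)\<^sup>2 \<le> 2 * (real i + 1)\<^sup>2" by (simp add: i power2_eq_square algebra_simps)
    also have "\<dots> \<le> 2 * (4 * 2 ^ i)" using 1 i by (intro mult_left_mono) auto
    finally show ?thesis by (simp add: i)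
  qed
qed

text \<open>Here \<open>l\<close> is the integer part of \<open>log 2 n\<close>, and with
  \<open>t = l div 8\<close> the covering time \<open>2 ^ (2 * t + 3)\<close> is of order at most
  \<open>n\<close> to the power 1/4. Scales with \<open>2^j < l^2\<close> have \<open>j\<close> of
  order \<open>log l\<close>, far below \<open>t\<close>. The last clause keeps the additive errors
  of all \<open>l + 1\<close> scales below \<open>n / l^2\<close>.\<close>

lemma scales_eventually:
  "eventually (\<lambda>l. l \<ge> 16 \<and> (\<forall>j. 2 ^ j < l ^ 2 \<longrightarrow> 4 * j + 7 \<le> l div 8 \<and> M * j \<le> 2 ^ (l div 8)) \<and>
     (real l + 1) * (2 ^ (2 * (l div 8) + 3) + 19) \<le> 2 ^ l / (real l)\<^sup>2) sequentially"
proof -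
  have "eventually (\<lambda>x::real. 8 * log 2 x + 7 \<le> x / 8 - 1) at_top" unfolding log_def by real_asymp
  then have e1: "eventually (\<lambda>l. 8 * log 2 (real l) + 7 \<le> real l / 8 - 1) sequentially"
    by (rule eventually_compose_filterlim[OF _ filterlim_real_sequentially])
  have "eventually (\<lambda>x::real. (x + 1) * (8 * 2 powr (x / 4) + 19) \<le> 2 powr x / x\<^sup>2) at_top" by real_asymp
  then have e2: "eventually (\<lambda>l. (real l + 1) * (8 * 2 powr (real l / 4) + 19) \<le> 2 powr (real l) / (real l)\<^sup>2) sequentially"
    by (rule eventually_compose_filterlim[OF _ filterlim_real_sequentially])
  have "eventually (\<lambda>x::real. x\<^sup>2 \<le> 2 powr x) at_top" by real_asymp
  then have "eventually (\<lambda>t. (real t)\<^sup>2 \<le> 2 powr (real t)) sequentially"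
    by (rule eventually_compose_filterlim[OF _ filterlim_real_sequentially])
  then obtain t0 where t0: "\<And>t. t \<ge> t0 \<Longrightarrow> (real t)\<^sup>2 \<le> 2 powr (real t)"
    by (auto simp: eventually_sequentially)
  have e3: "eventually (\<lambda>l. l \<ge> 8 * t0 + 8 * M + 16) sequentially" by (rule eventually_ge_at_top)
  from e1 e2 e3 show ?thesis
  proof eventually_elim
    case (elim l)
    define t where "t = l div 8"
    have l: "l \<ge> 16" "t \<ge> t0" "t \<ge> M" using elim(3) by (auto simp: t_def)
    have tl: "real l / 8 - 1 \<le> real t" "real t \<le> real l / 8"
    proof -
      have "l \<le> 8 * t + 7" "8 * t \<le> l" unfolding t_def by presburger+
      then have "real l \<le> real (8 * t + 7)" "real (8 * t) \<le> real l" by (simp_all only: of_nat_le_iff)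
      then show "real l / 8 - 1 \<le> real t" "real t \<le> real l / 8" by simp_all
    qed
    have "4 * j + 7 \<le> t \<and> M * j \<le> 2 ^ t" if j: "2 ^ j < l ^ 2" for j
    proof -
      have "real (2 ^ j) < real (l ^ 2)" using j by (rule of_nat_less_iff[THEN iffD2])
      then have "log 2 (2 ^ j) \<le> log 2 ((real l) ^ 2)" using l by (intro log_mono) auto
      then have "real j \<le> 2 * log 2 (real l)" using l by (simp add: log_nat_power)
      then have "real (4 * j + 7) \<le> real t" using elim(1) tl by simp
      then have jt: "4 * j + 7 \<le> t" by (simp only: of_nat_le_iff)
      have "real (M * j) \<le> real t * real t"
        unfolding of_nat_mult using l jt by (intro mult_mono) auto
      also have "\<dots> \<le> 2 powr (real t)" using t0[OF l(2)] by (simp add: power2_eq_square)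
      also have "\<dots> = real (2 ^ t)" by (simp add: powr_realpow)
      finally have "M * j \<le> 2 ^ t" by (simp only: of_nat_le_iff)
      then show ?thesis using jt by simp
    qed
    moreover have "(real l + 1) * (2 ^ (2 * t + 3) + 19) \<le> 2 ^ l / (real l)\<^sup>2"
    proof -
      have "(2::real) ^ (2 * t + 3) = 8 * 2 powr (real (2 * t))" by (simp add: powr_realpow power_add del: of_nat_mult)
      also have "\<dots> \<le> 8 * 2 powr (real l / 4)" using tl by (intro mult_left_mono powr_mono) auto
      finally have "(real l + 1) * (2 ^ (2 * t + 3) + 19) \<le> (real l + 1) * (8 * 2 powr (real l / 4) + 19)"
        by (intro mult_left_mono add_right_mono) auto
      also have "\<dots> \<le> 2 powr (real l) / (real l)\<^sup>2" by (rule elim(2))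
      also have "\<dots> = 2 ^ l / (real l)\<^sup>2" by (simp add: powr_realpow)
      finally show ?thesis .
    qed
    ultimately show ?case using l by (simp add: t_def)
  qed
qed

lemma plane_entropy_le_trivial:
  "entropy2 (map_pmf (visited 0) (pmf_of_set (plane.walks n))) \<le> 2 * real n"
proof -
  have "entropy2 (map_pmf (visited 0) (pmf_of_set (plane.walks n))) \<le> log 2 (real (card (plane.walks n)))"
    by (rule entropy2_le_log_card) (use plane.walks_nonempty in auto)
  also have "\<dots> = log 2 ((2 ^ 2) ^ n)" by (simp add: plane.card_walks)
  also have "\<dots> = 2 * real n" unfolding power_mult[symmetric] by (simp add: log_nat_power del: power_mult)
  finally show ?thesis .
qed

lemma plane_entropy_le:
  "\<exists>C>0. \<forall>n\<ge>2. entropy2 (map_pmf (visited 0) (pmf_of_set (plane.walks n))) \<le> C * real n / (log 2 (real n))\<^sup>2"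
proof -
  let ?H = "\<lambda>n. entropy2 (map_pmf (visited 0) (pmf_of_set (plane.walks n)))"
  obtain C M where C: "C > 0" and cover: "\<And>j t x B. t \<ge> 4 * j + 7 \<Longrightarrow> M * j \<le> 2 ^ t \<Longrightarrow>
      card B \<le> 4 ^ j \<Longrightarrow> finite B \<Longrightarrow> (\<forall>y\<in>B. \<bar>fst y - fst x\<bar> + \<bar>snd y - snd x\<bar> \<le> 2 * 2 ^ j) \<Longrightarrow>
      plane.uncovered (2 ^ (2 * t + 3)) x B \<le> C * (real j + 1)\<^sup>2 / real t"
    using plane_uncovered_box_le by blast
  obtain l0 where l0: "\<And>l. l \<ge> l0 \<Longrightarrow> l \<ge> 16 \<and>
     (\<forall>j. 2 ^ j < l ^ 2 \<longrightarrow> 4 * j + 7 \<le> l div 8 \<and> M * j \<le> 2 ^ (l div 8)) \<and>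
     (real l + 1) * (2 ^ (2 * (l div 8) + 3) + 19) \<le> 2 ^ l / (real l)\<^sup>2"
    using scales_eventually[of M] by (auto simp: eventually_sequentially)
  \<comment> \<open>24576 is 192 * 4 * 32, from \<open>sum_hit_box_le\<close>,
    \<open>Suc_sq_le_power\<close> and \<open>l^2 \<le> 32 * (a * t)\<close>. 19 is 18 for the large
    scales plus 1 for the additive errors.\<close>
  define C1 where "C1 = 24576 * C + 19"
  have C1: "C1 > 0" using C by (simp add: C1_def)
  have big: "?H n \<le> log 2 3 * (4 + 4 * C1) * real n / (real l)\<^sup>2"
    if l: "l \<ge> l0" "2 ^ l \<le> n" "n < 2 ^ (l + 1)" for l n
  proof -
    \<comment> \<open>\<open>a = l - 1\<close> because Green's function up to time \<open>n\<close>
      is bounded below under \<open>2 ^ (a + 1) \<le> n\<close>.\<close>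
    define t T a where "t = l div 8" and "T = (2::nat) ^ (2 * t + 3)" and "a = l - 1"
    have l16: "l \<ge> 16" and scale: "\<And>j. 2 ^ j < l ^ 2 \<Longrightarrow> 4 * j + 7 \<le> t \<and> M * j \<le> 2 ^ t"
      and small: "(real l + 1) * (real T + 19) \<le> 2 ^ l / (real l)\<^sup>2"
      using l0[OF l(1)] by (auto simp: t_def T_def)
    have n2: "2 ^ l \<le> real n" using of_nat_mono[OF l(2), where 'a = real] by simp
    have at: "(real l)\<^sup>2 \<le> 32 * (real a * real t)"
    proof -
      have "l \<le> 2 * a" "l \<le> 16 * t" using l16 unfolding a_def t_def by presburger+
      then have "real l \<le> real (2 * a)" "real l \<le> real (16 * t)" by (simp_all only: of_nat_le_iff)
      then have "real l * real l \<le> real (2 * a) * real (16 * t)" by (intro mult_mono) auto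
      then show ?thesis by (simp add: power2_eq_square)
    qed
    have lpos: "(real l)\<^sup>2 > 0" using l16 by simp
    \<comment> \<open>Scales below \<open>l^2\<close> use the covering estimate, the others the
      crude count. \<open>T + 19\<close> dominates the additive term of either, \<open>T + 1\<close>
      or 18.\<close>
    have Em: "plane.E n (\<lambda>xs. real (card (mixed j (visited 0 xs)))) \<le>
        24576 * C * real n / (real l)\<^sup>2 * (1 / 2 ^ j) + (if l ^ 2 \<le> 2 ^ j then 9 * real n * (1 / 2 ^ j) else 0) + (real T + 19)"
      for j
    proof (cases "2 ^ j < l ^ 2")
      case False
      have "0 \<le> 24576 * C * real n / (real l)\<^sup>2 * (1 / 2 ^ j)" using C by simp
      then show ?thesis using False expected_mixed_le_crude[of n j] by simp
    next
      case True
      have tj: "4 * j + 7 \<le> t" and Mj: "M * j \<le> 2 ^ t" using scale[OF True] by auto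
      have tl: "8 * t \<le> l" by (simp add: t_def)
      have "plane.E n (\<lambda>xs. real (card (mixed j (visited 0 xs)))) \<le>
         192 * real n / (4 ^ j * real a) * (C * (real j + 1)\<^sup>2 / real t) + (real T + 1)"
      proof (rule expected_mixed_le)
        fix q b assume b: "b \<in> dyadic_box j q"
        show "plane.uncovered T b (dyadic_box j q) \<le> C * (real j + 1)\<^sup>2 / real t"
          unfolding T_def by (rule cover[OF tj Mj]) (use b in \<open>auto simp: card_box box_close\<close>)
      next
        show "0 \<le> C * (real j + 1)\<^sup>2 / real t" using C by simp
        have "T \<le> 2 ^ l" unfolding T_def by (rule power_increasing) (use tl l16 in auto)
        then show "T \<le> n" using l by simp
        show "4 * j + 6 \<le> a" using tj tl l16 by (simp add: a_def)
        show "2 ^ (a + 1) \<le> n" using l l16 by (simp add: a_def)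
      qed
      also have "192 * real n / (4 ^ j * real a) * (C * (real j + 1)\<^sup>2 / real t) \<le>
         24576 * C * real n / (real l)\<^sup>2 * (1 / 2 ^ j)"
      proof -
        have at0: "real a * real t > 0" using tj tl l16 by (simp add: a_def)
        have "192 * real n / (4 ^ j * real a) * (C * (real j + 1)\<^sup>2 / real t) =
          192 * C * real n / 4 ^ j * (real j + 1)\<^sup>2 * (1 / (real a * real t))" by (simp add: mult_ac)
        also have "\<dots> \<le> 192 * C * real n / 4 ^ j * (4 * 2 ^ j) * (32 / (real l)\<^sup>2)"
        proof (intro mult_mono Suc_sq_le_power)
          have "1 / X \<le> 32 / Y" if "Y \<le> 32 * X" "X > 0" "Y > 0" for X Y :: real
            using that by (simp add: field_simps)
          from this[OF at at0 lpos] show "1 / (real a * real t) \<le> 32 / (real l)\<^sup>2" .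
        qed (use C in auto)
        also have "\<dots> = 24576 * C * real n / (real l)\<^sup>2 * (1 / 2 ^ j)"
        proof -
          have "(4::real) ^ j = 2 ^ j * 2 ^ j" by (simp add: power_mult_distrib[symmetric])
          then show ?thesis by (simp add: mult_ac)
        qed
        finally show ?thesis .
      qed
      finally show ?thesis using True by simp
    qed
    have ex: "\<exists>j. l ^ 2 \<le> (2::nat) ^ j" using less_exp[of "l ^ 2"] by (blast intro: less_imp_le)
    define j0 where "j0 = (LEAST j. l ^ 2 \<le> (2::nat) ^ j)"
    have j0: "l ^ 2 \<le> (2::nat) ^ j0" unfolding j0_def by (rule LeastI_ex[OF ex])
    have j0_le: "j0 \<le> j" if "l ^ 2 \<le> (2::nat) ^ j" for j unfolding j0_def using that by (rule Least_le)
    let ?K = "l + 1"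
    have s1: "(\<Sum>j\<in>{1..?K}. 1 / 2 ^ j :: real) \<le> 1" using sum_half_powers_from_le[of 1 ?K] by simp
    have s2: "(\<Sum>j\<in>{1..?K}. if l ^ 2 \<le> 2 ^ j then 9 * real n * (1 / 2 ^ j) else 0) \<le> 18 * real n / (real l)\<^sup>2"
    proof -
      have "(\<Sum>j\<in>{1..?K}. if l ^ 2 \<le> 2 ^ j then 9 * real n * (1 / 2 ^ j) else 0) =
         (\<Sum>j\<in>{j\<in>{1..?K}. l ^ 2 \<le> 2 ^ j}. 9 * real n * (1 / 2 ^ j))"
        by (rule sum.inter_filter[symmetric]) simp
      also have "\<dots> \<le> (\<Sum>j\<in>{j0..?K}. 9 * real n * (1 / 2 ^ j))"
        by (rule sum_mono2) (auto intro: j0_le)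
      also have "\<dots> = 9 * real n * (\<Sum>j\<in>{j0..?K}. 1 / 2 ^ j)" by (simp only: sum_distrib_left)
      also have "\<dots> \<le> 9 * real n * (2 / 2 ^ j0)" by (intro mult_left_mono sum_half_powers_from_le) simp
      also have "\<dots> \<le> 9 * real n * (2 / (real l)\<^sup>2)"
      proof -
        have "(real l)\<^sup>2 \<le> 2 ^ j0" using of_nat_mono[OF j0, where 'a = real] by simp
        then show ?thesis using lpos by (intro mult_left_mono divide_left_mono) auto
      qed
      finally show ?thesis by simp
    qed
    have s3: "real ?K * (real T + 19) \<le> real n / (real l)\<^sup>2"
      unfolding of_nat_add of_nat_1 by (rule order_trans[OF small divide_right_mono[OF n2]]) simp
    have "(\<Sum>j\<in>{1..?K}. plane.E n (\<lambda>xs. real (card (mixed j (visited 0 xs))))) \<le>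
      (\<Sum>j\<in>{1..?K}. 24576 * C * real n / (real l)\<^sup>2 * (1 / 2 ^ j) +
         (if l ^ 2 \<le> 2 ^ j then 9 * real n * (1 / 2 ^ j) else 0) + (real T + 19))"
      by (intro sum_mono Em)
    also have "\<dots> = 24576 * C * real n / (real l)\<^sup>2 * (\<Sum>j\<in>{1..?K}. 1 / 2 ^ j) +
        (\<Sum>j\<in>{1..?K}. if l ^ 2 \<le> 2 ^ j then 9 * real n * (1 / 2 ^ j) else 0) + real ?K * (real T + 19)"
    proof -
      have lin: "(\<Sum>j\<in>S. u * f j + g j + v) = u * (\<Sum>j\<in>S. f j) + (\<Sum>j\<in>S. g j) + real (card S) * v"
        for u v :: real and f g and S :: "nat set"
        by (simp add: sum.distrib sum_distrib_left)
      have cK: "card {1..?K} = ?K" by simp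
      show ?thesis unfolding lin cK by (rule refl)
    qed
    also have "\<dots> \<le> 24576 * C * real n / (real l)\<^sup>2 * 1 + 18 * real n / (real l)\<^sup>2 + real n / (real l)\<^sup>2"
      using C by (intro add_mono mult_left_mono s1 s2 s3) simp
    also have "\<dots> = C1 * real n / (real l)\<^sup>2"
      by (simp add: C1_def add_divide_distrib distrib_right)
    finally have sum: "(\<Sum>j\<in>{1..?K}. plane.E n (\<lambda>xs. real (card (mixed j (visited 0 xs))))) \<le> C1 * real n / (real l)\<^sup>2" .
    have one: "1 \<le> real n / (real l)\<^sup>2"
    proof -
      have "1 * 1 \<le> (real l + 1) * (real T + 19)" by (intro mult_mono) auto
      then show ?thesis using s3 by (simp only: of_nat_add of_nat_1)
    qed
    have "?H n \<le> log 2 3 * (4 + 4 * (\<Sum>j\<in>{1..?K}. plane.E n (\<lambda>xs. real (card (mixed j (visited 0 xs))))))"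
      by (rule plane_entropy_le_mixed) (use l in simp)
    also have "\<dots> \<le> log 2 3 * (4 * (real n / (real l)\<^sup>2) + 4 * (C1 * real n / (real l)\<^sup>2))"
      using one by (intro mult_left_mono add_mono sum) auto
    also have "\<dots> = log 2 3 * (4 + 4 * C1) * real n / (real l)\<^sup>2"
      by (simp add: algebra_simps add_divide_distrib)
    finally show ?thesis .
  qed
  \<comment> \<open>The second summand lets the trivial bound \<open>2 * n\<close> settle all
    \<open>n\<close> below \<open>2 ^ l0\<close>.\<close>
  define C2 where "C2 = log 2 3 * (4 + 4 * C1) + 2 * (real l0)\<^sup>2"
  have C2: "C2 > 0" using C1 by (auto simp: C2_def intro!: add_pos_nonneg mult_pos_pos)
  have "?H n \<le> 4 * C2 * real n / (log 2 (real n))\<^sup>2" if n: "n \<ge> 2" for n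
  proof -
    define l where "l = nat \<lfloor>log 2 (real n)\<rfloor>"
    have L: "log 2 (real n) \<ge> 1" using n by simp
    have l1: "l \<ge> 1" and lL: "real l \<le> log 2 (real n)" and Ll: "log 2 (real n) < real l + 1"
      using L unfolding l_def by linarith+
    have "2 powr (real l) \<le> 2 powr (log 2 (real n))" "2 powr (log 2 (real n)) < 2 powr (real (l + 1))"
      using lL Ll by auto
    then have "real (2 ^ l) \<le> real n" "real n < real (2 ^ (l + 1))"
      using n by (simp_all add: powr_realpow[symmetric] powr_add)
    then have nl: "2 ^ l \<le> n" "n < 2 ^ (l + 1)" by (simp_all only: of_nat_le_iff of_nat_less_iff)
    have "?H n \<le> C2 * real n / (real l)\<^sup>2"
    proof (cases "l \<ge> l0")
      case True
      have "?H n \<le> log 2 3 * (4 + 4 * C1) * real n / (real l)\<^sup>2" by (rule big[OF True nl])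
      also have "\<dots> \<le> C2 * real n / (real l)\<^sup>2"
        by (intro divide_right_mono mult_right_mono) (auto simp: C2_def)
      finally show ?thesis .
    next
      case False
      then have "(real l)\<^sup>2 \<le> (real l0)\<^sup>2" by (intro power_mono) auto
      then have "2 * (real l)\<^sup>2 \<le> C2" using C1 by (simp add: C2_def add_increasing)
      then have "2 * (real l)\<^sup>2 * real n \<le> C2 * real n" by (rule mult_right_mono) simp
      then have "2 * real n \<le> C2 * real n / (real l)\<^sup>2" using l1 by (simp add: field_simps)
      then show ?thesis using plane_entropy_le_trivial[of n] by linarith
    qed
    also have "\<dots> \<le> C2 * real n * (4 / (log 2 (real n))\<^sup>2)"
    proof -
      have "log 2 (real n) \<le> 2 * real l" using Ll l1 by linarith
      then have "(log 2 (real n))\<^sup>2 \<le> (2 * real l)\<^sup>2" using L by (intro power_mono) auto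
      then have "1 / (real l)\<^sup>2 \<le> 4 / (log 2 (real n))\<^sup>2"
        using L l1 by (simp add: field_simps power_mult_distrib)
      then have "C2 * real n * (1 / (real l)\<^sup>2) \<le> C2 * real n * (4 / (log 2 (real n))\<^sup>2)"
        using C2 by (intro mult_left_mono) auto
      then show ?thesis by simp
    qed
    finally show ?thesis by (simp add: mult.commute mult.left_commute)
  qed
  moreover have "4 * C2 > 0" using C2 by simp
  ultimately show ?thesis by blast
qed

section \<open>Transience in dimension at least three\<close>

context sym_walk
begin

text \<open>Optional stopping at the first visit to \<open>A\<close>, carried out as induction on
  the first step.\<close>

lemma superharmonic_hit_le:
  assumes super: "\<And>x. (\<Sum>s\<in>D. f (x + s)) \<le> real (card D) * f x"
    and nonneg: "\<And>x. 0 \<le> f x" and A: "\<And>x. x \<in> A \<Longrightarrow> \<phi> \<le> f x"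
  shows "(1 - avoid n x A) * \<phi> \<le> f x"
proof (induction n arbitrary: x)
  case 0
  show ?case using A[of x] nonneg[of x] by (cases "x \<in> A") (auto simp: avoid_0)
next
  case (Suc n)
  show ?case
  proof (cases "x \<in> A")
    case True
    then show ?thesis using A by simp
  next
    case False
    have "(1 - avoid (Suc n) x A) * \<phi> = (\<Sum>s\<in>D. (1 - avoid n (x + s) A) * \<phi>) / real (card D)"
      by (rule hit_Suc[OF False])
    also have "\<dots> \<le> (\<Sum>s\<in>D. f (x + s)) / real (card D)"
      using card_D_pos by (intro divide_right_mono sum_mono Suc.IH) auto
    also have "\<dots> \<le> f x" using super[of x] card_D_pos by (simp add: field_simps)
    finally show ?thesis .
  qed
qed

text \<open>Fewer than three steps contain no complete block, so the block bound is 0 there. The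
  straight walks along \<open>s\<close> and along \<open>- s\<close> already have different ranges,
  as \<open>- s\<close> is none of 0, \<open>s\<close> and \<open>s + s\<close>.\<close>

lemma entropy_range_pos:
  assumes s: "s \<in> D" "s + s \<noteq> 0" "s + s + s \<noteq> 0" and n: "n = 1 \<or> n = 2"
  shows "entropy2 (map_pmf (visited 0) (pmf_of_set (walks n))) > 0"
proof (rule entropy2_pos)
  show "replicate n s \<in> walks n" "replicate n (- s) \<in> walks n" using s D_uminus by auto
  have "s \<noteq> 0" using s by auto
  moreover have "s \<noteq> - s" "- s \<noteq> s" using s(2) by (metis add.right_inverse)+
  moreover have "- s \<noteq> s + s" using s(3) by (metis add.right_inverse add.commute)
  moreover have "- s \<in> visited 0 (replicate n (- s))" using n by (auto simp: numeral_2_eq_2)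
  moreover have "visited 0 (replicate n s) \<subseteq> {0, s, s + s}" using n by (auto simp: numeral_2_eq_2)
  ultimately show "visited 0 (replicate n s) \<noteq> visited 0 (replicate n (- s))" by auto
qed simp

end

section \<open>A superharmonic function in dimension at least three\<close>

lemma inverse_fourth_root_le:
  fixes w :: real
  assumes w: "\<bar>w\<bar> \<le> 1 / 4"
  shows "(1 + w) powr (-1/4) \<le> 1 - w / 4 + 3 / 16 * w^2 - w^3 / 8"
proof -
  define y where "y = (1 + w) powr (-1/4)"
  \<comment> \<open>Two successive square roots: \<open>Q\<close> bounds
    \<open>(1 + w) powr (-1/2)\<close> and \<open>P^2\<close> bounds \<open>Q\<close>. The quadratic
    coefficients 13/32 and 3/16 are the Taylor coefficients 3/8 and 5/32 raised by 1/32, which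
    leaves room for the remainders.\<close>
  define Q where "Q = 1 - w / 2 + 13 / 32 * w^2 - 5 / 16 * w^3"
  define P where "P = 1 - w / 4 + 3 / 16 * w^2 - w^3 / 8"
  have w1: "1 + w > 0" using w by linarith
  have pw: "\<bar>w ^ k\<bar> \<le> (1/4) ^ k" for k
    unfolding power_abs by (rule power_mono[OF w abs_ge_zero])
  have quarter: "(1/4::real)^2 = 1/16" "(1/4::real)^3 = 1/64" "(1/4::real)^4 = 1/256" "(1/4::real)^5 = 1/1024"
    by (simp_all add: eval_nat_numeral)
  have w2: "0 \<le> w^2" "w^2 \<le> 1 / 16" using pw[of 2] unfolding quarter by simp_all
  have w3: "\<bar>w^3\<bar> \<le> 1 / 64" using pw[of 3] unfolding quarter .
  have w4: "0 \<le> w^4" "w^4 \<le> 1 / 256" using pw[of 4] unfolding quarter by simp_all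
  have w5: "\<bar>w^5\<bar> \<le> 1 / 1024" using pw[of 5] unfolding quarter .
  have y0: "y > 0" using w1 by (simp add: y_def)
  have P0: "P \<ge> 0" using w w2 w3 unfolding P_def by linarith
  have Q0: "Q \<ge> 0" using w w2 w3 unfolding Q_def by linarith
  have y4: "y^4 * (1 + w) = 1"
  proof -
    have "y^4 = (1 + w) powr (-1)" using w1 unfolding y_def by (simp add: powr_power)
    then show ?thesis using w1 by (simp add: powr_minus)
  qed
  have PQ: "Q \<le> P^2"
  proof -
    have "P^2 - Q = w^2 * (1/32 - w/32 + 25/256 * w^2 - 3/64 * w^3 + 1/64 * w^4)"
      unfolding P_def Q_def by (simp add: power2_eq_square power3_eq_cube power4_eq_xxxx algebra_simps)
    moreover have "1/32 - w/32 + 25/256 * w^2 - 3/64 * w^3 + 1/64 * w^4 \<ge> 0"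
      using w w2 w3 w4 by linarith
    ultimately have "P^2 - Q \<ge> 0" using w2(1) by simp
    then show ?thesis by simp
  qed
  have Q1: "1 \<le> Q^2 * (1 + w)"
  proof -
    have "Q^2 * (1 + w) - 1 = w^2 * (1/16 + w/32 - 567/1024 * w^2 + 229/1024 * w^3 - 5/32 * w^4 + 25/256 * w^5)"
      unfolding Q_def by (simp add: eval_nat_numeral field_simps)
    moreover have "1/16 + w/32 - 567/1024 * w^2 + 229/1024 * w^3 - 5/32 * w^4 + 25/256 * w^5 \<ge> 0"
      using w w2 w3 w4 w5 by linarith
    ultimately have "Q^2 * (1 + w) - 1 \<ge> 0" using w2(1) by simp
    then show ?thesis by simp
  qed
  have "y^4 * (1 + w) \<le> Q^2 * (1 + w)" using y4 Q1 by simp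
  then have "(y^2)^2 \<le> Q^2" using w1 by (simp add: power_mult[symmetric])
  then have "y^2 \<le> Q" using Q0 by (rule power2_le_imp_le)
  then have "y^2 \<le> P^2" using PQ by linarith
  then have "y \<le> P" using P0 by (rule power2_le_imp_le)
  then show ?thesis by (simp add: y_def P_def)
qed

text \<open>Points of the lattice become functions on \<open>nat\<close> with pointwise addition, so
  that the dimension stays an ordinary parameter instead of a type.\<close>

definition unitv :: "nat \<Rightarrow> int \<Rightarrow> nat \<Rightarrow> int" where
  "unitv i a = (\<lambda>j. if j = i then a else 0)"

definition units :: "nat \<Rightarrow> (nat \<Rightarrow> int) set" where
  "units d = (\<lambda>p. unitv (fst p) (snd p)) ` ({..<d} \<times> {1, -1})"

lemma units_inj: "inj_on (\<lambda>p. unitv (fst p) (snd p)) ({..<d} \<times> {1, -1})"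
  by (auto simp: inj_on_def unitv_def fun_eq_iff split: if_splits)

lemma unitv_in_units: "i < d \<Longrightarrow> a = 1 \<or> a = -1 \<Longrightarrow> unitv i a \<in> units d"
  unfolding units_def by (rule image_eqI[of _ _ "(i, a)"]) auto

lemma sum_units: "(\<Sum>s\<in>units d. h s) = (\<Sum>i<d. h (unitv i 1) + h (unitv i (-1)))"
proof -
  have "(\<Sum>s\<in>units d. h s) = (\<Sum>p\<in>{..<d} \<times> {1, -1}. h (unitv (fst p) (snd p)))"
    unfolding units_def by (simp only: sum.reindex[OF units_inj] o_def)
  also have "\<dots> = (\<Sum>i<d. \<Sum>a\<in>{1, -1}. h (unitv i a))"
    by (simp add: sum.cartesian_product case_prod_unfold del: sum.insert)
  finally show ?thesis by simp
qed

lemma card_units: "card (units d) = 2 * d"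
  unfolding units_def by (simp add: card_image[OF units_inj] card_cartesian_product)

lemma unitv_uminus: "- unitv i a = unitv i (- a)"
  by (auto simp: unitv_def fun_eq_iff)

text \<open>With the exponent \<open>-1/4\<close> instead of the Newtonian \<open>-1/2\<close> there is room for all discretisation errors;
  the coordinates beyond the third only make the walk lazy.\<close>
definition nrm :: "(nat \<Rightarrow> int) \<Rightarrow> real" where
  "nrm x = (real_of_int (x 0))\<^sup>2 + (real_of_int (x 1))\<^sup>2 + (real_of_int (x 2))\<^sup>2 + 16"

definition lyap :: "(nat \<Rightarrow> int) \<Rightarrow> real" where
  "lyap x = nrm x powr (-1/4)"

lemma nrm_ge: "nrm x \<ge> 16"
  by (simp add: nrm_def)

lemma nrm_unitv:
  "i < 3 \<Longrightarrow> nrm (x + unitv i a) = nrm x + 2 * real_of_int a * real_of_int (x i) + (real_of_int a)\<^sup>2"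
  "i \<ge> 3 \<Longrightarrow> nrm (x + unitv i a) = nrm x"
proof -
  assume "i < 3"
  then have "i = 0 \<or> i = 1 \<or> i = 2" by auto
  then show "nrm (x + unitv i a) = nrm x + 2 * real_of_int a * real_of_int (x i) + (real_of_int a)\<^sup>2"
    by (auto simp: nrm_def unitv_def power2_sum)
qed (auto simp: nrm_def unitv_def)

text \<open>With \<open>s = nrm x + 1\<close> and \<open>w = 2 * x i / s\<close> the two neighbours
  have norms \<open>s * (1 + w)\<close> and \<open>s * (1 - w)\<close>, so the odd terms of
  \<open>inverse_fourth_root_le\<close> cancel.\<close>

lemma lyap_pair_le:
  assumes i: "i < 3"
  shows "lyap (x + unitv i 1) + lyap (x + unitv i (-1)) \<le>
     (nrm x + 1) powr (-1/4) * (2 + 3 / 2 * (real_of_int (x i))\<^sup>2 / (nrm x + 1)\<^sup>2)"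
proof -
  define s where "s = nrm x + 1"
  define z where "z = real_of_int (x i)"
  define w where "w = 2 * z / s"
  have s0: "s > 0" using nrm_ge[of x] by (simp add: s_def)
  have sw: "s * w = 2 * z" using s0 by (simp add: w_def)
  \<comment> \<open>The shift 16 in \<open>nrm\<close> is there for this: it gives
    \<open>8 * \<bar>z\<bar> \<le> s\<close>, that is
    \<open>\<bar>w\<bar> \<le> 1 / 4\<close>.\<close>
  have "z\<^sup>2 + 16 \<le> nrm x"
  proof -
    have "i = 0 \<or> i = 1 \<or> i = 2" using i by auto
    then show ?thesis by (auto simp: nrm_def z_def)
  qed
  moreover have "0 \<le> (\<bar>z\<bar> - 4)\<^sup>2" by simp
  then have "8 * \<bar>z\<bar> \<le> z\<^sup>2 + 16" by (simp add: power2_eq_square algebra_simps)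
  ultimately have zs: "8 * \<bar>z\<bar> \<le> s" by (simp add: s_def)
  then have "\<bar>w\<bar> \<le> 1 / 4" using s0 by (simp add: w_def abs_mult field_simps)
  then have w: "\<bar>w\<bar> \<le> 1 / 4" "\<bar>- w\<bar> \<le> 1 / 4" by auto
  have le: "(1 + w) powr (-1/4) + (1 + - w) powr (-1/4) \<le> 2 + 3 / 8 * w^2"
    using inverse_fourth_root_le[OF w(1)] inverse_fourth_root_le[OF w(2)] by simp
  have "lyap (x + unitv i 1) = s powr (-1/4) * (1 + w) powr (-1/4)"
  proof -
    have "nrm (x + unitv i 1) = s * (1 + w)" using sw by (simp add: nrm_unitv(1)[OF i] distrib_left) (simp add: s_def z_def)
    then show ?thesis using s0 w by (simp add: lyap_def powr_mult)
  qed
  moreover have "lyap (x + unitv i (-1)) = s powr (-1/4) * (1 + - w) powr (-1/4)"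
  proof -
    have "nrm (x + unitv i (-1)) = s * (1 + - w)" using sw by (simp add: nrm_unitv(1)[OF i] right_diff_distrib) (simp add: s_def z_def)
    then show ?thesis using s0 w by (simp add: lyap_def powr_mult)
  qed
  ultimately have "lyap (x + unitv i 1) + lyap (x + unitv i (-1)) =
      s powr (-1/4) * ((1 + w) powr (-1/4) + (1 + - w) powr (-1/4))"
    by (simp only: distrib_left)
  also have "\<dots> \<le> s powr (-1/4) * (2 + 3 / 8 * w^2)" by (rule mult_left_mono[OF le]) simp
  also have "3 / 8 * w^2 = 3 / 2 * z\<^sup>2 / s\<^sup>2" by (simp add: w_def power_divide power_mult_distrib)
  finally show ?thesis by (simp only: s_def z_def)
qed

text \<open>The three pairs sum to at most \<open>s powr (-1/4) * (6 + 3 / (2 * s))\<close>. Since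
  \<open>nrm x = s - 1\<close>, the value \<open>6 * lyap x\<close> is at least
  \<open>6 * s powr (-1/4) * (1 + 1 / (4 * s))\<close>, which is the same number; the coefficient
  3/16 in \<open>inverse_fourth_root_le\<close> is the one for which both sides meet.\<close>

lemma lyap_superharmonic:
  assumes d: "d \<ge> 3"
  shows "(\<Sum>s\<in>units d. lyap (x + s)) \<le> real (card (units d)) * lyap x"
proof -
  define s where "s = nrm x + 1"
  have s17: "s \<ge> 17" using nrm_ge[of x] by (simp add: s_def)
  define g where "g i = lyap (x + unitv i 1) + lyap (x + unitv i (-1))" for i
  have "{..<3} = {0, 1, 2::nat}" by auto
  then have "(\<Sum>i<3. g i) = g 0 + g 1 + g 2" by simp
  also have "\<dots> \<le> s powr (-1/4) * (2 + 3 / 2 * (real_of_int (x 0))\<^sup>2 / s\<^sup>2) +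
     s powr (-1/4) * (2 + 3 / 2 * (real_of_int (x 1))\<^sup>2 / s\<^sup>2) + s powr (-1/4) * (2 + 3 / 2 * (real_of_int (x 2))\<^sup>2 / s\<^sup>2)"
    unfolding s_def g_def by (intro add_mono lyap_pair_le) auto
  also have "\<dots> = s powr (-1/4) * (6 + 3 / 2 * ((nrm x - 16) / s\<^sup>2))"
    by (simp add: nrm_def add_divide_distrib algebra_simps)
  also have "\<dots> \<le> s powr (-1/4) * (6 * (1 + 1 / (4 * s)))"
  proof (rule mult_left_mono)
    have "(nrm x - 16) / s\<^sup>2 \<le> s / s\<^sup>2" by (intro divide_right_mono) (auto simp: s_def)
    also have "\<dots> = 1 / s" using s17 by (simp add: power2_eq_square)
    finally have "3 / 2 * ((nrm x - 16) / s\<^sup>2) \<le> 3 / 2 * (1 / s)" by (rule mult_left_mono) simp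
    moreover have "6 * (1 + 1 / (4 * s)) = 6 + 3 / 2 * (1 / s)" by (simp add: field_simps)
    ultimately show "6 + 3 / 2 * ((nrm x - 16) / s\<^sup>2) \<le> 6 * (1 + 1 / (4 * s))" by linarith
  qed simp
  also have "\<dots> \<le> 6 * lyap x"
  proof -
    \<comment> \<open>The claim is \<open>1 + y \<le> (1 - 4 * y) powr (-1/4)\<close>, where
      \<open>1 - 4 * y = nrm x / s\<close>. Its fourth power follows from
      \<open>1 - 4 * y \<le> (1 - y)^4\<close> and \<open>(1 - y^2)^4 \<le> 1\<close>.\<close>
    define y where "y = 1 / (4 * s)"
    have y: "0 < y" "y < 1 / 4" using s17 by (auto simp: y_def field_simps)
    have "1 + (real 4) * (- y) \<le> (1 + (- y)) ^ 4" by (rule Bernoulli_inequality) (use y in simp)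
    then have "1 - 4 * y \<le> (1 - y) ^ 4" by simp
    moreover have "(1 + y) ^ 4 * (1 - y) ^ 4 \<le> 1"
    proof -
      have "y * y \<le> 1 * 1" by (intro mult_mono) (use y in auto)
      then have "((1 + y) * (1 - y)) ^ 4 \<le> 1 ^ 4" by (intro power_mono) (use y in \<open>auto simp: algebra_simps\<close>)
      then show ?thesis by (simp add: power_mult_distrib)
    qed
    ultimately have "(1 + y) ^ 4 * (1 - 4 * y) \<le> 1"
      by (meson order_trans mult_left_mono zero_le_power y less_imp_le add_nonneg_nonneg zero_le_one)
    moreover have "1 - 4 * y = nrm x / s" using s17 by (simp add: y_def s_def field_simps)
    ultimately have "(1 + y) ^ 4 * (nrm x / s) \<le> 1" by (simp only:)
    then have le: "(1 + y) ^ 4 * nrm x \<le> s" using s17 by (simp add: divide_le_eq)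
    have n0: "nrm x > 0" using nrm_ge[of x] by linarith
    have "(1 + y) ^ 4 \<le> s / nrm x" using le n0 by (simp add: field_simps)
    then have "((1 + y) ^ 4) powr (1/4) \<le> (s / nrm x) powr (1/4)" using y by (intro powr_mono2) auto
    moreover have "((1 + y) ^ 4) powr (1/4) = 1 + y"
    proof -
      have "(1 + y) ^ 4 = (1 + y) powr (real 4)" using y by (intro powr_realpow[symmetric]) simp
      then have "((1 + y) ^ 4) powr (1/4) = (1 + y) powr (real 4 * (1/4))" by (simp only: powr_powr)
      then show ?thesis using y by simp
    qed
    moreover have "(s / nrm x) powr (1/4) = s powr (1/4) * lyap x"
      using powr_minus_divide[of "nrm x" "1/4"] s17 n0 by (simp add: lyap_def powr_divide)
    ultimately have "1 + y \<le> s powr (1/4) * lyap x" by simp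
    then have "s powr (-1/4) * (1 + y) \<le> s powr (-1/4) * (s powr (1/4) * lyap x)" by (intro mult_left_mono) auto
    also have "\<dots> = lyap x" using s17 by (simp add: mult.assoc[symmetric] powr_add[symmetric])
    finally have "6 * (s powr (-1/4) * (1 + y)) \<le> 6 * lyap x" by simp
    then show ?thesis by (simp only: y_def mult.left_commute)
  qed
  finally have three: "(\<Sum>i<3. g i) \<le> 6 * lyap x" .
  have split: "{..<d} = {..<3} \<union> {3..<d}" using d by auto
  have "(\<Sum>i<d. g i) = (\<Sum>i<3. g i) + (\<Sum>i\<in>{3..<d}. g i)"
    unfolding split by (rule sum.union_disjoint) auto
  also have "(\<Sum>i\<in>{3..<d}. g i) = (\<Sum>i\<in>{3..<d}. 2 * lyap x)"
  proof (rule sum.cong[OF refl])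
    fix i assume "i \<in> {3..<d}"
    then have "3 \<le> i" by simp
    then show "g i = 2 * lyap x" unfolding g_def lyap_def nrm_unitv(2)[OF \<open>3 \<le> i\<close>] by simp
  qed
  also have "\<dots> = (2 * real d - 6) * lyap x" using d by (simp add: of_nat_diff algebra_simps)
  finally have "(\<Sum>i<d. g i) \<le> 2 * real d * lyap x" using three by (simp add: algebra_simps)
  then show ?thesis by (simp only: sum_units card_units g_def of_nat_mult of_nat_numeral)
qed

section \<open>Escape from two points and linear entropy in dimension at least three\<close>

definition pt :: "int \<Rightarrow> int \<Rightarrow> nat \<Rightarrow> int" where
  "pt a b = (\<lambda>j. if j = 0 then a else if j = 1 then b else 0)"

lemma pt_eq_iff: "pt a b = pt a' b' \<longleftrightarrow> a = a' \<and> b = b'"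
proof
  assume "pt a b = pt a' b'"
  then have "pt a b 0 = pt a' b' 0" "pt a b 1 = pt a' b' 1" by simp_all
  then show "a = a' \<and> b = b'" by (simp add: pt_def)
qed simp

lemma pt_add: "pt a b + pt a' b' = pt (a + a') (b + b')"
  by (auto simp: pt_def fun_eq_iff)

lemma pt_0: "pt 0 0 = 0"
  by (auto simp: pt_def fun_eq_iff)

lemma pt_units: "d \<ge> 3 \<Longrightarrow> pt 1 0 \<in> units d" "d \<ge> 3 \<Longrightarrow> pt (-1) 0 \<in> units d" "d \<ge> 3 \<Longrightarrow> pt 0 1 \<in> units d"
proof -
  have "pt 1 0 = unitv 0 1" "pt (-1) 0 = unitv 0 (-1)" "pt 0 1 = unitv 1 1"
    by (auto simp: pt_def unitv_def fun_eq_iff)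
  then show "d \<ge> 3 \<Longrightarrow> pt 1 0 \<in> units d" "d \<ge> 3 \<Longrightarrow> pt (-1) 0 \<in> units d" "d \<ge> 3 \<Longrightarrow> pt 0 1 \<in> units d"
    by (simp_all add: unitv_in_units)
qed

lemma units_sym_walk: "d \<ge> 3 \<Longrightarrow> sym_walk (units d)"
proof
  assume d: "d \<ge> 3"
  show "finite (units d)" by (simp add: units_def)
  show "units d \<noteq> {}" using pt_units[OF d] by auto
  show "- s \<in> units d" if "s \<in> units d" for s
    using that by (auto simp: units_def unitv_uminus intro!: unitv_in_units[unfolded units_def])
qed

lemma high_dim_entropy_bounds:
  assumes d: "d \<ge> 3"
  defines "H \<equiv> \<lambda>n. entropy2 (map_pmf (visited 0) (pmf_of_set {xs. set xs \<subseteq> units d \<and> length xs = n}))"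
  shows "\<exists>c C. c > 0 \<and> C > 0 \<and> (\<forall>n::nat. c * real n \<le> H n \<and> H n \<le> C * real n)"
proof -
  interpret sym_walk "units d" by (rule units_sym_walk[OF d])
  define A where "A = {pt 0 0, pt 2 0}"
  define N where "N = real (card (units d))"
  have N6: "N \<ge> 6" using d by (simp add: N_def card_units)
  have A: "{0, pt 1 0 + pt 1 0} = A" by (simp add: A_def pt_0 pt_add)
  \<comment> \<open>The points of \<open>A\<close> have norms 16 and 20, and 320 is 16 * 20. So
    \<open>lyap x\<close> is at most \<open>16 powr (-1/4) = 1 / 2\<close> times the smallest value
    on \<open>A\<close>, and \<open>A\<close> is hit with probability at most 1/2.\<close>
  have far: "1 / 2 \<le> avoid n x A" if x: "nrm x \<ge> 320" for n x
  proof -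
    have "(1 - avoid n x A) * 20 powr (-1/4) \<le> lyap x"
    proof (rule superharmonic_hit_le)
      show "(\<Sum>s\<in>units d. lyap (x + s)) \<le> real (card (units d)) * lyap x" for x by (rule lyap_superharmonic[OF d])
      show "0 \<le> lyap x" for x by (simp add: lyap_def)
      fix y assume "y \<in> A"
      then have "nrm y = 16 \<or> nrm y = 20" unfolding A_def by (auto simp: nrm_def pt_def)
      moreover have "(20::real) powr (-1/4) \<le> 16 powr (-1/4)" by (rule powr_mono2') auto
      ultimately show "20 powr (-1/4) \<le> lyap y" by (auto simp: lyap_def)
    qed
    also have "lyap x \<le> 320 powr (-1/4)" unfolding lyap_def using x by (intro powr_mono2') auto
    also have "\<dots> = 16 powr (-1/4) * 20 powr (-1/4)" by (simp add: powr_mult[symmetric])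
    also have "(16::real) powr (-1/4) = 1 / 2"
    proof -
      have "(16::real) = 2 powr 4" by simp
      then have "(16::real) powr (-1/4) = 2 powr (-1)" by (simp only: powr_powr) simp
      then show ?thesis by (simp add: powr_minus)
    qed
    finally have "1 - avoid n x A \<le> 1 / 2" by (rule mult_right_le_imp_le) simp
    then show ?thesis by linarith
  qed
  \<comment> \<open>\<open>k\<close> prescribed steps in one direction, at a factor \<open>N\<close>
    each; the points from which a step is taken must lie outside \<open>A\<close>.\<close>
  have chain: "avoid n (x + pt (int k * a) (int k * b)) A \<le> N ^ k * avoid (n + k) x A"
    if s: "pt a b \<in> units d" and off: "\<And>i. i < k \<Longrightarrow> x + pt (int i * a) (int i * b) \<notin> A" for n k x a b
    using off
  proof (induction k arbitrary: n)
    case 0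
    then show ?case by (simp add: pt_0)
  next
    case (Suc k)
    let ?y = "x + pt (int k * a) (int k * b)"
    have e: "x + pt (int (Suc k) * a) (int (Suc k) * b) = ?y + pt a b"
      by (simp add: add.assoc pt_add algebra_simps)
    have "avoid n (?y + pt a b) A \<le> N * avoid (Suc n) ?y A"
      unfolding N_def by (rule avoid_step[OF Suc.prems s]) simp
    also have "\<dots> \<le> N * (N ^ k * avoid (Suc n + k) x A)"
      using N6 by (intro mult_left_mono Suc.IH Suc.prems) auto
    finally show ?case unfolding e by (simp only: power_Suc mult.assoc add_Suc add_Suc_right)
  qed
  \<comment> \<open>18^2 + 16 exceeds 320, and 17 steps lead from -1 to -18, away from
    \<open>A\<close>.\<close>
  have left: "1 / 2 \<le> N ^ 17 * avoid n (pt (-1) 0) A" for n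
  proof -
    have "1 / 2 \<le> avoid n (pt (-18) 0) A" by (rule far) (simp add: nrm_def pt_def)
    also have "\<dots> \<le> N ^ 17 * avoid (n + 17) (pt (-1) 0) A"
    proof -
      have "avoid n (pt (-1) 0 + pt (int 17 * (-1)) (int 17 * 0)) A \<le> N ^ 17 * avoid (n + 17) (pt (-1) 0) A"
        by (rule chain[OF pt_units(2)[OF d]]) (unfold A_def, simp add: pt_add pt_eq_iff)
      then show ?thesis by (simp add: pt_add)
    qed
    also have "\<dots> \<le> N ^ 17 * avoid n (pt (-1) 0) A"
      using N6 by (intro mult_left_mono avoid_antimono) auto
    finally show ?thesis .
  qed
  \<comment> \<open>The way from between the two points goes sideways, along the second axis, where
    it never meets \<open>A\<close>.\<close>
  have right: "1 / 2 \<le> N ^ 18 * avoid n (pt 1 0) A" for n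
  proof -
    have "1 / 2 \<le> avoid n (pt 1 18) A" by (rule far) (simp add: nrm_def pt_def)
    also have "\<dots> \<le> N ^ 18 * avoid (n + 18) (pt 1 0) A"
    proof -
      have "avoid n (pt 1 0 + pt (int 18 * 0) (int 18 * 1)) A \<le> N ^ 18 * avoid (n + 18) (pt 1 0) A"
        by (rule chain[OF pt_units(3)[OF d]]) (unfold A_def, simp add: pt_add pt_eq_iff)
      then show ?thesis by (simp add: pt_add)
    qed
    also have "\<dots> \<le> N ^ 18 * avoid n (pt 1 0) A"
      using N6 by (intro mult_left_mono avoid_antimono) auto
    finally show ?thesis .
  qed
  \<comment> \<open>Both sides need 18 prescribed steps: 18 from the midpoint, and on the left 17
    after the first step from 0 to -1.\<close>
  define h where "h = 1 / (2 * N ^ 18)"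
  have h0: "h > 0" using N6 by (simp add: h_def)
  have esc: "h \<le> escape A 0 n" for n
  proof (cases n)
    case 0
    have "1 \<le> N ^ 18" using N6 by (intro one_le_power) simp
    then have "h \<le> 1" unfolding h_def by (subst divide_le_eq_1_pos) linarith+
    then show ?thesis using 0 by simp
  next
    case (Suc m)
    have "1 / 2 \<le> N ^ 17 * avoid m (pt (-1) 0) A" by (rule left)
    also have "avoid m (pt (-1) 0) A \<le> (\<Sum>s\<in>units d. avoid m (0 + s) A)"
      using member_le_sum[OF pt_units(2)[OF d], of "\<lambda>s. avoid m (0 + s) A"] by (simp add: avoid_nonneg finite_D)
    also have "\<dots> = N * escape A 0 n" using N6 by (simp add: Suc N_def)
    finally have "1 / 2 \<le> N ^ 17 * (N * escape A 0 n)" using N6 by (simp add: mult_left_mono)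
    then show ?thesis using N6 by (simp add: h_def field_simps eval_nat_numeral)
  qed
  have av: "h \<le> avoid n (pt 1 0) A" for n using right[of n] N6 by (simp add: h_def field_simps)
  define c0 where "c0 = 2 / N ^ 3 * h * h / 5"
  have c0: "c0 > 0" using N6 h0 by (simp add: c0_def)
  have range_ge: "real (n div 3) * (2 / N ^ 3 * h * h) \<le> H n" for n
  proof -
    have ss: "pt 1 0 + pt 1 0 \<noteq> 0" by (simp add: pt_add pt_0[symmetric] pt_eq_iff)
    have "real (n div 3) * (2 / N ^ 3 * h * h) \<le>
        real (n div 3) * (2 / N ^ 3 * escape A 0 n * avoid n (pt 1 0) A)"
      using N6 h0 by (intro mult_mono mult_left_mono esc av mult_nonneg_nonneg escape_nonneg) auto
    also have "\<dots> \<le> H n"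
      using entropy_range_ge[OF pt_units(1)[OF d] ss, of n] unfolding H_def N_def A .
    finally show ?thesis .
  qed
  have pos: "H n > 0" if "n = 1 \<or> n = 2" for n
    unfolding H_def
    by (rule entropy_range_pos[OF pt_units(1)[OF d] _ _ that]) (simp_all add: pt_add pt_0[symmetric] pt_eq_iff)
  \<comment> \<open>\<open>n div 3\<close> vanishes for \<open>n = 1\<close> and
    \<open>n = 2\<close>, so these two values enter through the positivity of their
    entropies.\<close>
  define c where "c = min c0 (min (H 1) (H 2 / 2))"
  have c: "c > 0" using c0 pos by (simp add: c_def)
  have "c * real n \<le> H n" for n
  proof -
    consider "n = 0" | "n = 1" | "n = 2" | "n \<ge> 3" by linarith
    then show ?thesis
    proof cases
      case 1
      then show ?thesis using range_ge[of 0] by simp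
    next
      case 2
      then show ?thesis by (simp add: c_def)
    next
      case 3
      have "c \<le> H 2 / 2" by (simp add: c_def)
      then show ?thesis using 3 by simp
    next
      case 4
      then have "n \<le> 5 * (n div 3)" by presburger
      then have "real n \<le> real (5 * (n div 3))" by (rule of_nat_mono)
      then have n5: "real n / 5 \<le> real (n div 3)" by simp
      have "c * real n \<le> c0 * real n" by (intro mult_right_mono) (auto simp: c_def)
      also have "\<dots> = real n / 5 * (2 / N ^ 3 * h * h)" by (simp add: c0_def mult_ac)
      also have "\<dots> \<le> real (n div 3) * (2 / N ^ 3 * h * h)"
        using N6 h0 by (intro mult_right_mono n5) simp
      also have "\<dots> \<le> H n" by (rule range_ge)
      finally show ?thesis .
    qed
  qed
  moreover have "H n \<le> log 2 N * real n" for n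
  proof -
    have "H n \<le> log 2 (real (card (walks n)))"
      unfolding H_def by (rule entropy2_le_log_card) (use walks_nonempty in auto)
    also have "\<dots> = log 2 N * real n" using N6 by (simp add: card_walks N_def log_nat_power)
    finally show ?thesis .
  qed
  moreover have "log 2 N > 0" using N6 by simp
  ultimately show ?thesis using c by blast
qed

section \<open>Transport along a coordinate map\<close>

text \<open>Under a coordinate map that is injective and additive on lists of length
  \<open>d\<close>, equal ranges correspond to equal visited sets. The length conditions are
  essential in this form because \<open>vadd\<close> truncates to the shorter list.\<close>

lemma range_dist_entropy_transport:
  fixes \<phi> :: "int list \<Rightarrow> 'a::ab_group_add"
  assumes inj: "inj_on \<phi> {l. length l = d}"
    and add: "\<And>l m. length l = d \<Longrightarrow> length m = d \<Longrightarrow> \<phi> (vadd l m) = \<phi> l + \<phi> m"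
    and zero: "\<phi> (replicate d 0) = 0"
    and steps: "\<phi> ` steps d = D" and fin: "finite D" and ne: "D \<noteq> {}"
  shows "entropy2 (range_dist d n) = entropy2 (map_pmf (visited 0) (pmf_of_set {xs. set xs \<subseteq> D \<and> length xs = n}))"
proof -
  have len: "length s = d" if "s \<in> steps d" for s using that by (auto simp: steps_def unit_step_def)
  have len_vadd: "length (vadd l m) = d" if "length l = d" "length m = d" for l m
    using that by (simp add: vadd_def)
  have foldl: "\<phi> (foldl vadd a zs) = \<phi> a + sum_list (map \<phi> zs) \<and> length (foldl vadd a zs) = d"
    if "length a = d" "set zs \<subseteq> steps d" for a zs
    using that
  proof (induction zs arbitrary: a)
    case (Cons s zs)
    have s: "length s = d" using Cons.prems len by simp
    show ?case using Cons.IH[of "vadd a s"] Cons.prems s len_vadd[of a s] by (simp add: add add.assoc)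
  qed simp
  have inj_steps: "inj_on \<phi> (steps d)" by (rule inj_on_subset[OF inj]) (auto dest: len)
  have fin_steps: "finite (steps d)" using fin steps finite_imageD[OF _ inj_steps] by simp
  have walk: "\<phi> (walk_pos d xs k) = sum_list (take k (map \<phi> xs)) \<and> length (walk_pos d xs k) = d"
    if "xs \<in> step_seqs d n" for xs k
  proof -
    have "set (take k xs) \<subseteq> steps d" using that set_take_subset[of k xs] by (auto simp: step_seqs_def)
    then show ?thesis
      using foldl[of "replicate d 0" "take k xs"] by (simp add: walk_pos_def zero take_map)
  qed
  have range: "visited 0 (map \<phi> xs) = \<phi> ` walk_range d xs n" and sub: "walk_range d xs n \<subseteq> {l. length l = d}"
    if "xs \<in> step_seqs d n" for xs
  proof -
    have "length xs = n" using that by (simp add: step_seqs_def)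
    then show "visited 0 (map \<phi> xs) = \<phi> ` walk_range d xs n"
    proof -
      have "visited 0 (map \<phi> xs) = {\<phi> (walk_pos d xs k) | k. k \<le> n}"
        using walk[OF that] \<open>length xs = n\<close> by (simp add: visited_conv_take)
      also have "\<dots> = \<phi> ` walk_range d xs n" unfolding walk_range_def by blast
      finally show ?thesis .
    qed
    show "walk_range d xs n \<subseteq> {l. length l = d}" using walk[OF that] by (auto simp: walk_range_def)
  qed
  have bij: "bij_betw (map \<phi>) (step_seqs d n) {xs. set xs \<subseteq> D \<and> length xs = n}"
    unfolding bij_betw_def
  proof
    show "inj_on (map \<phi>) (step_seqs d n)"
      by (rule inj_on_mapI, rule inj_on_subset[OF inj_steps]) (auto simp: step_seqs_def)
    show "map \<phi> ` step_seqs d n = {xs. set xs \<subseteq> D \<and> length xs = n}"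
    proof
      show "map \<phi> ` step_seqs d n \<subseteq> {xs. set xs \<subseteq> D \<and> length xs = n}"
        using steps by (auto simp: step_seqs_def subset_iff)
      show "{xs. set xs \<subseteq> D \<and> length xs = n} \<subseteq> map \<phi> ` step_seqs d n"
      proof
        fix xs assume xs: "xs \<in> {xs. set xs \<subseteq> D \<and> length xs = n}"
        let ?g = "inv_into (steps d) \<phi>"
        have g: "?g s \<in> steps d \<and> \<phi> (?g s) = s" if "s \<in> set xs" for s
          using that xs steps by (auto intro: inv_into_into f_inv_into_f)
        have "map \<phi> (map ?g xs) = xs" using g by (simp add: map_idI)
        moreover have "map ?g xs \<in> step_seqs d n" using g xs by (auto simp: step_seqs_def)
        ultimately show "xs \<in> map \<phi> ` step_seqs d n" by (metis imageI)
      qed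
    qed
  qed
  have "step_seqs d n = {xs. set xs \<subseteq> steps d \<and> length xs = n}" by (auto simp: step_seqs_def)
  then have fin_seqs: "finite (step_seqs d n)" using finite_lists_length_eq[OF fin_steps] by simp
  obtain s where "s \<in> steps d" using ne steps by auto
  then have "replicate n s \<in> step_seqs d n" by (auto simp: step_seqs_def)
  then have ne_seqs: "step_seqs d n \<noteq> {}" by auto
  show ?thesis
    unfolding range_dist_def
  proof (rule entropy2_map_uniform_bij[OF fin_seqs ne_seqs bij])
    fix xs ys assume xy: "xs \<in> step_seqs d n" "ys \<in> step_seqs d n"
    show "walk_range d xs n = walk_range d ys n \<longleftrightarrow> visited 0 (map \<phi> xs) = visited 0 (map \<phi> ys)"
      unfolding range[OF xy(1)] range[OF xy(2)]
      by (rule inj_on_image_eq_iff[OF inj sub[OF xy(1)] sub[OF xy(2)], symmetric])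
  qed
qed

lemma range_dist_plane:
  "entropy2 (range_dist 2 n) = entropy2 (map_pmf (visited 0) (pmf_of_set {xs. set xs \<subseteq> D2 \<and> length xs = n}))"
proof (rule range_dist_entropy_transport[where \<phi> = "\<lambda>l. (l ! 0, l ! 1)"])
  have two: "\<exists>a b. l = [a, b]" if "length l = 2" for l :: "int list"
    using that by (auto simp: length_Suc_conv numeral_2_eq_2)
  show "inj_on (\<lambda>l::int list. (l ! 0, l ! 1)) {l. length l = 2}"
    by (auto simp: inj_on_def dest!: two)
  show "(vadd l m ! 0, vadd l m ! 1) = (l ! 0, l ! 1) + (m ! 0, m ! 1)" if "length l = 2" "length m = 2" for l m
    using two[OF that(1)] two[OF that(2)] by (auto simp: vadd_def)
  show "(replicate 2 0 ! 0, replicate 2 0 ! 1) = (0 :: int \<times> int)"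
    by (simp add: zero_prod_def numeral_2_eq_2)
  have "steps 2 = {[1, 0], [-1, 0], [0, 1], [0, -1]}"
  proof -
    have "unit_step 2 0 s = [s, 0]" "unit_step 2 1 s = [0, s]" for s
      by (simp_all add: unit_step_def numeral_2_eq_2)
    moreover have "i < 2 \<longleftrightarrow> i = 0 \<or> i = 1" for i :: nat by auto
    ultimately show ?thesis unfolding steps_def by (auto simp: numeral_2_eq_2) (metis One_nat_def)+
  qed
  then show "(\<lambda>l. (l ! 0, l ! 1)) ` steps 2 = D2" by (simp add: D2_def)
qed (auto simp: D2_def)

lemma range_dist_units:
  assumes d: "d \<ge> 3"
  shows "entropy2 (range_dist d n) = entropy2 (map_pmf (visited 0) (pmf_of_set {xs. set xs \<subseteq> units d \<and> length xs = n}))"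
proof (rule range_dist_entropy_transport[where \<phi> = "\<lambda>l j. if j < length l then l ! j else 0"])
  show "inj_on (\<lambda>l j. if j < length l then l ! j else (0::int)) {l. length l = d}"
  proof (rule inj_onI)
    fix l m :: "int list" assume lm: "l \<in> {l. length l = d}" "m \<in> {l. length l = d}"
      and eq: "(\<lambda>j. if j < length l then l ! j else 0) = (\<lambda>j. if j < length m then m ! j else 0)"
    show "l = m"
    proof (rule nth_equalityI)
      show "length l = length m" using lm by simp
      show "l ! j = m ! j" if "j < length l" for j using fun_cong[OF eq, of j] that lm by simp
    qed
  qed
  show "(\<lambda>j. if j < length (vadd l m) then vadd l m ! j else 0) =
     (\<lambda>j. if j < length l then l ! j else 0) + (\<lambda>j. if j < length m then m ! j else 0)"
    if "length l = d" "length m = d" for l m using that by (auto simp: fun_eq_iff vadd_def)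
  show "(\<lambda>j. if j < length (replicate d 0) then replicate d 0 ! j else 0) = (0 :: nat \<Rightarrow> int)"
    by (auto simp: fun_eq_iff)
  have u: "(\<lambda>j. if j < length (unit_step d i s) then unit_step d i s ! j else 0) = unitv i s" if "i < d" for i s
    using that by (auto simp: fun_eq_iff unit_step_def unitv_def)
  show "(\<lambda>l j. if j < length l then l ! j else 0) ` steps d = units d"
  proof
    show "(\<lambda>l j. if j < length l then l ! j else 0) ` steps d \<subseteq> units d"
      using u by (auto simp: steps_def intro: unitv_in_units)
    show "units d \<subseteq> (\<lambda>l j. if j < length l then l ! j else 0) ` steps d"
    proof
      fix z assume "z \<in> units d"
      then obtain i a where "z = unitv i a" "i < d" "a = 1 \<or> a = -1" by (auto simp: units_def)
      then have "z = (\<lambda>l j. if j < length l then l ! j else 0) (unit_step d i a)" "unit_step d i a \<in> steps d"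
        using u[of i a] by (auto simp: steps_def)
      then show "z \<in> (\<lambda>l j. if j < length l then l ! j else 0) ` steps d" by blast
    qed
  qed
  show "finite (units d)" by (simp add: units_def)
  show "units d \<noteq> {}" using pt_units[OF d] by auto
qed

theorem mainTheorem1:
  shows "(\<exists>c C. c > 0 \<and> C > 0 \<and>
            (\<forall>n::nat. n \<ge> 2 \<longrightarrow>
               c * real n / (log 2 (real n))^2 \<le> entropy2 (range_dist 2 n) \<and>
               entropy2 (range_dist 2 n) \<le> C * real n / (log 2 (real n))^2))
       \<and> (\<forall>d::nat. d \<ge> 3 \<longrightarrow>
            (\<exists>c C. c > 0 \<and> C > 0 \<and>
              (\<forall>n::nat. c * real n \<le> entropy2 (range_dist d n) \<and>
                        entropy2 (range_dist d n) \<le> C * real n)))"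
proof (intro conjI allI impI)
  let ?H = "\<lambda>n. entropy2 (range_dist 2 n)"
  have H: "?H n = entropy2 (map_pmf (visited 0) (pmf_of_set (plane.walks n)))" for n
    by (rule range_dist_plane)
  have H2: "?H 2 > 0"
    unfolding H by (rule plane.entropy_range_pos[of "(1, 0)"]) (auto simp: D2_def zero_prod_def)
  obtain C where C: "C > 0" "\<And>n. n \<ge> 2 \<Longrightarrow> ?H n \<le> C * real n / (log 2 (real n))\<^sup>2"
    using plane_entropy_le unfolding H by blast
  \<comment> \<open>At \<open>n = 2\<close> the logarithm is 1 and there is no block, so the
    constant is capped by half of the entropy there.\<close>
  define c where "c = min (1 / 10 ^ 8) (?H 2 / 2)"
  have "c * real n / (log 2 (real n))\<^sup>2 \<le> ?H n" if "n \<ge> 2" for n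
  proof (cases "n = 2")
    case True
    have "c \<le> ?H 2 / 2" by (simp add: c_def)
    then show ?thesis by (simp add: True)
  next
    case False
    have "c * real n / (log 2 (real n))\<^sup>2 \<le> 1 / 10 ^ 8 * real n / (log 2 (real n))\<^sup>2"
      by (intro divide_right_mono mult_right_mono) (auto simp: c_def)
    also have "\<dots> \<le> ?H n" unfolding H by (rule plane_entropy_ge) (use False that in simp)
    finally show ?thesis .
  qed
  moreover have "c > 0" using H2 by (simp add: c_def)
  ultimately show "\<exists>c C. c > 0 \<and> C > 0 \<and> (\<forall>n::nat. n \<ge> 2 \<longrightarrow>
      c * real n / (log 2 (real n))\<^sup>2 \<le> ?H n \<and> ?H n \<le> C * real n / (log 2 (real n))\<^sup>2)"
    using C by blast
next
  fix d :: nat assume "d \<ge> 3"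
  then show "\<exists>c C. c > 0 \<and> C > 0 \<and> (\<forall>n::nat. c * real n \<le> entropy2 (range_dist d n) \<and>
      entropy2 (range_dist d n) \<le> C * real n)"
    using high_dim_entropy_bounds[of d] by (simp only: range_dist_units)
qed

end
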